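(* Let $\mathfrak{F}$ be a saturated formation of finite soluble groups containing all finite supersoluble groups. Let $\sigma$ be a partition of the set of all primes, let $G$ be a finite group and let $E$ be a normal subgroup of $G$ with $G/E\in\mathfrak{F}$. Suppose that $G$ is a $\sigma$-full group of Sylow type, write $\sigma(G)=\{\sigma_1,\dots,\sigma_t\}$, and let $\mathcal{H}=\{H_1,\dots,H_t\}$ be a complete Hall $\sigma$-set of $G$ such that $H_i$ is a nilpotent $\sigma_i$-subgroup for all $i=1,\dots,t$. If for every $\sigma_i\in\sigma(E)$ such that $H_i\cap E$ is non-cyclic, every maximal subgroup of $H_i\cap E$ has a $\sigma_i$-sylowizer in $G$ that is $c$-permutable in $G$ with every member of $\mathcal{H}$, then $G\in\mathfrak{F}$.
   Context: All groups are finite. $\sigma=\{\sigma_i\mid i\in I\}$ is a partition of the set $\mathbb{P}$ of all primes, i.e. $\mathbb{P}=\bigcup_{i\in I}\sigma_i$ and $\sigma_i\cap\sigma_j=\emptyset$ for $i\neq j$. For a finite group $G$, $\pi(G)$ is the set of primes dividing $|G|$ and $\sigma(G)=\{\sigma_i\mid \sigma_i\cap\pi(G)\neq\emptyset\}$. For a set of primes $\pi$, a $\pi$-number is a positive integer all of whose prime divisors lie in $\pi$; a $\pi$-subgroup is a subgroup whose order is a $\pi$-number; a Hall $\pi$-subgroup of $G$ is a $\pi$-subgroup whose index in $G$ is divisible by no prime in $\pi$. A formation is a class of finite groups, closed under isomorphism, that is closed under quotients and such that $G/(N_1\cap N_2)$ belongs to the class whenever $N_1,N_2\trianglelefteq G$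 and $G/N_1$, $G/N_2$ belong to it. It is saturated if $G/\Phi(G)$ in the class implies $G$ in the class, where $\Phi(G)$ is the Frattini subgroup. Complete Hall $\sigma$-set of $G$: a set of subgroups consisting of exactly one Hall $\sigma_i$-subgroup of $G$ for each $\sigma_i\in\sigma(G)$ (up to including the trivial subgroup); here $H_i$ is the Hall $\sigma_i$-subgroup. $G$ is $\sigma$-full of Sylow type if every subgroup $K$ of $G$ is a $D_{\sigma_i}$-group for every $\sigma_i\in\sigma(K)$, i.e. $K$ has a Hall $\sigma_i$-subgroup, any two Hall $\sigma_i$-subgroups of $K$ are conjugate in $K$, and every $\sigma_i$-subgroup of $K$ is contained in a Hall $\sigma_i$-subgroup of $K$. A $\sigma_i$-sylowizer of a $\sigma_i$-subgroup $R$ in $G$ is a subgroup $S$ of $G$ that is maximal (with respect to inclusion) among the subgroups of $G$ having $R$ as a Hall $\sigma_i$-subgroup. Two subgroups $H$ and $T$ of $G$ are $c$-permutable (conditionally permutable) in $G$ if there exists $x\in G$ such that $HT^x=T^xH$, where $T^x=x^{-1}Tx$. *)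

theory Defs
  imports "HOL-Algebra.Algebra" "HOL-Library.Disjoint_Sets" "HOL-Computational_Algebra.Primes"
begin

section \<open>Classes of finite groups\<close>

text \<open>
  An isomorphism-closed class of finite groups is represented by the set of its members with
  carrier in the natural numbers.  No generality is lost, since every finite group is isomorphic
  to one of these (lemma \<open>finite_group_iso_nat\<close>).  Membership of a group over an
  arbitrary type, such as a quotient group, is membership up to isomorphism.
\<close>

definition in_class :: "nat monoid set \<Rightarrow> ('a, 'b) monoid_scheme \<Rightarrow> bool"
  where "in_class F G \<longleftrightarrow> (\<exists>K\<in>F. G \<cong> K)"

definition group_class :: "nat monoid set \<Rightarrow> bool"
  where "group_class F \<longleftrightarrow>
    (\<forall>G\<in>F. group G \<and> finite (carrier G)) \<and>
    (\<forall>G\<in>F. \<forall>K. group K \<and> G \<cong> K \<longrightarrow> K \<in> F)"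

lemma in_class_nat:
  fixes G :: "nat monoid"
  assumes "group_class F" "group G"
  shows "in_class F G \<longleftrightarrow> G \<in> F"
  using assms iso_refl group.iso_sym unfolding in_class_def group_class_def by blast

lemma finite_group_iso_nat:
  assumes "group G" "finite (carrier G)"
  shows "\<exists>K :: nat monoid. group K \<and> finite (carrier K) \<and> G \<cong> K"
proof -
  interpret group G by fact
  obtain f :: "'a \<Rightarrow> nat" where f: "inj_on f (carrier G)"
    using finite_imp_inj_to_nat_seg[OF assms(2)] by blast
  let ?g = "inv_into (carrier G) f"
  define K :: "nat monoid" where
    "K = \<lparr>carrier = f ` carrier G, monoid.mult = (\<lambda>x y. f (?g x \<otimes>\<^bsub>G\<^esub> ?g y)), one = f \<one>\<^bsub>G\<^esub>\<rparr>"
  have iso: "f \<in> iso G K"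
    using f by (auto simp: K_def iso_def hom_def bij_betw_def)
  have "group (K\<lparr>one := f \<one>\<^bsub>G\<^esub>\<rparr>)"
    by (rule iso_imp_img_group[OF iso])
  then have "group K" by (simp add: K_def)
  moreover have "finite (carrier K)" using assms(2) by (simp add: K_def)
  ultimately show ?thesis using iso is_isoI by blast
qed

definition formation :: "nat monoid set \<Rightarrow> bool"
  where "formation F \<longleftrightarrow>
    group_class F \<and>
    (\<forall>G\<in>F. \<forall>N. N \<lhd> G \<longrightarrow> in_class F (G Mod N)) \<and>
    (\<forall>G :: nat monoid. \<forall>N\<^sub>1 N\<^sub>2.
       group G \<and> finite (carrier G) \<and> N\<^sub>1 \<lhd> G \<and> N\<^sub>2 \<lhd> G \<and>
       in_class F (G Mod N\<^sub>1) \<and> in_class F (G Mod N\<^sub>2) \<longrightarrow> in_class F (G Mod (N\<^sub>1 \<inter> N\<^sub>2)))"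

definition maximal_subgroup :: "'a set \<Rightarrow> ('a, 'b) monoid_scheme \<Rightarrow> bool"
  where "maximal_subgroup M G \<longleftrightarrow>
    subgroup M G \<and> M \<noteq> carrier G \<and>
    (\<forall>K. subgroup K G \<and> M \<subseteq> K \<longrightarrow> K = M \<or> K = carrier G)"

text \<open>The intersection with the carrier makes the Frattini subgroup of the trivial group trivial.\<close>

definition frattini :: "('a, 'b) monoid_scheme \<Rightarrow> 'a set"
  where "frattini G = carrier G \<inter> \<Inter>{M. maximal_subgroup M G}"

definition saturated_formation :: "nat monoid set \<Rightarrow> bool"
  where "saturated_formation F \<longleftrightarrow>
    formation F \<and>
    (\<forall>G :: nat monoid. group G \<and> finite (carrier G) \<and> in_class F (G Mod frattini G) \<longrightarrow> G \<in> F)"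

definition supersoluble :: "('a, 'b) monoid_scheme \<Rightarrow> bool"
  where "supersoluble G \<longleftrightarrow>
    (\<exists>(n :: nat) N. N 0 = {\<one>\<^bsub>G\<^esub>} \<and> N n = carrier G \<and> (\<forall>i\<le>n. N i \<lhd> G) \<and>
      (\<forall>i<n. N i \<subseteq> N (Suc i) \<and> cyclic_group ((G\<lparr>carrier := N (Suc i)\<rparr>) Mod N i)))"

text \<open>The commutator condition says that each factor of the series is central in the quotient.\<close>

definition nilpotent_group :: "('a, 'b) monoid_scheme \<Rightarrow> bool"
  where "nilpotent_group G \<longleftrightarrow>
    (\<exists>(n :: nat) N. N 0 = {\<one>\<^bsub>G\<^esub>} \<and> N n = carrier G \<and> (\<forall>i\<le>n. N i \<lhd> G) \<and>
      (\<forall>i<n. N i \<subseteq> N (Suc i) \<and>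
        (\<forall>x\<in>N (Suc i). \<forall>g\<in>carrier G.
          x \<otimes>\<^bsub>G\<^esub> g \<otimes>\<^bsub>G\<^esub> inv\<^bsub>G\<^esub> x \<otimes>\<^bsub>G\<^esub> inv\<^bsub>G\<^esub> g \<in> N i)))"

section \<open>Hall subgroups and partitions of the primes\<close>

definition pi_number :: "nat set \<Rightarrow> nat \<Rightarrow> bool"
  where "pi_number \<pi> n \<longleftrightarrow> n > 0 \<and> (\<forall>p. Factorial_Ring.prime p \<and> p dvd n \<longrightarrow> p \<in> \<pi>)"

definition pi_subgroup :: "nat set \<Rightarrow> 'a set \<Rightarrow> ('a, 'b) monoid_scheme \<Rightarrow> bool"
  where "pi_subgroup \<pi> H G \<longleftrightarrow> subgroup H G \<and> pi_number \<pi> (card H)"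

definition hall_subgroup :: "nat set \<Rightarrow> 'a set \<Rightarrow> ('a, 'b) monoid_scheme \<Rightarrow> bool"
  where "hall_subgroup \<pi> H G \<longleftrightarrow>
    pi_subgroup \<pi> H G \<and> (\<forall>p\<in>\<pi>. \<not> p dvd card (rcosets\<^bsub>G\<^esub> H))"

definition conj_set :: "('a, 'b) monoid_scheme \<Rightarrow> 'a set \<Rightarrow> 'a \<Rightarrow> 'a set"
  where "conj_set G T x = inv\<^bsub>G\<^esub> x <#\<^bsub>G\<^esub> T #>\<^bsub>G\<^esub> x"

definition D_group :: "nat set \<Rightarrow> ('a, 'b) monoid_scheme \<Rightarrow> bool"
  where "D_group \<pi> G \<longleftrightarrow>
    (\<exists>H. hall_subgroup \<pi> H G) \<and>
    (\<forall>H H'. hall_subgroup \<pi> H G \<and> hall_subgroup \<pi> H' G \<longrightarrow>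
       (\<exists>x\<in>carrier G. H' = conj_set G H x)) \<and>
    (\<forall>U. pi_subgroup \<pi> U G \<longrightarrow> (\<exists>H. hall_subgroup \<pi> H G \<and> U \<subseteq> H))"

text \<open>
  A partition of the primes is a set \<open>\<sigma>\<close> of sets of primes; the blocks \<open>s \<in> \<sigma>\<close>
  themselves play the role of the indexed blocks \<open>\<sigma>\<^sub>i\<close>.
\<close>

definition prime_divisors :: "('a, 'b) monoid_scheme \<Rightarrow> nat set"
  where "prime_divisors G = {p. Factorial_Ring.prime p \<and> p dvd order G}"

definition sigma_of :: "nat set set \<Rightarrow> ('a, 'b) monoid_scheme \<Rightarrow> nat set set"
  where "sigma_of \<sigma> G = {s \<in> \<sigma>. s \<inter> prime_divisors G \<noteq> {}}"

definition sigma_full_sylow_type :: "nat set set \<Rightarrow> ('a, 'b) monoid_scheme \<Rightarrow> bool"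
  where "sigma_full_sylow_type \<sigma> G \<longleftrightarrow>
    (\<forall>K. subgroup K G \<longrightarrow>
      (\<forall>s\<in>sigma_of \<sigma> (G\<lparr>carrier := K\<rparr>). D_group s (G\<lparr>carrier := K\<rparr>)))"

definition complete_hall_set :: "nat set set \<Rightarrow> ('a, 'b) monoid_scheme \<Rightarrow> 'a set set \<Rightarrow> bool"
  where "complete_hall_set \<sigma> G \<H> \<longleftrightarrow>
    (\<forall>H\<in>\<H>. H \<noteq> {\<one>\<^bsub>G\<^esub>} \<longrightarrow> (\<exists>s\<in>sigma_of \<sigma> G. hall_subgroup s H G)) \<and>
    (\<forall>s\<in>sigma_of \<sigma> G. \<exists>!H. H \<in> \<H> \<and> hall_subgroup s H G)"

section \<open>Sylowizers and conditional permutability\<close>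

definition sylowizer :: "nat set \<Rightarrow> 'a set \<Rightarrow> 'a set \<Rightarrow> ('a, 'b) monoid_scheme \<Rightarrow> bool"
  where "sylowizer \<pi> R S G \<longleftrightarrow>
    pi_subgroup \<pi> R G \<and> subgroup S G \<and> hall_subgroup \<pi> R (G\<lparr>carrier := S\<rparr>) \<and>
    (\<forall>T. subgroup T G \<and> hall_subgroup \<pi> R (G\<lparr>carrier := T\<rparr>) \<and> S \<subseteq> T \<longrightarrow> T = S)"

definition c_permutable :: "('a, 'b) monoid_scheme \<Rightarrow> 'a set \<Rightarrow> 'a set \<Rightarrow> bool"
  where "c_permutable G H T \<longleftrightarrow>
    (\<exists>x\<in>carrier G. H <#>\<^bsub>G\<^esub> conj_set G T x = conj_set G T x <#>\<^bsub>G\<^esub> H)"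

end

theory Submission
  imports Defs "HOL-Number_Theory.Residue_Primitive_Roots"
begin

text \<open>
  If \<open>S\<close> is a \<open>\<sigma>\<^sub>i\<close>-sylowizer of \<open>M\<close> and \<open>j \<noteq> i\<close>, then \<open>S\<close> times a suitable conjugate of
  \<open>H\<^sub>j\<close> is a subgroup that still has \<open>M\<close> as a Hall \<open>\<sigma>\<^sub>i\<close>-subgroup, so \<open>S\<close> contains this conjugate by
  maximality.  Hence the index of \<open>S\<close> is a \<open>\<sigma>\<^sub>i\<close>-number, \<open>G = S H\<^sub>i\<close>, and \<open>S \<inter> E\<close> has prime index
  in \<open>E\<close>.  So every maximal subgroup of a non-cyclic Sylow subgroup of \<open>E\<close> lies in a subgroup of
  \<open>E\<close> of index \<open>p\<close>.  For the smallest prime \<open>p\<close> such subgroups are normal, and Tate's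
  criterion makes \<open>E\<close> \<open>p\<close>-nilpotent; for a cyclic Sylow subgroup this is Burnside's transfer theorem.
  By induction \<open>E\<close> has a Sylow tower, so its Sylow subgroup \<open>P\<close> for the largest prime is normal in
  \<open>G\<close>.

  In a minimal counterexample, saturation forces \<open>P\<close> to be a minimal normal subgroup of \<open>G\<close>.  A
  maximal subgroup \<open>M\<close> of \<open>P\<close> that is normalized by \<open>H\<^sub>i\<close> is also normalized by \<open>S\<close>, hence is normal
  in \<open>G = S H\<^sub>i\<close>; thus \<open>M = 1\<close> and \<open>P\<close> has prime order.  If \<open>P\<close> has prime order and a complement,
  then \<open>G\<close> is a subdirect product of \<open>G/P\<close> and a supersoluble group, so it lies in the formation.
\<close>

text \<open>Maximality of a sylowizer is hard to follow into a quotient, so the induction runs on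
  what it implies for one prime at a time: a subgroup \<open>S\<close> with \<open>S H = G\<close>
  and \<open>|E : E \<inter> S| = p\<close>. The hypothesis concerns maximal subgroups of the Hall
  part \<open>H_i \<inter> E\<close>, the argument those of a Sylow \<open>p\<close>-subgroup
  \<open>P\<close> of it; since the rest of a nilpotent group centralizes \<open>P\<close>, every
  maximal subgroup of \<open>P\<close> is the trace of a maximal subgroup of
  \<open>H_i \<inter> E\<close>. As \<open>E\<close> is not known to be soluble, a normal Sylow
  subgroup has to be extracted by transfer rather than from a chief series. Minimality of
  \<open>P\<close> arises as follows. Let \<open>N\<close> be minimal normal in \<open>G\<close>
  inside the centre of \<open>P\<close>. If \<open>N\<close> lies in the Frattini subgroup,
  saturation ends the proof. Otherwise a maximal subgroup \<open>L\<close> supplements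
  \<open>N\<close>, and \<open>P \<inter> L\<close> is normal in \<open>G\<close>, being normalized
  by \<open>L\<close> and centralized by \<open>N\<close>. If it is nontrivial, \<open>G\<close> is
  a subdirect product of \<open>G/N\<close> and \<open>G/(P \<inter> L)\<close>, both in the
  formation by induction; if it is trivial, \<open>P = N\<close>.\<close>

section \<open>Nilpotency, cyclicity and maximality relative to an ambient group\<close>

definition commutator :: "('a, 'b) monoid_scheme \<Rightarrow> 'a \<Rightarrow> 'a \<Rightarrow> 'a"
  where "commutator G x y = x \<otimes>\<^bsub>G\<^esub> y \<otimes>\<^bsub>G\<^esub> inv\<^bsub>G\<^esub> x \<otimes>\<^bsub>G\<^esub> inv\<^bsub>G\<^esub> y"

text \<open>Phrased inside the ambient group, so that images, intersections and subgroups are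
  handled without nested carrier updates. \<open>nilpotent_in_series\<close> recovers that the terms
  lie in \<open>U\<close> and are normalized by it.\<close>

definition nilpotent_in :: "('a, 'b) monoid_scheme \<Rightarrow> 'a set \<Rightarrow> bool"
  where "nilpotent_in G U \<longleftrightarrow> subgroup U G \<and>
    (\<exists>(n :: nat) N. N 0 = {\<one>\<^bsub>G\<^esub>} \<and> N n = U \<and> (\<forall>i\<le>n. subgroup (N i) G) \<and>
      (\<forall>i<n. N i \<subseteq> N (Suc i) \<and> (\<forall>x\<in>N (Suc i). \<forall>g\<in>U. commutator G x g \<in> N i)))"

text \<open>Natural exponents are adequate for elements of finite order;
  \<open>cyclic_in_iff\<close> supplies the link to \<open>cyclic_group\<close> when
  \<open>U\<close> is finite.\<close>

definition cyclic_in :: "('a, 'b) monoid_scheme \<Rightarrow> 'a set \<Rightarrow> bool"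
  where "cyclic_in G U \<longleftrightarrow> subgroup U G \<and> (\<exists>x\<in>U. \<forall>y\<in>U. \<exists>k :: nat. y = x [^]\<^bsub>G\<^esub> k)"

definition maximal_in :: "('a, 'b) monoid_scheme \<Rightarrow> 'a set \<Rightarrow> 'a set \<Rightarrow> bool"
  where "maximal_in G M U \<longleftrightarrow> subgroup M G \<and> M \<subseteq> U \<and> M \<noteq> U \<and>
    (\<forall>K. subgroup K G \<and> M \<subseteq> K \<and> K \<subseteq> U \<longrightarrow> K = M \<or> K = U)"

lemma (in group) subgroup_restrict_iff:
  assumes "subgroup U G"
  shows "subgroup K (G\<lparr>carrier := U\<rparr>) \<longleftrightarrow> subgroup K G \<and> K \<subseteq> U"
proof
  assume "subgroup K (G\<lparr>carrier := U\<rparr>)"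
  then show "subgroup K G \<and> K \<subseteq> U"
    using incl_subgroup[OF assms] subgroup.subset[of K "G\<lparr>carrier := U\<rparr>"] by simp
next
  assume "subgroup K G \<and> K \<subseteq> U"
  then show "subgroup K (G\<lparr>carrier := U\<rparr>)"
    using subgroup_incl assms by blast
qed

lemma (in group) maximal_in_iff:
  assumes "subgroup U G"
  shows "maximal_subgroup M (G\<lparr>carrier := U\<rparr>) \<longleftrightarrow> maximal_in G M U"
  unfolding maximal_subgroup_def maximal_in_def
  using subgroup_restrict_iff[OF assms] by auto

lemma (in group) nilpotent_in_if:
  assumes "subgroup U G" "nilpotent_group (G\<lparr>carrier := U\<rparr>)"
  shows "nilpotent_in G U"
proof -
  obtain n :: nat and N where N: "N 0 = {\<one>}" "N n = U" "\<And>i. i \<le> n \<Longrightarrow> N i \<lhd> (G\<lparr>carrier := U\<rparr>)"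
      "\<And>i. i < n \<Longrightarrow> N i \<subseteq> N (Suc i)"
      "\<And>i x g. i < n \<Longrightarrow> x \<in> N (Suc i) \<Longrightarrow> g \<in> U \<Longrightarrow>
        x \<otimes> g \<otimes> inv\<^bsub>G\<lparr>carrier := U\<rparr>\<^esub> x \<otimes> inv\<^bsub>G\<lparr>carrier := U\<rparr>\<^esub> g \<in> N i"
    using assms(2) unfolding nilpotent_group_def by auto
  have sub: "subgroup (N i) G \<and> N i \<subseteq> U" if "i \<le> n" for i
    using subgroup_restrict_iff[OF assms(1)] normal_imp_subgroup[OF N(3)[OF that]] by blast
  have "commutator G x g \<in> N i" if "i < n" "x \<in> N (Suc i)" "g \<in> U" for i x g
  proof -
    have "x \<in> U" using sub[of "Suc i"] that by auto
    then show ?thesis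
      using N(5)[OF that] that(3) m_inv_consistent[OF assms(1)] unfolding commutator_def by simp
  qed
  then show ?thesis
    unfolding nilpotent_in_def using assms(1) N(1,2,4) sub
    by (intro conjI exI[of _ n] exI[of _ N]) auto
qed

lemma (in group) cyclic_in_iff:
  assumes "subgroup U G" "finite U"
  shows "cyclic_group (G\<lparr>carrier := U\<rparr>) \<longleftrightarrow> cyclic_in G U"
proof -
  interpret U: group "G\<lparr>carrier := U\<rparr>"
    using assms(1) subgroup_imp_group by blast
  have pow: "x [^]\<^bsub>G\<lparr>carrier := U\<rparr>\<^esub> (k::int) = x [^] k" if "x \<in> U" for x k
    using int_pow_consistent[OF assms(1) that] by simp
  have powX: "x [^] (k::nat) \<in> U" if "x \<in> U" for x k
    using subgroup_int_pow_closed[OF assms(1) that, of "int k"] by (simp add: int_pow_int)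
  have powXi: "x [^] (k::int) \<in> U" if "x \<in> U" for x k
    using subgroup_int_pow_closed[OF assms(1) that, of k] .
  have nat: "\<exists>m::nat. x [^] (k::int) = x [^] m" if "x \<in> U" for x k
  proof -
    have xc: "x \<in> carrier G" using that subgroup.mem_carrier[OF assms(1)] by blast
    have "\<exists>n>0. x [^] (n::nat) = \<one>"
    proof -
      have "finite (range (\<lambda>n::nat. x [^] n))"
        using powX[OF that] assms(2) by (meson finite_subset image_subsetI)
      then have "\<not> inj (\<lambda>n::nat. x [^] n)"
        using finite_imageD infinite_UNIV_nat by blast
      then obtain a b :: nat where ab: "a < b" "x [^] a = x [^] b"
        by (metis injI nat_neq_iff)
      then have "x [^] (b - a) = \<one>" using pow_eq_div2[OF xc ab(2)[symmetric]] by simp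
      then show ?thesis using ab by (intro exI[of _ "b-a"]) auto
    qed
    then obtain n::nat where n: "n > 0" "x [^] n = \<one>" by blast
    \<comment> \<open>Reducing modulo an exponent \<open>n\<close> that kills \<open>x\<close> makes
      an integer exponent non-negative.\<close>
    have "x [^] k = x [^] (k mod int n)"
    proof -
      have "x [^] k = x [^] (int n * (k div int n) + k mod int n)" by simp
      also have "\<dots> = (x [^] int n) [^] (k div int n) \<otimes> x [^] (k mod int n)"
        by (simp only: int_pow_mult[OF xc] int_pow_pow[OF xc])
      also have "\<dots> = x [^] (k mod int n)" using n xc by (simp add: int_pow_int)
      finally show ?thesis .
    qed
    moreover have "k mod int n = int (nat (k mod int n))" using n by simp
    ultimately show ?thesis using int_pow_int by metis
  qed
  have "cyclic_group (G\<lparr>carrier := U\<rparr>) \<longleftrightarrow> (\<exists>x\<in>U. U = range (\<lambda>n::int. x [^] n))"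
    unfolding U.cyclic_group using pow by simp
  also have "\<dots> \<longleftrightarrow> (\<exists>x\<in>U. \<forall>y\<in>U. \<exists>k::nat. y = x [^] k)"
  proof (intro bex_cong refl iffI ballI)
    fix x y assume "x \<in> U" "U = range (\<lambda>n::int. x [^] n)" "y \<in> U"
    then obtain n :: int where "y = x [^] n" by blast
    then show "\<exists>k::nat. y = x [^] k" using nat[OF \<open>x \<in> U\<close>] by blast
  next
    fix x assume x: "x \<in> U" and gen: "\<forall>y\<in>U. \<exists>k::nat. y = x [^] k"
    show "U = range (\<lambda>n::int. x [^] n)"
    proof
      show "U \<subseteq> range (\<lambda>n::int. x [^] n)"
      proof
        fix y assume "y \<in> U"
        then obtain k :: nat where "y = x [^] k" using gen by blast
        then have "y = x [^] int k" by (simp add: int_pow_int)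
        then show "y \<in> range (\<lambda>n::int. x [^] n)" by blast
      qed
    qed (use powXi[OF x] in blast)
  qed
  finally show ?thesis unfolding cyclic_in_def using assms(1) by simp
qed

text \<open>Double counting of \<open>A \<times> B\<close> along the product map: the fibre over
  \<open>a \<otimes> b\<close> consists of the pairs
  \<open>(a \<otimes> d, inv d \<otimes> b)\<close> with \<open>d\<close> in the
  intersection.\<close>

lemma (in group) card_set_mult:
  assumes A: "subgroup A G" and B: "subgroup B G" and fin: "finite (carrier G)"
  shows "card (A <#> B) * card (A \<inter> B) = card A * card B"
proof -
  have fA: "finite A" "finite B" using assms subgroup.subset finite_subset by metis+
  have cA: "x \<in> carrier G" if "x \<in> A" for x using that subgroup.mem_carrier[OF A] by blast
  have cB: "x \<in> carrier G" if "x \<in> B" for x using that subgroup.mem_carrier[OF B] by blast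
  have AB: "A <#> B = (\<lambda>(a,b). a \<otimes> b) ` (A \<times> B)" unfolding set_mult_def by auto
  have fib: "card {z \<in> A \<times> B. (case z of (a,b) \<Rightarrow> a \<otimes> b) = y} = card (A \<inter> B)" if y: "y \<in> A <#> B" for y
  proof -
    obtain a b where ab: "a \<in> A" "b \<in> B" "y = a \<otimes> b" using y unfolding AB by auto
    have "bij_betw (\<lambda>d. (a \<otimes> d, inv d \<otimes> b)) (A \<inter> B) {z \<in> A \<times> B. (case z of (a,b) \<Rightarrow> a \<otimes> b) = y}"
    proof (rule bij_betwI[where g = "\<lambda>(u,v). inv a \<otimes> u"])
      show "(\<lambda>d. (a \<otimes> d, inv d \<otimes> b)) \<in> A \<inter> B \<rightarrow> {z \<in> A \<times> B. (case z of (a,b) \<Rightarrow> a \<otimes> b) = y}"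
      proof
        fix d assume d: "d \<in> A \<inter> B"
        have "a \<otimes> d \<otimes> (inv d \<otimes> b) = a \<otimes> b"
          using ab cA cB d by (metis Int_iff inv_closed m_assoc m_closed r_inv r_one)
        then show "(a \<otimes> d, inv d \<otimes> b) \<in> {z \<in> A \<times> B. (case z of (a,b) \<Rightarrow> a \<otimes> b) = y}"
          using d ab A B by (auto simp: subgroup.m_closed subgroup.m_inv_closed)
      qed
    next
      show "(\<lambda>(u,v). inv a \<otimes> u) \<in> {z \<in> A \<times> B. (case z of (a,b) \<Rightarrow> a \<otimes> b) = y} \<rightarrow> A \<inter> B"
      proof
        fix z assume z: "z \<in> {z \<in> A \<times> B. (case z of (a,b) \<Rightarrow> a \<otimes> b) = y}"
        then obtain u v where uv: "z = (u,v)" "u \<in> A" "v \<in> B" "u \<otimes> v = a \<otimes> b" using ab by auto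
        have "inv a \<otimes> u = b \<otimes> inv v"
          using uv ab cA cB by (metis inv_solve_left' inv_solve_right m_assoc m_closed inv_closed)
        then show "(case z of (u,v) \<Rightarrow> inv a \<otimes> u) \<in> A \<inter> B"
          using uv ab A B by (auto simp: subgroup.m_closed subgroup.m_inv_closed) (metis subgroup.m_closed subgroup.m_inv_closed)
      qed
    next
      fix d assume "d \<in> A \<inter> B"
      then show "(case (a \<otimes> d, inv d \<otimes> b) of (u,v) \<Rightarrow> inv a \<otimes> u) = d"
        using ab cA by (simp add: m_assoc[symmetric])
    next
      fix z assume z: "z \<in> {z \<in> A \<times> B. (case z of (a,b) \<Rightarrow> a \<otimes> b) = y}"
      then obtain u v where uv: "z = (u,v)" "u \<in> A" "v \<in> B" "u \<otimes> v = a \<otimes> b" using ab by auto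
      have c: "u \<in> carrier G" "v \<in> carrier G" "a \<in> carrier G" "b \<in> carrier G" using uv ab cA cB by auto
      have "a \<otimes> (inv a \<otimes> u) = u" using c by (simp add: m_assoc[symmetric])
      moreover have "inv (inv a \<otimes> u) \<otimes> b = v"
      proof -
        have "inv (inv a \<otimes> u) \<otimes> b = inv u \<otimes> (a \<otimes> b)" using c by (simp add: inv_mult_group m_assoc)
        also have "\<dots> = v" using c uv(4) by (metis inv_solve_left m_closed)
        finally show ?thesis .
      qed
      ultimately show "(a \<otimes> (case z of (u,v) \<Rightarrow> inv a \<otimes> u), inv (case z of (u,v) \<Rightarrow> inv a \<otimes> u) \<otimes> b) = z"
        using uv by simp
    qed
    then show ?thesis by (simp add: bij_betw_same_card)
  qed
  have "card (A \<times> B) = (\<Sum>y\<in>A <#> B. card {z \<in> A \<times> B. (case z of (a,b) \<Rightarrow> a \<otimes> b) = y})"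
    using fA AB by (subst card_eq_sum, subst sum.image_gen[where g = "\<lambda>(a,b). a \<otimes> b"]) auto
  then show ?thesis using fib by (simp add: card_cartesian_product)
qed

section \<open>Nilpotent subgroups\<close>

lemma (in group) inv_cancel_left [simp]:
  assumes "x \<in> carrier G" "y \<in> carrier G"
  shows "inv x \<otimes> (x \<otimes> y) = y" "x \<otimes> (inv x \<otimes> y) = y"
  using assms by (simp_all add: m_assoc[symmetric])

lemma (in group_hom) subgroup_vimage:
  assumes "subgroup T H"
  shows "subgroup {x \<in> carrier G. h x \<in> T} G"
proof (rule G.subgroupI)
  show "{x \<in> carrier G. h x \<in> T} \<noteq> {}"
    using subgroup.one_closed[OF assms] hom_one by (metis (mono_tags, lifting) G.one_closed empty_iff mem_Collect_eq)
qed (use assms in \<open>auto simp: subgroup.m_closed subgroup.m_inv_closed\<close>)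

text \<open>Because \<open>S\<close> contains the kernel, each fibre of \<open>h\<close> on
  \<open>S\<close> is a full coset of the kernel.\<close>

lemma (in group_hom) card_subgroup_image:
  assumes S: "subgroup S G" and ker: "kernel G H h \<subseteq> S" and fin: "finite (carrier G)"
  shows "card S = card (kernel G H h) * card (h ` S)"
proof -
  have Sc: "S \<subseteq> carrier G" using subgroup.subset[OF S] .
  have fS: "finite S" using Sc fin finite_subset by blast
  have fib: "card {x \<in> S. h x = y} = card (kernel G H h)" if y: "y \<in> h ` S" for y
  proof -
    obtain s where s: "s \<in> S" "y = h s" using y by blast
    have sc: "s \<in> carrier G" using s Sc by blast
    have "bij_betw (\<lambda>k. k \<otimes> s) (kernel G H h) {x \<in> S. h x = y}"
    proof (rule bij_betwI[where g = "\<lambda>x. x \<otimes> inv s"])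
      show "(\<lambda>k. k \<otimes> s) \<in> kernel G H h \<rightarrow> {x \<in> S. h x = y}"
        using ker s sc subgroup.m_closed[OF S] by (auto simp: kernel_def)
      show "(\<lambda>x. x \<otimes> inv s) \<in> {x \<in> S. h x = y} \<rightarrow> kernel G H h"
        using s sc Sc by (auto simp: kernel_def)
    qed (use sc Sc in \<open>auto simp: kernel_def G.m_assoc\<close>)
    then show ?thesis by (simp add: bij_betw_same_card)
  qed
  have "card S = (\<Sum>y\<in>h ` S. card {x \<in> S. h x = y})"
    using fS by (subst card_eq_sum, subst sum.image_gen[where g = h]) auto
  then show ?thesis using fib by simp
qed

text \<open>Moving \<open>y\<close> past one factor \<open>x\<close> costs one factor
  \<open>c\<close>, and \<open>c\<close> commutes with everything in sight, so the costs accumulate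
  to \<open>c [^] k\<close>. This is the bilinearity of a central commutator.\<close>

lemma (in group) commutator_pow:
  assumes x: "x \<in> carrier G" and y: "y \<in> carrier G" and c: "c = commutator G x y"
    and cx: "c \<otimes> x = x \<otimes> c" and cy: "c \<otimes> y = y \<otimes> c"
  shows "x [^] (k::nat) \<otimes> y = c [^] k \<otimes> y \<otimes> x [^] k"
    and "x \<otimes> y [^] (k::nat) = c [^] k \<otimes> y [^] k \<otimes> x"
proof -
  have cc: "c \<in> carrier G" using x y c unfolding commutator_def by simp
  have xy: "x \<otimes> y = c \<otimes> y \<otimes> x"
    unfolding c commutator_def using x y by (simp add: m_assoc)
  have ckx: "c [^] j \<otimes> x = x \<otimes> c [^] j" and cky: "c [^] j \<otimes> y = y \<otimes> c [^] j" for j :: nat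
    using group_commutes_pow[OF cx cc x] group_commutes_pow[OF cy cc y] by auto
  show "x [^] (k::nat) \<otimes> y = c [^] k \<otimes> y \<otimes> x [^] k"
  proof (induction k)
    case (Suc k)
    have "x [^] Suc k \<otimes> y = x [^] k \<otimes> (c \<otimes> y \<otimes> x)" using x y xy by (simp add: m_assoc)
    also have "\<dots> = c \<otimes> (x [^] k \<otimes> y) \<otimes> x"
      using x y cc group_commutes_pow[OF cx[symmetric] x cc, of k] by (simp add: m_assoc[symmetric])
    also have "\<dots> = c [^] Suc k \<otimes> y \<otimes> x [^] Suc k"
      unfolding Suc using x y cc nat_pow_comm[of c k 1] by (simp add: m_assoc nat_pow_Suc2)
    finally show ?case .
  qed (use x y in simp)
  show "x \<otimes> y [^] (k::nat) = c [^] k \<otimes> y [^] k \<otimes> x"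
  proof (induction k)
    case (Suc k)
    have "x \<otimes> y [^] Suc k = c [^] k \<otimes> y [^] k \<otimes> (x \<otimes> y)"
      using x y cc Suc by (simp add: m_assoc[symmetric])
    also have "\<dots> = c [^] k \<otimes> (y [^] k \<otimes> c) \<otimes> y \<otimes> x" unfolding xy using x y cc by (simp add: m_assoc)
    also have "\<dots> = c [^] Suc k \<otimes> y [^] Suc k \<otimes> x"
      using x y cc group_commutes_pow[OF cy[symmetric] y cc, of k] by (simp add: m_assoc)
    finally show ?case .
  qed (use x y in simp)
qed

lemma (in group) pow_coprime_one:
  assumes "x \<in> carrier G" "x [^] (m::nat) = \<one>" "x [^] (n::nat) = \<one>" "coprime m n"
  shows "x = \<one>"
proof -
  have "ord x dvd m" "ord x dvd n" using assms pow_eq_id by auto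
  then have "ord x = 1" using assms(4) by (meson coprime_common_divisor_nat nat_dvd_1_iff_1)
  then show ?thesis using ord_eq_1 assms(1) by blast
qed

text \<open>The working form of nilpotency: containment in \<open>U\<close> and invariance under
  conjugation are included, so that \<open>U\<close> can be factored by any term.\<close>

definition central_series :: "('a, 'b) monoid_scheme \<Rightarrow> (nat \<Rightarrow> 'a set) \<Rightarrow> nat \<Rightarrow> 'a set \<Rightarrow> bool"
  where "central_series G N n U \<longleftrightarrow> N 0 = {\<one>\<^bsub>G\<^esub>} \<and> N n = U \<and>
    (\<forall>i\<le>n. subgroup (N i) G \<and> N i \<subseteq> U) \<and>
    (\<forall>i<n. N i \<subseteq> N (Suc i) \<and> (\<forall>x\<in>N (Suc i). \<forall>g\<in>U. commutator G x g \<in> N i)) \<and>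
    (\<forall>i\<le>n. \<forall>x\<in>N i. \<forall>g\<in>U. g \<otimes>\<^bsub>G\<^esub> x \<otimes>\<^bsub>G\<^esub> inv\<^bsub>G\<^esub> g \<in> N i)"

lemma (in group) central_seriesD:
  assumes "central_series G N n U"
  shows "N 0 = {\<one>}" "N n = U" "\<And>i. i \<le> n \<Longrightarrow> subgroup (N i) G"
    "\<And>i. i \<le> n \<Longrightarrow> N i \<subseteq> U"
    "\<And>i. i < n \<Longrightarrow> N i \<subseteq> N (Suc i)"
    "\<And>i x g. i < n \<Longrightarrow> x \<in> N (Suc i) \<Longrightarrow> g \<in> U \<Longrightarrow> commutator G x g \<in> N i"
    "\<And>i x g. i \<le> n \<Longrightarrow> x \<in> N i \<Longrightarrow> g \<in> U \<Longrightarrow> g \<otimes> x \<otimes> inv g \<in> N i"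
  using assms unfolding central_series_def by auto

text \<open>Containment in \<open>U\<close> descends from the top term. Conjugation invariance comes
  from the identity that the conjugate of \<open>x\<close> by \<open>g\<close> is \<open>x\<close>
  times the commutator of \<open>inv x\<close> and \<open>g\<close>.\<close>

lemma (in group) nilpotent_in_series:
  assumes "nilpotent_in G U"
  shows "\<exists>N n. central_series G N n U"
proof -
  obtain N and n :: nat where N: "N 0 = {\<one>}" "N n = U" "\<And>i. i \<le> n \<Longrightarrow> subgroup (N i) G"
    "\<And>i. i < n \<Longrightarrow> N i \<subseteq> N (Suc i)"
    "\<And>i x g. i < n \<Longrightarrow> x \<in> N (Suc i) \<Longrightarrow> g \<in> U \<Longrightarrow> commutator G x g \<in> N i"
    using assms unfolding nilpotent_in_def by auto
  have sub: "N (n - i) \<subseteq> U" for i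
  proof (induction i)
    case (Suc i)
    then show ?case using N(4)[of "n - Suc i"] by (cases "i < n") (auto simp: Suc_diff_Suc)
  qed (simp add: N)
  have sub: "N i \<subseteq> U" if "i \<le> n" for i using sub[of "n - i"] that by simp
  have "g \<otimes> x \<otimes> inv g \<in> N i" if i: "i \<le> n" and x: "x \<in> N i" and g: "g \<in> U" for i x g
  proof -
    have gc: "g \<in> carrier G" using g assms subgroup.mem_carrier unfolding nilpotent_in_def by metis
    have xc: "x \<in> carrier G" using x N(3)[OF i] subgroup.mem_carrier by metis
    show ?thesis
    proof (cases i)
      case 0 then show ?thesis using x gc N(1) by simp
    next
      case (Suc j)
      have ix: "inv x \<in> N i" using x N(3)[OF i] subgroup.m_inv_closed by metis
      have "commutator G (inv x) g \<in> N i" using N(4,5)[of j] ix Suc i g by auto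
      then have "x \<otimes> commutator G (inv x) g \<in> N i" using N(3)[OF i] x subgroup.m_closed by metis
      moreover have "x \<otimes> commutator G (inv x) g = g \<otimes> x \<otimes> inv g"
        unfolding commutator_def using xc gc by (simp add: m_assoc[symmetric])
      ultimately show ?thesis by simp
    qed
  qed
  then have "central_series G N n U"
    unfolding central_series_def using N sub by auto
  then show ?thesis by blast
qed

text \<open>The commutator of \<open>x\<close> and \<open>y\<close> is pushed down the central
  series. Modulo \<open>N i\<close> it is central, hence bilinear, so both \<open>k\<close> and
  \<open>l\<close> kill it there; coprimality puts it into \<open>N i\<close>.\<close>

lemma (in group) nilpotent_in_commute:
  assumes nil: "nilpotent_in G U" and x: "x \<in> U" and y: "y \<in> U"
    and pows: "x [^] (k::nat) = \<one>" "y [^] (l::nat) = \<one>" "coprime k l"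
  shows "x \<otimes> y = y \<otimes> x"
proof -
  obtain N n where "central_series G N n U"
    using nilpotent_in_series[OF nil] by blast
  note N = central_seriesD[OF this]
  have U: "subgroup U G" using nil unfolding nilpotent_in_def by blast
  interpret XG: group "G\<lparr>carrier := U\<rparr>" using U subgroup_imp_group by blast
  have cX: "z \<in> carrier G" if "z \<in> U" for z using that subgroup.mem_carrier[OF U] by blast
  let ?c = "commutator G x y"
  have cin: "?c \<in> U" unfolding commutator_def using x y U by (simp add: subgroup.m_closed subgroup.m_inv_closed)
  have step: "?c \<in> N i" if i: "i < n" and c: "?c \<in> N (Suc i)" for i
  proof -
    have sub: "subgroup (N i) (G\<lparr>carrier := U\<rparr>)" using subgroup_restrict_iff[OF U] N(3,4) i by simp
    have norm: "N i \<lhd> (G\<lparr>carrier := U\<rparr>)"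
      using XG.normal_invI[OF sub] N(7)[of i] i m_inv_consistent[OF U] by simp
    then interpret Ni: normal "N i" "G\<lparr>carrier := U\<rparr>" .
    interpret Q: group "G\<lparr>carrier := U\<rparr> Mod N i" using Ni.factorgroup_is_group .
    let ?Q = "G\<lparr>carrier := U\<rparr> Mod N i"
    let ?f = "\<lambda>z. N i #>\<^bsub>G\<lparr>carrier := U\<rparr>\<^esub> z"
    interpret f: group_hom "G\<lparr>carrier := U\<rparr>" "G\<lparr>carrier := U\<rparr> Mod N i" ?f
      using Ni.r_coset_hom_Mod by unfold_locales
    have one: "z \<in> N i" if "z \<in> U" "?f z = \<one>\<^bsub>G\<lparr>carrier := U\<rparr> Mod N i\<^esub>" for z
      using that XG.rcos_self[OF _ sub, of z] by simp
    have oneI: "?f z = \<one>\<^bsub>G\<lparr>carrier := U\<rparr> Mod N i\<^esub>" if "z \<in> N i" for z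
      using that Ni.rcos_const[OF XG.group_axioms] by simp
    have com: "?f ?c \<otimes>\<^bsub>G\<lparr>carrier := U\<rparr> Mod N i\<^esub> ?f g = ?f g \<otimes>\<^bsub>G\<lparr>carrier := U\<rparr> Mod N i\<^esub> ?f ?c"
      if g: "g \<in> U" for g
    proof -
      have "commutator G ?c g \<in> N i" using N(6)[OF i c g] .
      moreover have "?c \<otimes> g = commutator G ?c g \<otimes> (g \<otimes> ?c)"
        unfolding commutator_def[of G ?c g] using cX[OF cin] cX[OF g] by (simp add: m_assoc)
      moreover have "commutator G ?c g \<in> U" using calculation(1) N(4)[of i] i by auto
      ultimately have "?f (?c \<otimes> g) = \<one>\<^bsub>G\<lparr>carrier := U\<rparr> Mod N i\<^esub> \<otimes>\<^bsub>G\<lparr>carrier := U\<rparr> Mod N i\<^esub> ?f (g \<otimes> ?c)"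
        using f.hom_mult[of "commutator G ?c g" "g \<otimes> ?c"] oneI g cin U by (simp add: subgroup.m_closed)
      then show ?thesis using f.hom_mult[of ?c g] f.hom_mult[of g ?c] Q.l_one[OF f.hom_closed[of "g \<otimes> ?c"]] g cin U
        by (simp add: subgroup.m_closed del: f.hom_closed mult_FactGroup)
    qed
    have fc: "?f ?c = commutator (G\<lparr>carrier := U\<rparr> Mod N i) (?f x) (?f y)"
      unfolding commutator_def using x y U f.hom_mult f.hom_inv m_inv_consistent[OF U]
      by (simp add: subgroup.m_closed subgroup.m_inv_closed del: mult_FactGroup f.hom_mult f.hom_inv flip: f.hom_mult f.hom_inv)
    have fX: "?f x \<in> carrier (G\<lparr>carrier := U\<rparr> Mod N i)" "?f y \<in> carrier (G\<lparr>carrier := U\<rparr> Mod N i)"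
      "?f ?c \<in> carrier (G\<lparr>carrier := U\<rparr> Mod N i)"
      using x y cin f.hom_closed by simp_all
    have p1: "?f x [^]\<^bsub>G\<lparr>carrier := U\<rparr> Mod N i\<^esub> k = \<one>\<^bsub>G\<lparr>carrier := U\<rparr> Mod N i\<^esub>"
      using f.hom_nat_pow[of x k] x pows(1) nat_pow_consistent[of x k U] f.hom_one by simp
    have p2: "?f y [^]\<^bsub>G\<lparr>carrier := U\<rparr> Mod N i\<^esub> l = \<one>\<^bsub>G\<lparr>carrier := U\<rparr> Mod N i\<^esub>"
      using f.hom_nat_pow[of y l] y pows(2) nat_pow_consistent[of y l U] f.hom_one by simp
    have "?f ?c [^]\<^bsub>G\<lparr>carrier := U\<rparr> Mod N i\<^esub> k = \<one>\<^bsub>G\<lparr>carrier := U\<rparr> Mod N i\<^esub>"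
    proof -
      have "?f ?c [^]\<^bsub>?Q\<^esub> k \<otimes>\<^bsub>?Q\<^esub> ?f y = \<one>\<^bsub>?Q\<^esub> \<otimes>\<^bsub>?Q\<^esub> ?f y"
        using Q.commutator_pow(1)[OF fX(1,2) fc com[OF x] com[OF y], of k] p1
          Q.r_one Q.l_one Q.nat_pow_closed fX by (simp del: one_FactGroup mult_FactGroup)
      then show ?thesis using Q.right_cancel Q.nat_pow_closed Q.one_closed fX by blast
    qed
    moreover have "?f ?c [^]\<^bsub>G\<lparr>carrier := U\<rparr> Mod N i\<^esub> l = \<one>\<^bsub>G\<lparr>carrier := U\<rparr> Mod N i\<^esub>"
    proof -
      have "?f ?c [^]\<^bsub>?Q\<^esub> l \<otimes>\<^bsub>?Q\<^esub> ?f x = \<one>\<^bsub>?Q\<^esub> \<otimes>\<^bsub>?Q\<^esub> ?f x"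
        using Q.commutator_pow(2)[OF fX(1,2) fc com[OF x] com[OF y], of l] p2
          Q.r_one Q.l_one Q.nat_pow_closed fX by (simp del: one_FactGroup mult_FactGroup)
      then show ?thesis using Q.right_cancel Q.nat_pow_closed Q.one_closed fX by blast
    qed
    ultimately have "?f ?c = \<one>\<^bsub>G\<lparr>carrier := U\<rparr> Mod N i\<^esub>"
      using Q.pow_coprime_one fX(3) pows(3) by blast
    then show ?thesis using one cin by blast
  qed
  have "?c \<in> N (n - i)" if "i \<le> n" for i
    using that
  proof (induction i)
    case 0 then show ?case using cin N(2) by simp
  next
    case (Suc i) then show ?case using step[of "n - Suc i"] by (simp add: Suc_diff_Suc)
  qed
  from this[of n] have "?c = \<one>" using N(1) by simp
  then show ?thesis unfolding commutator_def using cX[OF x] cX[OF y]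
    by (metis inv_closed inv_mult_group inv_equality inv_inv m_assoc m_closed)
qed

lemma (in group) nilpotent_in_imp_subgroup: "nilpotent_in G U \<Longrightarrow> subgroup U G"
  unfolding nilpotent_in_def by blast

text \<open>\<open>L\<close> is cut out of \<open>K\<close> by the last term of the central series
  that does not contain \<open>K\<close>. The result is the proper inclusion
  \<open>[K, U] < K\<close> for nontrivial normal subgroups of a nilpotent group.\<close>

lemma (in group) nilpotent_descends:
  assumes nil: "nilpotent_in G U" and K: "subgroup K G" "K \<subseteq> U" "K \<noteq> {\<one>}"
    and inv: "\<And>k u. k \<in> K \<Longrightarrow> u \<in> U \<Longrightarrow> u \<otimes> k \<otimes> inv u \<in> K"
  obtains L where "subgroup L G" "L \<subset> K" "\<And>k u. k \<in> K \<Longrightarrow> u \<in> U \<Longrightarrow> commutator G k u \<in> L"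
proof -
  obtain N n where "central_series G N n U"
    using nilpotent_in_series[OF nil] by blast
  note N = central_seriesD[OF this]
  define i where "i = (LEAST i. K \<subseteq> N i)"
  have Ki: "K \<subseteq> N i" unfolding i_def using N(2) K(2) by (metis LeastI)
  have in': "i \<le> n" unfolding i_def using N(2) K(2) by (metis Least_le)
  have "i \<noteq> 0" using Ki N(1) K(1,3) subgroup.one_closed by (metis subset_singletonD empty_iff)
  then obtain j where j: "i = Suc j" by (cases i) auto
  have nKj: "\<not> K \<subseteq> N j" using not_less_Least[of j "\<lambda>i. K \<subseteq> N i"] j i_def by auto
  show thesis
  proof
    show "subgroup (K \<inter> N j) G" using subgroups_Inter_pair K(1) N(3) in' j by simp
    show "K \<inter> N j \<subset> K" using nKj by blast
    fix k u assume k: "k \<in> K" and u: "u \<in> U"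
    have c: "k \<in> carrier G" "u \<in> carrier G"
      using k u K(2) subgroup.mem_carrier[OF nilpotent_in_imp_subgroup[OF nil]] by auto
    have "commutator G k u = k \<otimes> (u \<otimes> inv k \<otimes> inv u)"
      unfolding commutator_def using c by (simp add: m_assoc)
    then have "commutator G k u \<in> K"
      using inv[OF subgroup.m_inv_closed[OF K(1) k] u] k K(1) subgroup.m_closed by metis
    moreover have "commutator G k u \<in> N j" using N(6)[of j k u] k u Ki in' j by auto
    ultimately show "commutator G k u \<in> K \<inter> N j" by blast
  qed
qed

lemma (in group) conj_eq_commutator:
  assumes "k \<in> carrier G" "u \<in> carrier G"
  shows "u \<otimes> k \<otimes> inv u = k \<otimes> commutator G (inv k) u"
  unfolding commutator_def using assms by (simp add: m_assoc[symmetric])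

lemma (in group) maximal_inD:
  assumes "maximal_in G M U"
  shows "subgroup M G" "M \<subseteq> U" "M \<noteq> U" "\<And>K. subgroup K G \<Longrightarrow> M \<subseteq> K \<Longrightarrow> K \<subseteq> U \<Longrightarrow> K = M \<or> K = U"
  using assms unfolding maximal_in_def by auto

lemma (in group) maximal_in_exists:
  assumes L: "subgroup L G" "L \<subset> U" and U: "finite U"
  obtains M where "maximal_in G M U" "L \<subseteq> M"
proof -
  let ?S = "{K. subgroup K G \<and> L \<subseteq> K \<and> K \<subset> U}"
  have "finite ?S" using U by (rule_tac finite_subset[of _ "Pow U"]) auto
  moreover have "L \<in> ?S" using L by blast
  ultimately obtain M where M: "M \<in> ?S" "\<And>K. K \<in> ?S \<Longrightarrow> M \<subseteq> K \<Longrightarrow> K = M"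
    by (metis (no_types, lifting) finite_has_maximal empty_iff)
  have "maximal_in G M U" unfolding maximal_in_def using M by blast
  then show thesis using that M by blast
qed

lemma (in group) normal_in_restrictI:
  assumes U: "subgroup U G" and M: "subgroup M G" "M \<subseteq> U"
    and inv: "\<And>m u. m \<in> M \<Longrightarrow> u \<in> U \<Longrightarrow> u \<otimes> m \<otimes> inv u \<in> M"
  shows "M \<lhd> (G\<lparr>carrier := U\<rparr>)"
proof -
  interpret U: group "G\<lparr>carrier := U\<rparr>" using U subgroup_imp_group by blast
  show ?thesis
    using U.normal_invI[of M] subgroup_restrict_iff[OF U, of M] M inv m_inv_consistent[OF U] by simp
qed

text \<open>The first term \<open>N i\<close> not inside \<open>M\<close> normalizes
  \<open>M\<close>, because its commutators with \<open>U\<close> fall into the preceding term,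
  which lies in \<open>M\<close>. By maximality the normalizer of \<open>M\<close> is then all of
  \<open>U\<close>.\<close>

lemma (in group) nilpotent_maximal_normal:
  assumes nil: "nilpotent_in G U" and M: "maximal_in G M U" and m: "m \<in> M" and u: "u \<in> U"
  shows "u \<otimes> m \<otimes> inv u \<in> M"
proof -
  note M = maximal_inD[OF M]
  note U = nilpotent_in_imp_subgroup[OF nil]
  have cU: "z \<in> carrier G" if "z \<in> U" for z using that subgroup.mem_carrier[OF U] by blast
  have cM: "z \<in> carrier G" if "z \<in> M" for z using that subgroup.mem_carrier[OF M(1)] by blast
  obtain N n where "central_series G N n U"
    using nilpotent_in_series[OF nil] by blast
  note N = central_seriesD[OF this]
  define i where "i = (LEAST i. i \<le> n \<and> \<not> N i \<subseteq> M)"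
  have nn: "n \<le> n \<and> \<not> N n \<subseteq> M" using N(2) M by auto
  have i: "i \<le> n" "\<not> N i \<subseteq> M" using LeastI[of "\<lambda>i. i \<le> n \<and> \<not> N i \<subseteq> M", OF nn] i_def by auto
  have "i \<noteq> 0"
  proof
    assume "i = 0"
    then show False using i N(1) subgroup.one_closed[OF M(1)] by simp
  qed
  then obtain j where j: "i = Suc j" by (cases i) auto
  have Nj: "N j \<subseteq> M" using not_less_Least[of j "\<lambda>i. i \<le> n \<and> \<not> N i \<subseteq> M"] j i i_def by auto
  obtain x where x: "x \<in> N i" "x \<notin> M" using i by blast
  have xU: "x \<in> U" using x N(4) i by auto
  define R where "R = {r \<in> U. \<forall>m\<in>M. r \<otimes> m \<otimes> inv r \<in> M \<and> inv r \<otimes> m \<otimes> r \<in> M}"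
  have R: "subgroup R G"
  proof (rule subgroupI)
    show "R \<subseteq> carrier G" using cU R_def by auto
    show "R \<noteq> {}" using subgroup.one_closed[OF U] cM by (auto simp: R_def)
  next
    fix a assume "a \<in> R" then show "inv a \<in> R" using U cU by (auto simp: R_def subgroup.m_inv_closed)
  next
    fix a b assume a: "a \<in> R" and b: "b \<in> R"
    have c: "a \<in> carrier G" "b \<in> carrier G" using a b cU R_def by auto
    have "a \<otimes> b \<otimes> m \<otimes> inv (a \<otimes> b) \<in> M \<and> inv (a \<otimes> b) \<otimes> m \<otimes> (a \<otimes> b) \<in> M" if m: "m \<in> M" for m
    proof -
      have "a \<otimes> b \<otimes> m \<otimes> inv (a \<otimes> b) = a \<otimes> (b \<otimes> m \<otimes> inv b) \<otimes> inv a"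
        using c cM[OF m] by (simp add: inv_mult_group m_assoc)
      moreover have "inv (a \<otimes> b) \<otimes> m \<otimes> (a \<otimes> b) = inv b \<otimes> (inv a \<otimes> m \<otimes> a) \<otimes> b"
        using c cM[OF m] by (simp add: inv_mult_group m_assoc)
      ultimately show ?thesis using a b m by (simp add: R_def)
    qed
    then show "a \<otimes> b \<in> R" using a b U by (auto simp: R_def subgroup.m_closed)
  qed
  have comm: "z \<otimes> m \<otimes> inv z \<in> M" if z: "z \<in> N i" and m: "m \<in> M" for z m
  proof -
    have "commutator G z m \<in> M" using N(6)[of j z m] z j i m M(2) Nj by auto
    moreover have "z \<otimes> m \<otimes> inv z = commutator G z m \<otimes> m"
      unfolding commutator_def using cM[OF m] cU[of z] z N(4)[OF i(1)] by (auto simp: m_assoc)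
    ultimately show ?thesis using m M(1) subgroup.m_closed by metis
  qed
  have "inv x \<in> N i" using x N(3) i subgroup.m_inv_closed by metis
  then have xR: "x \<in> R" using comm[OF x(1)] comm[of "inv x"] xU cU by (auto simp: R_def)
  have "M \<subseteq> R" using M by (auto simp: R_def subgroup.m_closed subgroup.m_inv_closed)
  then have "R = U" using M(4)[OF R] xR x R_def by auto
  then show ?thesis using u m R_def by auto
qed

lemma (in group) cauchy:
  assumes "finite (carrier G)" "Factorial_Ring.prime p" "p dvd order G"
  obtains H where "subgroup H G" "card H = p"
proof -
  obtain m where "order G = p ^ 1 * m" using assms(3) by auto
  then show thesis using sylow_thm[OF assms(2) is_group _ assms(1)] that by (metis power_one_right)
qed

text \<open>Cauchy's theorem gives a subgroup of prime order in \<open>U/M\<close>; its preimage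
  lies strictly above \<open>M\<close>, so it is \<open>U\<close>.\<close>

lemma (in group) maximal_normal_prime_index:
  assumes U: "subgroup U G" and fin: "finite U" and M: "maximal_in G M U"
    and inv: "\<And>m u. m \<in> M \<Longrightarrow> u \<in> U \<Longrightarrow> u \<otimes> m \<otimes> inv u \<in> M"
  obtains q where "Factorial_Ring.prime q" "card U = q * card M"
proof -
  note M = maximal_inD[OF M]
  let ?U = "G\<lparr>carrier := U\<rparr>"
  interpret U: group ?U using U subgroup_imp_group by blast
  have norm: "M \<lhd> ?U" using normal_in_restrictI[OF U M(1,2) inv] .
  then interpret M: normal M ?U .
  interpret Q: group "?U Mod M" using M.factorgroup_is_group .
  let ?f = "\<lambda>z. M #>\<^bsub>?U\<^esub> z"
  interpret f: group_hom ?U "?U Mod M" ?f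
    using M.r_coset_hom_Mod by unfold_locales
  have surj: "?f ` U = carrier (?U Mod M)" by (auto simp: FactGroup_def RCOSETS_def)
  have ker: "kernel ?U (?U Mod M) ?f = M"
  proof
    show "kernel ?U (?U Mod M) ?f \<subseteq> M"
      using U.rcos_self[OF _ M.subgroup_axioms] by (auto simp: kernel_def)
    show "M \<subseteq> kernel ?U (?U Mod M) ?f"
      using M(2) M.rcos_const[OF U.group_axioms] by (auto simp: kernel_def)
  qed
  have cardU: "card U = card M * order (?U Mod M)"
    using f.card_subgroup_image[OF U.subgroup_self] M(2) fin ker surj by (simp add: order_def)
  have "order (?U Mod M) \<noteq> 1"
    using cardU M(3) card_subset_eq[OF fin M(2)] by auto
  then obtain q where q: "Factorial_Ring.prime q" "q dvd order (?U Mod M)"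
    using prime_factor_nat by blast
  have "finite (carrier (?U Mod M))" using surj fin by (metis finite_imageI)
  then obtain T where T: "subgroup T (?U Mod M)" "card T = q" using Q.cauchy q by blast
  let ?K = "{x \<in> carrier ?U. ?f x \<in> T}"
  have K: "subgroup ?K ?U" using f.subgroup_vimage[OF T(1)] .
  have MK: "M \<subseteq> ?K"
    using M.rcos_const[OF U.group_axioms] M(2) subgroup.one_closed[OF T(1)] by auto
  have "?f ` ?K = T"
  proof
    show "T \<subseteq> ?f ` ?K"
    proof
      fix y assume y: "y \<in> T"
      then have "y \<in> ?f ` U" using subgroup.subset[OF T(1)] surj by blast
      then show "y \<in> ?f ` ?K" using y by auto
    qed
  qed auto
  then have cK: "card ?K = card M * q"
    using f.card_subgroup_image[OF K] ker MK fin T(2) by simp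
  have "card M > 0" using M(1,2) fin by (metis card_gt_0_iff empty_iff finite_subset subgroup.one_closed)
  then have "?K \<noteq> M" using cK prime_gt_1_nat[OF q(1)] by auto
  then have "?K = U" using M(4)[of ?K] K MK subgroup_restrict_iff[OF U] by auto
  then show thesis using that q cK by (simp add: mult.commute)
qed

lemma (in group) nilpotent_maximal_prime_index:
  assumes "nilpotent_in G U" "finite U" "maximal_in G M U"
  obtains q where "Factorial_Ring.prime q" "card U = q * card M"
  using maximal_normal_prime_index[OF nilpotent_in_imp_subgroup[OF assms(1)] assms(2,3)]
    nilpotent_maximal_normal[OF assms(1,3)] by metis

text \<open>Commutators with the first nontrivial term of a central series are trivial, so this term
  is central.\<close>

lemma (in group) nilpotent_center:
  assumes nil: "nilpotent_in G U" and ne: "U \<noteq> {\<one>}"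
  obtains z where "z \<in> U" "z \<noteq> \<one>" "\<And>u. u \<in> U \<Longrightarrow> z \<otimes> u = u \<otimes> z"
proof -
  obtain N n where "central_series G N n U"
    using nilpotent_in_series[OF nil] by blast
  note N = central_seriesD[OF this]
  define i where "i = (LEAST i. i \<le> n \<and> N i \<noteq> {\<one>})"
  have nn: "n \<le> n \<and> N n \<noteq> {\<one>}" using N(2) ne by simp
  have i: "i \<le> n" "N i \<noteq> {\<one>}" using LeastI[of "\<lambda>i. i \<le> n \<and> N i \<noteq> {\<one>}", OF nn] i_def by auto
  then obtain j where j: "i = Suc j" using N(1) by (cases i) auto
  have Nj: "N j = {\<one>}" using not_less_Least[of j "\<lambda>i. i \<le> n \<and> N i \<noteq> {\<one>}"] j i i_def by auto
  obtain z where z: "z \<in> N i" "z \<noteq> \<one>" using i(2) subgroup.one_closed[OF N(3)[OF i(1)]] by blast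
  have zU: "z \<in> U" using z N(4) i by auto
  have cU: "z \<in> carrier G" if "z \<in> U" for z using that subgroup.mem_carrier[OF nilpotent_in_imp_subgroup[OF nil]] by blast
  have "z \<otimes> u = u \<otimes> z" if u: "u \<in> U" for u
  proof -
    have c: "commutator G z u = \<one>" using N(6)[of j z u] z j i u Nj by auto
    have "z \<otimes> u = commutator G z u \<otimes> (u \<otimes> z)"
      unfolding commutator_def using cU[OF zU] cU[OF u] by (simp add: m_assoc)
    then show ?thesis using c cU[OF zU] cU[OF u] by simp
  qed
  with that zU z show thesis by blast
qed

section \<open>Transfer\<close>

lemma (in group) rcosets_eq_r_coset:
  assumes P: "subgroup P G" and C: "C \<in> rcosets P" and x: "x \<in> C"
  shows "x \<in> carrier G" "C = P #> x"
proof -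
  obtain g where g: "g \<in> carrier G" "C = P #> g" using C unfolding RCOSETS_def by blast
  show "C = P #> x" using repr_independence[OF _ g(1) P] x g by auto
  show "x \<in> carrier G" using x g subgroup.elemrcos_carrier[OF P is_group] by auto
qed

lemma (in group) rcosets_r_coset_closed:
  assumes P: "subgroup P G" and C: "C \<in> rcosets P" and g: "g \<in> carrier G"
  shows "C #> g \<in> rcosets P"
proof -
  obtain h where h: "h \<in> carrier G" "C = P #> h" using C unfolding RCOSETS_def by blast
  have "C #> g = P #> (h \<otimes> g)" using coset_mult_assoc[OF subgroup.subset[OF P] h(1) g] h by simp
  then show ?thesis using rcosetsI[OF subgroup.subset[OF P], of "h \<otimes> g"] h g by simp
qed

lemma (in group) rcosets_subset_carrier:
  assumes P: "subgroup P G" and C: "C \<in> rcosets P"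
  shows "C \<subseteq> carrier G"
  using subgroup.rcosets_carrier[OF P is_group C] .

lemma (in group) bij_betw_rcosets:
  assumes P: "subgroup P G" and g: "g \<in> carrier G"
  shows "bij_betw (\<lambda>C. C #> g) (rcosets P) (rcosets P)"
proof (rule bij_betwI[where g = "\<lambda>C. C #> inv g"])
  show "(\<lambda>C. C #> g) \<in> rcosets P \<rightarrow> rcosets P" "(\<lambda>C. C #> inv g) \<in> rcosets P \<rightarrow> rcosets P"
    using rcosets_r_coset_closed[OF P] g by auto
qed (use rcosets_subset_carrier[OF P] coset_mult_assoc coset_mult_one g in auto)

text \<open>The transfer and its variants are all products, over the right cosets of a subgroup, of a
  cocycle for right multiplication.\<close>

lemma (in group) cocycle_prod_hom:
  assumes P: "subgroup P G" and fin: "finite (carrier G)" and B: "subgroup B G"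
    and A: "comm_group A"
    and c: "\<And>C g. C \<in> rcosets P \<Longrightarrow> g \<in> B \<Longrightarrow> c C g \<in> carrier A"
    and coc: "\<And>C g h. C \<in> rcosets P \<Longrightarrow> g \<in> B \<Longrightarrow> h \<in> B \<Longrightarrow>
      c C (g \<otimes> h) = c C g \<otimes>\<^bsub>A\<^esub> c (C #> g) h"
  shows "(\<lambda>g. finprod A (\<lambda>C. c C g) (rcosets P)) \<in> hom (G\<lparr>carrier := B\<rparr>) A"
proof -
  interpret A: comm_group A by fact
  note mem = subgroup.mem_carrier[OF B]
  show ?thesis
  proof (rule homI)
    fix g assume "g \<in> carrier (G\<lparr>carrier := B\<rparr>)"
    then show "finprod A (\<lambda>C. c C g) (rcosets P) \<in> carrier A"
      using c by (intro A.finprod_closed) auto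
  next
    fix g h assume "g \<in> carrier (G\<lparr>carrier := B\<rparr>)" "h \<in> carrier (G\<lparr>carrier := B\<rparr>)"
    then have g: "g \<in> B" and h: "h \<in> B" by auto
    have "finprod A (\<lambda>C. c C (g \<otimes> h)) (rcosets P)
        = finprod A (\<lambda>C. c C g \<otimes>\<^bsub>A\<^esub> c (C #> g) h) (rcosets P)"
      using c coc g h rcosets_r_coset_closed[OF P _ mem[OF g]] by (intro A.finprod_cong') auto
    also have "\<dots> = finprod A (\<lambda>C. c C g) (rcosets P) \<otimes>\<^bsub>A\<^esub> finprod A (\<lambda>C. c (C #> g) h) (rcosets P)"
      using c g h rcosets_r_coset_closed[OF P _ mem[OF g]] by (intro A.finprod_multf) auto
    \<comment> \<open>Right multiplication by \<open>g\<close> permutes the cosets, so the shift in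
      the second factor disappears from the product.\<close>
    also have "finprod A (\<lambda>C. c (C #> g) h) (rcosets P) = finprod A (\<lambda>C. c C h) (rcosets P)"
      using A.finprod_reindex[of "\<lambda>C. c C h" "\<lambda>C. C #> g" "rcosets P"] c h
        bij_betw_rcosets[OF P mem[OF g]] by (auto simp: bij_betw_def)
    finally show "finprod A (\<lambda>C. c C (g \<otimes>\<^bsub>G\<lparr>carrier := B\<rparr>\<^esub> h)) (rcosets P)
        = finprod A (\<lambda>C. c C g) (rcosets P) \<otimes>\<^bsub>A\<^esub> finprod A (\<lambda>C. c C h) (rcosets P)" by simp
  qed
qed

definition transversal :: "('a, 'b) monoid_scheme \<Rightarrow> 'a set \<Rightarrow> ('a set \<Rightarrow> 'a) \<Rightarrow> bool"
  where "transversal G P t \<longleftrightarrow> (\<forall>C\<in>rcosets\<^bsub>G\<^esub> P. t C \<in> C)"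

text \<open>The element of \<open>P\<close> that appears when \<open>t C \<otimes> g\<close> is
  written as an element of \<open>P\<close> times the representative of its coset. The product over
  all cosets, taken in an abelian image of \<open>P\<close>, is the transfer.\<close>

definition transfer_factor :: "('a, 'b) monoid_scheme \<Rightarrow> ('a set \<Rightarrow> 'a) \<Rightarrow> 'a set \<Rightarrow> 'a \<Rightarrow> 'a"
  where "transfer_factor G t C g = t C \<otimes>\<^bsub>G\<^esub> g \<otimes>\<^bsub>G\<^esub> inv\<^bsub>G\<^esub> (t (C #>\<^bsub>G\<^esub> g))"

lemma (in group) transversal_closed:
  assumes "subgroup P G" "transversal G P t" "C \<in> rcosets P"
  shows "t C \<in> carrier G" "C = P #> t C"
  using assms rcosets_eq_r_coset[OF assms(1,3)] unfolding transversal_def by auto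

lemma (in group) transfer_factor_closed:
  assumes P: "subgroup P G" and t: "transversal G P t" and C: "C \<in> rcosets P" and g: "g \<in> carrier G"
  shows "transfer_factor G t C g \<in> P"
proof -
  note tC = transversal_closed[OF P t C]
  have Cg: "C #> g \<in> rcosets P" using rcosets_r_coset_closed[OF P C g] .
  note tCg = transversal_closed[OF P t Cg]
  have "C #> g = P #> (t C \<otimes> g)"
    using coset_mult_assoc[OF subgroup.subset[OF P] tC(1) g] tC(2) by simp
  then have "P #> (t C \<otimes> g) = P #> t (C #> g)" using tCg(2) by simp
  then have "t C \<otimes> g \<in> P #> t (C #> g)"
    using rcos_self[OF _ P, of "t C \<otimes> g"] tC(1) g by simp
  then show ?thesis
    unfolding transfer_factor_def using subgroup.rcos_module_imp[OF P is_group tCg(1)] by blast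
qed

lemma (in group) transfer_factor_mult:
  assumes P: "subgroup P G" and t: "transversal G P t" and C: "C \<in> rcosets P"
    and g: "g \<in> carrier G" and h: "h \<in> carrier G"
  shows "transfer_factor G t C (g \<otimes> h) = transfer_factor G t C g \<otimes> transfer_factor G t (C #> g) h"
proof -
  have Cg: "C #> g \<in> rcosets P" and Cgh: "C #> g #> h \<in> rcosets P"
    using rcosets_r_coset_closed[OF P] C g h by auto
  have eq: "C #> (g \<otimes> h) = C #> g #> h"
    using coset_mult_assoc[OF rcosets_subset_carrier[OF P C] g h] by simp
  show ?thesis
    unfolding transfer_factor_def eq
    using transversal_closed(1)[OF P t] C Cg Cgh g h by (simp add: m_assoc)
qed

lemma (in group) transfer_hom:
  assumes P: "subgroup P G" and fin: "finite (carrier G)" and A: "comm_group A"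
    and l: "lam \<in> hom (G\<lparr>carrier := P\<rparr>) A" and t: "transversal G P t"
  shows "(\<lambda>g. finprod A (\<lambda>C. lam (transfer_factor G t C g)) (rcosets P)) \<in> hom G A"
  using cocycle_prod_hom[OF P fin subgroup_self A, of "\<lambda>C g. lam (transfer_factor G t C g)"]
    transfer_factor_closed[OF P t] transfer_factor_mult[OF P t] rcosets_r_coset_closed[OF P]
    hom_in_carrier[OF l] hom_mult[OF l] by simp

text \<open>In standard notation \<open>O\<^sup>p(G)\<close>.\<close>

definition p_residual :: "('a, 'b) monoid_scheme \<Rightarrow> nat \<Rightarrow> 'a set"
  where "p_residual G p =
    generate G {x \<in> carrier G. \<exists>k::nat. \<not> p dvd k \<and> x [^]\<^bsub>G\<^esub> k = \<one>\<^bsub>G\<^esub>}"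

lemma (in group) conj_pow:
  assumes "g \<in> carrier G" "x \<in> carrier G"
  shows "(g \<otimes> x \<otimes> inv g) [^] (k::nat) = g \<otimes> x [^] k \<otimes> inv g"
proof (induction k)
  case (Suc k)
  then show ?case using assms by (simp add: m_assoc)
qed (use assms in simp)

lemma (in group) p_residual_normal: "p_residual G p \<lhd> G"
  unfolding p_residual_def
proof (rule normal_generateI)
  fix h g assume h: "h \<in> {x \<in> carrier G. \<exists>k::nat. \<not> p dvd k \<and> x [^] k = \<one>}" and g: "g \<in> carrier G"
  then obtain k :: nat where k: "h \<in> carrier G" "\<not> p dvd k" "h [^] k = \<one>" by blast
  then have "(g \<otimes> h \<otimes> inv g) [^] k = \<one>" using conj_pow[OF g k(1)] g by simp
  then show "g \<otimes> h \<otimes> inv g \<in> {x \<in> carrier G. \<exists>k::nat. \<not> p dvd k \<and> x [^] k = \<one>}"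
    using g k by blast
qed blast

lemma (in group) p_residual_subset:
  assumes "subgroup S G" "\<And>x k. x \<in> carrier G \<Longrightarrow> \<not> p dvd k \<Longrightarrow> x [^] (k::nat) = \<one> \<Longrightarrow> x \<in> S"
  shows "p_residual G p \<subseteq> S"
  unfolding p_residual_def using assms by (intro generate_subgroup_incl) auto

lemma (in group) p_residual_mem:
  assumes "x \<in> carrier G" "\<not> p dvd k" "x [^] (k::nat) = \<one>"
  shows "x \<in> p_residual G p"
  unfolding p_residual_def using assms by (blast intro: generate.incl)

section \<open>Orders, Sylow subgroups and the index of \<open>O^p(G)\<close>\<close>

lemma prime_not_dvd_coprime_power:
  assumes "Factorial_Ring.prime (p::nat)" "\<not> p dvd k"
  shows "coprime k (p ^ e)"
  using assms prime_imp_coprime[of p k] by (simp add: coprime_commute)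

text \<open>The image of a generator of the residual is killed both by an exponent prime to
  \<open>p\<close> and by \<open>p ^ e\<close>. The homomorphism is defined only on
  \<open>B\<close>, since in \<open>tate\<close> it is a transfer defined on the residual
  itself.\<close>

lemma (in group) p_residual_hom_trivial:
  assumes p: "Factorial_Ring.prime p" and B: "subgroup B G" and A: "group A" "order A = p ^ e"
    and h: "h \<in> hom (G\<lparr>carrier := B\<rparr>) A" and sub: "p_residual G p \<subseteq> B"
    and x: "x \<in> p_residual G p"
  shows "h x = \<one>\<^bsub>A\<^esub>"
proof -
  interpret A: group A by fact
  interpret B: group "G\<lparr>carrier := B\<rparr>" using B subgroup_imp_group by blast
  interpret h: group_hom "G\<lparr>carrier := B\<rparr>" A h using h by unfold_locales
  have ker: "subgroup (kernel (G\<lparr>carrier := B\<rparr>) A h) G"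
    using h.subgroup_kernel subgroup_restrict_iff[OF B] by blast
  have "p_residual G p \<subseteq> kernel (G\<lparr>carrier := B\<rparr>) A h"
  proof (rule p_residual_subset[OF ker])
    fix y k assume y: "y \<in> carrier G" "\<not> p dvd k" "y [^] (k::nat) = \<one>"
    then have yB: "y \<in> B" using p_residual_mem sub by blast
    have "h y [^]\<^bsub>A\<^esub> k = \<one>\<^bsub>A\<^esub>"
      using h.hom_nat_pow[of y k] yB y(3) nat_pow_consistent[of y k B] h.hom_one by simp
    moreover have "h y [^]\<^bsub>A\<^esub> (p ^ e) = \<one>\<^bsub>A\<^esub>"
      using A.pow_order_eq_1[of "h y"] A(2) yB by simp
    ultimately have "h y = \<one>\<^bsub>A\<^esub>"
      using A.pow_coprime_one prime_not_dvd_coprime_power[OF p y(2)] yB by (metis h.hom_closed partial_object.select_convs(1) partial_object.surjective partial_object.update_convs(1))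
    then show "y \<in> kernel (G\<lparr>carrier := B\<rparr>) A h" using yB by (simp add: kernel_def)
  qed
  then show ?thesis using x by (auto simp: kernel_def)
qed

lemma prime_power_if_unique_prime_factor:
  assumes "(n::nat) > 0" "Factorial_Ring.prime p" "\<And>q. Factorial_Ring.prime q \<Longrightarrow> q dvd n \<Longrightarrow> q = p"
  obtains e where "n = p ^ e"
proof -
  obtain m where m: "n = p ^ multiplicity p n * m" "\<not> p dvd m"
    using multiplicity_decompose'[of n p] assms(1,2) by (metis not_prime_unit mult.commute not_gr_zero)
  have "m = 1"
    using assms(3) m prime_factor_nat[of m] by (metis dvd_mult)
  then show thesis using m that by simp
qed

lemma not_dvd_Suc_multiplicity:
  assumes "Factorial_Ring.prime (p::nat)" "n > 0"
  shows "\<not> p ^ Suc (multiplicity p n) dvd n"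
proof
  assume "p ^ Suc (multiplicity p n) dvd n"
  then have "Suc (multiplicity p n) \<le> multiplicity p n"
    using assms not_prime_unit by (intro multiplicity_geI) auto
  then show False by simp
qed

lemma multiplicity_neq_zero:
  assumes "Factorial_Ring.prime (p::nat)" "n > 0" "p dvd n"
  shows "multiplicity p n \<noteq> 0"
  using not_dvd_Suc_multiplicity[OF assms(1,2)] assms(3) by (intro notI) simp

lemma (in group) card_subgroup_dvd:
  assumes "subgroup A G" "subgroup B G" "A \<subseteq> B"
  shows "card A dvd card B"
proof -
  interpret B: group "G\<lparr>carrier := B\<rparr>" using assms(2) subgroup_imp_group by blast
  show ?thesis
    using B.lagrange[of A] subgroup_incl[OF assms] by (metis dvd_triv_right order_def partial_object.select_convs(1) partial_object.surjective partial_object.update_convs(1))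
qed

lemma (in group) card_subgroup_dvd_order:
  assumes "subgroup A G"
  shows "card A dvd order G"
  using lagrange[OF assms] by (metis dvd_triv_right)

lemma (in group) pow_card_subgroup_eq_one:
  assumes "subgroup B G" "x \<in> B"
  shows "x [^] card B = \<one>"
proof -
  interpret B: group "G\<lparr>carrier := B\<rparr>" using assms(1) subgroup_imp_group by blast
  show ?thesis
    using B.pow_order_eq_1[of x] assms(2) nat_pow_consistent[of x "card B" B] by (simp add: order_def)
qed

lemma (in group) finite_subgroup_pos:
  assumes "finite (carrier G)" "subgroup B G"
  shows "card B > 0" "finite B"
  using assms(1) subgroup.finite_imp_card_positive[OF assms(2)] subgroup.subset[OF assms(2)]
    finite_subset by auto

lemma (in group) subset_set_mult_subgroup:
  assumes "subgroup A G" "subgroup B G"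
  shows "A \<subseteq> A <#> B" "B \<subseteq> A <#> B"
proof -
  show "A \<subseteq> A <#> B"
  proof
    fix x assume x: "x \<in> A"
    then have "x = x \<otimes> \<one>" using subgroup.mem_carrier[OF assms(1)] by simp
    then show "x \<in> A <#> B" using x subgroup.one_closed[OF assms(2)] unfolding set_mult_def by blast
  qed
  show "B \<subseteq> A <#> B"
  proof
    fix x assume x: "x \<in> B"
    then have "x = \<one> \<otimes> x" using subgroup.mem_carrier[OF assms(2)] by simp
    then show "x \<in> A <#> B" using x subgroup.one_closed[OF assms(1)] unfolding set_mult_def by blast
  qed
qed

lemma (in group) subgroup_mult_normal:
  assumes "subgroup A G" "N \<lhd> G"
  shows "subgroup (A <#> N) G"
  using mult_norm_subgroup[OF assms(2,1)] commut_normal[OF assms] by simp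

lemma (in group) card_subgroup_eq_one:
  assumes "subgroup A G" "card A = 1"
  shows "A = {\<one>}"
  using assms(2) subgroup.one_closed[OF assms(1)] by (metis card_1_singletonE singletonD)

text \<open>For a prime \<open>q\<close> other than \<open>p\<close>, a Sylow
  \<open>q\<close>-subgroup consists of elements of order prime to \<open>p\<close> and so lies in
  the residual; hence \<open>q\<close> cannot divide the index.\<close>

lemma (in group) p_residual_index:
  assumes fin: "finite (carrier G)" and p: "Factorial_Ring.prime p"
  obtains e where "order G = p ^ e * card (p_residual G p)"
proof -
  let ?N = "p_residual G p"
  have N: "subgroup ?N G" using p_residual_normal normal_imp_subgroup by blast
  have oG: "order G > 0" using fin order_gt_0_iff_finite by simp
  obtain k where k: "order G = k * card ?N" using card_subgroup_dvd_order[OF N] by (metis dvdE mult.commute)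
  have "q = p" if q: "Factorial_Ring.prime q" "q dvd k" for q
  proof (rule ccontr)
    assume "q \<noteq> p"
    let ?a = "multiplicity q (order G)"
    obtain m where "order G = q ^ ?a * m"
      using multiplicity_dvd[of q "order G"] by blast
    then obtain Q where Q: "subgroup Q G" "card Q = q ^ ?a"
      using sylow_thm[OF q(1) is_group _ fin] by blast
    have "\<not> p dvd q ^ ?a" using \<open>q \<noteq> p\<close> p q(1) prime_dvd_power primes_dvd_imp_eq by blast
    then have "Q \<subseteq> ?N"
      using p_residual_mem[of _ p "q ^ ?a"] pow_card_subgroup_eq_one[OF Q(1)] Q(2)
        subgroup.mem_carrier[OF Q(1)] by auto
    then have "q ^ ?a dvd card ?N" using card_subgroup_dvd[OF Q(1) N] Q(2) by simp
    then have "q * q ^ ?a dvd order G" using q(2) k mult_dvd_mono by simp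
    then show False
      using not_dvd_Suc_multiplicity[OF q(1) oG] by simp
  qed
  moreover have "k > 0" using k oG by (metis gr0I mult_0)
  ultimately show thesis using prime_power_if_unique_prime_factor[of k p] p k that by metis
qed

text \<open>The order of the product is divisible by the \<open>p\<close>-part of the order of
  \<open>G\<close> because of \<open>P\<close>, and by the complementary part because the residual
  has \<open>p\<close>-power index.\<close>

lemma (in group) sylow_mult_p_residual:
  assumes fin: "finite (carrier G)" and p: "Factorial_Ring.prime p"
    and P: "subgroup P G" "card P = p ^ multiplicity p (order G)"
  shows "P <#> p_residual G p = carrier G"
proof -
  let ?N = "p_residual G p"
  have N: "?N \<lhd> G" "subgroup ?N G" using p_residual_normal normal_imp_subgroup by blast+
  have oG: "order G > 0" using fin order_gt_0_iff_finite by simp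
  have PN: "subgroup (P <#> ?N) G" using subgroup_mult_normal[OF P(1) N(1)] .
  obtain e where e: "order G = p ^ e * card ?N" using p_residual_index[OF fin p] .
  obtain m where m: "order G = p ^ multiplicity p (order G) * m" "\<not> p dvd m"
    using multiplicity_decompose'[of "order G" p] oG p by (metis not_prime_unit mult.commute not_gr_zero)
  have "m dvd p ^ e * card ?N" using m e by (metis dvd_triv_right)
  then have "m dvd card ?N"
    using coprime_dvd_mult_right_iff prime_not_dvd_coprime_power[OF p m(2)] by blast
  moreover note sub = subset_set_mult_subgroup[OF P(1) N(2)]
  have "card ?N dvd card (P <#> ?N)" using card_subgroup_dvd[OF N(2) PN sub(2)] .
  ultimately have "m dvd card (P <#> ?N)" using dvd_trans by blast
  moreover have "p ^ multiplicity p (order G) dvd card (P <#> ?N)"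
    using card_subgroup_dvd[OF P(1) PN sub(1)] P(2) by simp
  ultimately have "order G dvd card (P <#> ?N)"
    using m(1) divides_mult prime_not_dvd_coprime_power[OF p m(2)] by (metis coprime_commute)
  then show ?thesis
    using PN fin subgroup.subset[OF PN] finite_subgroup_pos[OF fin PN]
    by (metis card_seteq dvd_imp_le order_def)
qed

lemma (in group) pow_eq_iff_cong:
  assumes "u \<in> carrier G"
  shows "u [^] (i::nat) = u [^] (j::nat) \<longleftrightarrow> [i = j] (mod (ord u))"
  using int_pow_eq[OF assms, of "int i" "int j"]
  by (metis cong_iff_dvd_diff cong_int_iff int_pow_int cong_sym_eq)

lemma (in group) sylow_index_not_dvd:
  assumes fin: "finite (carrier G)" and p: "Factorial_Ring.prime p"
    and P: "subgroup P G" "card P = p ^ multiplicity p (order G)"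
  shows "\<not> p dvd card (rcosets P)"
proof
  assume "p dvd card (rcosets P)"
  then have "p * card P dvd order G" using lagrange[OF P(1)] by (metis dvd_refl mult_dvd_mono)
  then show False
    using not_dvd_Suc_multiplicity[OF p, of "order G"] fin order_gt_0_iff_finite P(2) by simp
qed

text \<open>The hypothesis \<open>nongen\<close> says that \<open>P \<inter> O\<^sup>p(G)\<close> consists of
  non-generators of \<open>P\<close>.  If \<open>K = P \<inter> O\<^sup>p(G)\<close> were non-trivial, it would have a
  \<open>P\<close>-invariant homomorphism onto a non-trivial abelian \<open>p\<close>-group.  Its transfer to
  \<open>O\<^sup>p(G)\<close> vanishes, which makes the cocycle product \<open>W\<close> below a homomorphism on \<open>P\<close>
  extending a power of it, coprime to \<open>p\<close>; then the kernel of \<open>W\<close> supplements \<open>K\<close> in \<open>P\<close>.\<close>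

lemma (in group) tate:
  assumes fin: "finite (carrier G)" and p: "Factorial_Ring.prime p"
    and P: "subgroup P G" "card P = p ^ multiplicity p (order G)" and nil: "nilpotent_in G P"
    and nongen: "\<And>M. subgroup M G \<Longrightarrow> M \<subseteq> P \<Longrightarrow> (P \<inter> p_residual G p) <#> M = P \<Longrightarrow> M = P"
  shows "P \<inter> p_residual G p = {\<one>}"
proof (rule ccontr)
  assume "P \<inter> p_residual G p \<noteq> {\<one>}"
  define N where "N = p_residual G p"
  define K where "K = P \<inter> N"
  have N: "N \<lhd> G" "subgroup N G" unfolding N_def using p_residual_normal normal_imp_subgroup by blast+
  have K: "subgroup K G" unfolding K_def using subgroups_Inter_pair[OF P(1) N(2)] .
  have KP: "K \<subseteq> P" and KN: "K \<subseteq> N" unfolding K_def by auto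
  have K1: "K \<noteq> {\<one>}" using \<open>P \<inter> p_residual G p \<noteq> {\<one>}\<close> K_def N_def by simp
  note cP = subgroup.mem_carrier[OF P(1)] and cN = subgroup.mem_carrier[OF N(2)]
  note cK = subgroup.mem_carrier[OF K]
  note clP = subgroup.m_closed[OF P(1)] subgroup.m_inv_closed[OF P(1)]
  note clN = subgroup.m_closed[OF N(2)] subgroup.m_inv_closed[OF N(2)]
  note clK = subgroup.m_closed[OF K] subgroup.m_inv_closed[OF K]
  have Kinv: "u \<otimes> k \<otimes> inv u \<in> K" if "k \<in> K" "u \<in> P" for k u
    using that normal.inv_op_closed2[OF N(1)] cP clP unfolding K_def by auto
  \<comment> \<open>\<open>L\<close> contains all commutators of \<open>K\<close> with
    \<open>P\<close>. So \<open>K/L\<close>, the group \<open>A\<close> below, is abelian, and the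
    projection \<open>lam\<close> is invariant under conjugation by \<open>P\<close>.\<close>
  obtain L where L: "subgroup L G" "L \<subset> K" "\<And>k u. k \<in> K \<Longrightarrow> u \<in> P \<Longrightarrow> commutator G k u \<in> L"
    using nilpotent_descends[OF nil K KP K1 Kinv] by blast
  have conjL: "u \<otimes> k \<otimes> inv u = k \<otimes> commutator G (inv k) u" "commutator G (inv k) u \<in> L"
    if "k \<in> K" "u \<in> P" for k u
    using that conj_eq_commutator[OF cK cP] L(3)[OF clK(2)] by auto
  have Linv: "u \<otimes> m \<otimes> inv u \<in> L" if "m \<in> L" "u \<in> K" for m u
  proof -
    have "m \<in> K" "u \<in> P" using that L(2) KP by auto
    then show ?thesis using conjL[of m u] that subgroup.m_closed[OF L(1)] by simp
  qed
  let ?K = "G\<lparr>carrier := K\<rparr>"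
  have nL: "L \<lhd> ?K" using normal_in_restrictI[OF K L(1) _ Linv] L(2) by blast
  interpret KG: group ?K using K subgroup_imp_group by blast
  interpret L: normal L ?K using nL .
  define A where "A = ?K Mod L"
  define lam where "lam = (\<lambda>z. L #>\<^bsub>?K\<^esub> z)"
  interpret A: group A unfolding A_def using L.factorgroup_is_group .
  have lam: "lam \<in> hom ?K A" unfolding lam_def A_def using L.r_coset_hom_Mod .
  then interpret lam: group_hom ?K A lam by unfold_locales
  have surj: "lam ` K = carrier A" unfolding lam_def A_def by (auto simp: FactGroup_def RCOSETS_def)
  have lamL: "lam m = \<one>\<^bsub>A\<^esub>" if "m \<in> L" for m
    using L.rcos_const[OF KG.group_axioms that] by (simp add: lam_def A_def)
  have lamL': "m \<in> L" if "m \<in> K" "lam m = \<one>\<^bsub>A\<^esub>" for m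
    using KG.rcos_self[OF _ L.subgroup_axioms, of m] that by (simp add: lam_def A_def)
  have lammult: "lam (a \<otimes> b) = lam a \<otimes>\<^bsub>A\<^esub> lam b" if "a \<in> K" "b \<in> K" for a b
    using lam.hom_mult that by simp
  have lamc: "lam a \<in> carrier A" if "a \<in> K" for a using lam.hom_closed that by simp
  have laminv: "lam (u \<otimes> k \<otimes> inv u) = lam k" if "k \<in> K" "u \<in> P" for k u
  proof -
    have "commutator G (inv k) u \<in> K" using conjL(2)[OF that] L(2) by blast
    then show ?thesis
      using conjL[OF that] lammult[OF that(1)] lamL[OF conjL(2)[OF that]] lamc[OF that(1)] by simp
  qed
  have "comm_group A"
  proof (rule A.group_comm_groupI)
    fix a b assume "a \<in> carrier A" "b \<in> carrier A"
    then obtain x y where xy: "x \<in> K" "y \<in> K" "a = lam x" "b = lam y"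
      unfolding surj[symmetric] by auto
    have "a \<otimes>\<^bsub>A\<^esub> b = lam (x \<otimes> y \<otimes> inv x \<otimes> x)"
      using xy lammult cK by (simp add: m_assoc)
    also have "\<dots> = lam (x \<otimes> y \<otimes> inv x) \<otimes>\<^bsub>A\<^esub> lam x"
      using xy by (intro lammult) (auto simp: clK)
    also have "\<dots> = b \<otimes>\<^bsub>A\<^esub> a" using laminv[of y x] xy KP by auto
    finally show "a \<otimes>\<^bsub>A\<^esub> b = b \<otimes>\<^bsub>A\<^esub> a" .
  qed
  then interpret A: comm_group A .
  have "card K dvd p ^ multiplicity p (order G)"
    using card_subgroup_dvd[OF K P(1) KP] P(2) by simp
  moreover have "order A dvd card K"
  proof -
    have "kernel ?K A lam \<subseteq> K" by (auto simp: kernel_def)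
    then show ?thesis
      using lam.card_subgroup_image[OF KG.subgroup_self] surj finite_subgroup_pos[OF fin K]
      by (simp add: order_def)
  qed
  ultimately have "order A dvd p ^ multiplicity p (order G)" using dvd_trans by blast
  then obtain e where e: "order A = p ^ e" using divides_primepow_nat[OF p, of "order A"] by auto
  \<comment> \<open>Representatives can be taken in \<open>N\<close> because \<open>P\<close> and
    \<open>N\<close> generate \<open>G\<close> as a product. Then transfer factors of elements of
    \<open>N\<close> lie in \<open>K\<close>, and the factor at \<open>x\<close> in \<open>P\<close>
    differs from \<open>x\<close> only by an element of \<open>K\<close>.\<close>
  have "\<exists>t. \<forall>C\<in>rcosets P. t C \<in> C \<inter> N"
  proof (rule bchoice, rule ballI)
    fix C assume "C \<in> rcosets P"
    then obtain g where g: "g \<in> carrier G" "C = P #> g" unfolding RCOSETS_def by blast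
    have "g \<in> P <#> N" using sylow_mult_p_residual[OF fin p P] g N_def by simp
    then obtain u n where un: "u \<in> P" "n \<in> N" "g = u \<otimes> n" unfolding set_mult_def by blast
    have "n = inv u \<otimes> g" using un cP cN by simp
    then have "n \<in> C" using g(2) clP(2)[OF un(1)] unfolding r_coset_def by blast
    then show "\<exists>x. x \<in> C \<inter> N" using un by blast
  qed
  then obtain t where t: "\<And>C. C \<in> rcosets P \<Longrightarrow> t C \<in> C" "\<And>C. C \<in> rcosets P \<Longrightarrow> t C \<in> N" by auto
  have tr: "transversal G P t" unfolding transversal_def using t by blast
  define a where "a = transfer_factor G t"
  have aP: "a C g \<in> P" if "C \<in> rcosets P" "g \<in> carrier G" for C g
    unfolding a_def using transfer_factor_closed[OF P(1) tr that] .
  have aN: "a C g \<in> N" if "C \<in> rcosets P" "g \<in> N" for C g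
    unfolding a_def transfer_factor_def
    using t(2)[OF that(1)] t(2)[OF rcosets_r_coset_closed[OF P(1) that(1) cN[OF that(2)]]] that(2)
    by (simp add: clN)
  have amult: "a C (g \<otimes> h) = a C g \<otimes> a (C #> g) h" if "C \<in> rcosets P" "g \<in> carrier G" "h \<in> carrier G" for C g h
    unfolding a_def using transfer_factor_mult[OF P(1) tr that] .
  have rc: "C #> g \<in> rcosets P" if "C \<in> rcosets P" "g \<in> carrier G" for C g
    using rcosets_r_coset_closed[OF P(1) that] .
  have aK: "inv (a C x) \<otimes> x \<in> K" if C: "C \<in> rcosets P" and x: "x \<in> P" for C x
  proof -
    have "t C \<in> N" "t (C #> x) \<in> N" using t(2) C rc x cP by auto
    moreover from this have "inv (a C x) \<otimes> x = t (C #> x) \<otimes> (inv x \<otimes> inv (t C) \<otimes> x)"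
      unfolding a_def transfer_factor_def using x cP cN by (simp add: inv_mult_group m_assoc)
    ultimately have "inv (a C x) \<otimes> x \<in> N"
      using normal.inv_op_closed1[OF N(1), of x "inv (t C)"] x cP clN by simp
    then show ?thesis unfolding K_def using aP[OF C] x cP clP by simp
  qed
  \<comment> \<open>For \<open>x\<close> in \<open>P\<close> the factor \<open>a C x\<close> itself
    may lie outside \<open>K\<close>, where \<open>lam\<close> has no meaning; its discrepancy from
    \<open>x\<close> lies in \<open>K\<close> and is used instead.\<close>
  define W where "W = (\<lambda>x. finprod A (\<lambda>C. lam (inv (a C x) \<otimes> x)) (rcosets P))"
  define V where "V = (\<lambda>x. finprod A (\<lambda>C. lam (a C x)) (rcosets P))"
  have W: "W \<in> hom (G\<lparr>carrier := P\<rparr>) A"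
    unfolding W_def
  proof (rule cocycle_prod_hom[OF P(1) fin P(1) A.comm_group_axioms])
    fix C g assume "C \<in> rcosets P" "g \<in> P"
    then show "lam (inv (a C g) \<otimes> g) \<in> carrier A" using aK lamc by blast
  next
    fix C g h assume C: "C \<in> rcosets P" and g: "g \<in> P" and h: "h \<in> P"
    have Cg: "C #> g \<in> rcosets P" using rc C g cP by blast
    define a1 a2 where "a1 = a C g" and "a2 = a (C #> g) h"
    have a12: "a1 \<in> P" "a2 \<in> P" unfolding a1_def a2_def using aP C Cg g h cP by auto
    have k12: "inv a1 \<otimes> g \<in> K" "inv a2 \<otimes> h \<in> K" unfolding a1_def a2_def using aK C Cg g h by auto
    \<comment> \<open>The discrepancies multiply only up to conjugation by an element of
      \<open>P\<close>, which the invariance \<open>laminv\<close> absorbs.\<close>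
    have "inv (a C (g \<otimes> h)) \<otimes> (g \<otimes> h) = inv a2 \<otimes> (inv a1 \<otimes> g) \<otimes> inv (inv a2) \<otimes> (inv a2 \<otimes> h)"
      using amult[OF C cP[OF g] cP[OF h]] a12 g h cP unfolding a1_def[symmetric] a2_def[symmetric]
      by (simp add: inv_mult_group m_assoc)
    then have "lam (inv (a C (g \<otimes> h)) \<otimes> (g \<otimes> h))
        = lam (inv a2 \<otimes> (inv a1 \<otimes> g) \<otimes> inv (inv a2)) \<otimes>\<^bsub>A\<^esub> lam (inv a2 \<otimes> h)"
      using lammult Kinv[OF k12(1) clP(2)[OF a12(2)]] k12(2) by simp
    also have "lam (inv a2 \<otimes> (inv a1 \<otimes> g) \<otimes> inv (inv a2)) = lam (inv a1 \<otimes> g)"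
      using laminv[OF k12(1) clP(2)[OF a12(2)]] .
    finally show "lam (inv (a C (g \<otimes> h)) \<otimes> (g \<otimes> h))
        = lam (inv (a C g) \<otimes> g) \<otimes>\<^bsub>A\<^esub> lam (inv (a (C #> g) h) \<otimes> h)"
      unfolding a1_def a2_def .
  qed
  have V: "V \<in> hom (G\<lparr>carrier := N\<rparr>) A"
    unfolding V_def
  proof (rule cocycle_prod_hom[OF P(1) fin N(2) A.comm_group_axioms])
    fix C g assume "C \<in> rcosets P" "g \<in> N"
    then show "lam (a C g) \<in> carrier A" using aP aN cN lamc K_def by blast
  next
    fix C g h assume "C \<in> rcosets P" "g \<in> N" "h \<in> N"
    then show "lam (a C (g \<otimes> h)) = lam (a C g) \<otimes>\<^bsub>A\<^esub> lam (a (C #> g) h)"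
      using amult[of C g h] lammult[of "a C g" "a (C #> g) h"] aP aN rc cN K_def by auto
  qed
  have V1: "V k = \<one>\<^bsub>A\<^esub>" if "k \<in> N" for k
    using p_residual_hom_trivial[OF p N(2) A.group_axioms e V] that N_def by simp
  let ?n = "card (rcosets P)"
  have WK: "W k = lam k [^]\<^bsub>A\<^esub> ?n" if k: "k \<in> K" for k
  proof -
    have 1: "a C k \<in> K" "inv (a C k) \<otimes> k \<in> K" if "C \<in> rcosets P" for C
      using aP aN aK that k KP KN cN K_def by blast+
    \<comment> \<open>\<open>V k\<close> is trivial, so multiplying by it changes nothing, and
      afterwards every coset contributes exactly \<open>lam k\<close>.\<close>
    have "W k = W k \<otimes>\<^bsub>A\<^esub> V k"
    proof -
      have "V k = \<one>\<^bsub>A\<^esub>" "W k \<in> carrier A"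
        using V1[of k] k KN hom_in_carrier[OF W, of k] KP by auto
      then show ?thesis by simp
    qed
    also have "\<dots> = finprod A (\<lambda>C. lam (a C k) \<otimes>\<^bsub>A\<^esub> lam (inv (a C k) \<otimes> k)) (rcosets P)"
      unfolding W_def V_def using 1 lamc
      by (subst A.finprod_multf[symmetric]) (auto intro!: A.finprod_cong' simp: A.m_comm)
    also have "\<dots> = finprod A (\<lambda>C. lam k) (rcosets P)"
    proof (rule A.finprod_cong')
      fix C assume "C \<in> rcosets P"
      note 1 = 1[OF this]
      have "lam (a C k) \<otimes>\<^bsub>A\<^esub> lam (inv (a C k) \<otimes> k) = lam (a C k \<otimes> (inv (a C k) \<otimes> k))"
        using lammult[OF 1] by simp
      then show "lam (a C k) \<otimes>\<^bsub>A\<^esub> lam (inv (a C k) \<otimes> k) = lam k" using 1(1) k cK by simp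
    qed (use lamc k in auto)
    also have "\<dots> = lam k [^]\<^bsub>A\<^esub> ?n" by (rule A.finprod_const[OF lamc[OF k]])
    finally show ?thesis .
  qed
  have "\<not> p dvd ?n" using sylow_index_not_dvd[OF fin p P] .
  then have cop: "coprime ?n (order A)" using prime_not_dvd_coprime_power[OF p] e by simp
  interpret PG: group "G\<lparr>carrier := P\<rparr>" using P(1) subgroup_imp_group by blast
  interpret W: group_hom "G\<lparr>carrier := P\<rparr>" A W using W by unfold_locales
  have root: "\<exists>k\<in>K. W k = y" if y: "y \<in> carrier A" for y
  proof -
    obtain k0 where k0: "k0 \<in> K" "y = lam k0" using y unfolding surj[symmetric] by auto
    \<comment> \<open>\<open>r\<close> inverts the index of \<open>P\<close> modulo the order of
      \<open>A\<close>, so taking \<open>r\<close>-th powers undoes the power map in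
      \<open>WK\<close> and \<open>W\<close> maps \<open>K\<close> onto \<open>A\<close>.\<close>
    obtain r where r: "[?n * r = 1] (mod order A)" using cop cong_solve_coprime_nat by auto
    have kr: "k0 [^] r \<in> K"
      using subgroup_int_pow_closed[OF K k0(1), of "int r"] by (simp add: int_pow_int)
    have "lam (k0 [^] r) = y [^]\<^bsub>A\<^esub> r"
      using lam.hom_nat_pow[of k0 r] k0 nat_pow_consistent[of k0 r K] by simp
    then have "W (k0 [^] r) = y [^]\<^bsub>A\<^esub> (r * ?n)"
      using WK[OF kr] y A.nat_pow_pow by simp
    also have "\<dots> = y [^]\<^bsub>A\<^esub> (1::nat)"
    proof -
      have "[r * ?n = 1] (mod A.ord y)"
        using r A.ord_dvd_group_order[OF y] cong_dvd_modulus_nat by (metis mult.commute)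
      then show ?thesis using A.pow_eq_iff_cong[OF y] by blast
    qed
    finally show ?thesis using kr y by auto
  qed
  define M where "M = kernel (G\<lparr>carrier := P\<rparr>) A W"
  have M: "subgroup M G" "M \<subseteq> P"
    unfolding M_def using W.subgroup_kernel subgroup_restrict_iff[OF P(1)] by blast+
  have "K <#> M = P"
  proof
    show "K <#> M \<subseteq> P" using KP M(2) clP unfolding set_mult_def by blast
    show "P \<subseteq> K <#> M"
    proof
      fix x assume x: "x \<in> P"
      have "W x \<in> carrier A" using W.hom_closed x by simp
      then obtain k where k: "k \<in> K" "W k = W x" using root by blast
      have "W (inv k \<otimes> x) = \<one>\<^bsub>A\<^esub>"
        using W.hom_mult[of "inv k" x] W.hom_inv[of k] k x KP clP m_inv_consistent[OF P(1), of k]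
          W.hom_closed[of x] by auto
      then have "inv k \<otimes> x \<in> M" unfolding M_def kernel_def using k x KP clP by auto
      moreover have "x = k \<otimes> (inv k \<otimes> x)" using k x cK cP by simp
      ultimately show "x \<in> K <#> M" using k unfolding set_mult_def by blast
    qed
  qed
  then have MP: "M = P" using nongen[OF M] unfolding K_def N_def by simp
  \<comment> \<open>With \<open>M = P\<close> the map \<open>W\<close> vanishes on \<open>K\<close>.
    By \<open>WK\<close> and coprimality \<open>lam\<close> vanishes there too, although
    \<open>L\<close> is proper in \<open>K\<close>.\<close>
  obtain k where k: "k \<in> K" "k \<notin> L" using L(2) by blast
  have "lam k [^]\<^bsub>A\<^esub> ?n = \<one>\<^bsub>A\<^esub>" using WK[OF k(1)] k(1) KP MP unfolding M_def kernel_def by auto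
  moreover have "lam k [^]\<^bsub>A\<^esub> order A = \<one>\<^bsub>A\<^esub>" using A.pow_order_eq_1 lamc k by simp
  ultimately have "lam k = \<one>\<^bsub>A\<^esub>" using A.pow_coprime_one lamc k(1) cop by blast
  then show False using lamL' k by blast
qed

section \<open>Evaluation of the transfer for a cyclic Sylow subgroup\<close>

text \<open>The least return time \<open>m\<close> of a point enumerates its cycle without
  repetition, and removing that cycle leaves a smaller set permuted by \<open>\<pi>\<close>. Thus a
  product can be checked cycle by cycle.\<close>

lemma (in comm_monoid) finprod_orbits_eq_one:
  assumes "finite Z" and "bij_betw \<pi> Z Z" and "\<And>x. x \<in> Z \<Longrightarrow> f x \<in> carrier G"
    and "\<And>x m. x \<in> Z \<Longrightarrow> m > 0 \<Longrightarrow> (\<pi> ^^ m) x = x \<Longrightarrow>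
      (\<And>j. 0 < j \<Longrightarrow> j < m \<Longrightarrow> (\<pi> ^^ j) x \<noteq> x) \<Longrightarrow>
      finprod G (\<lambda>j. f ((\<pi> ^^ j) x)) {..<m} = \<one>"
  shows "finprod G f Z = \<one>"
  using assms
proof (induction "card Z" arbitrary: Z rule: less_induct)
  case (less Z)
  show ?case
  proof (cases "Z = {}")
    case False
    then obtain x where x: "x \<in> Z" by blast
    have inj: "inj_on \<pi> Z" and im: "\<pi> ` Z = Z" using less.prems(2) by (auto simp: bij_betw_def)
    have itX: "(\<pi> ^^ j) y \<in> Z" if "y \<in> Z" for j y
      using that im by (induction j) auto
    have cancel: "a = b" if "(\<pi> ^^ j) a = (\<pi> ^^ j) b" "a \<in> Z" "b \<in> Z" for a b j
      using that
    proof (induction j)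
      case (Suc j)
      then show ?case using inj_onD[OF inj, of "(\<pi> ^^ j) a" "(\<pi> ^^ j) b"] itX by simp
    qed simp
    have "\<exists>m>0. (\<pi> ^^ m) x = x"
    proof -
      have "finite (range (\<lambda>j. (\<pi> ^^ j) x))"
        using itX[OF x] less.prems(1) by (meson finite_subset image_subsetI)
      then have "\<not> inj (\<lambda>j. (\<pi> ^^ j) x)" using finite_imageD infinite_UNIV_nat by blast
      then obtain a' b' :: nat where "a' \<noteq> b'" "(\<pi> ^^ a') x = (\<pi> ^^ b') x"
        unfolding inj_def by blast
      then obtain a b :: nat where ab: "a < b" "(\<pi> ^^ a) x = (\<pi> ^^ b) x"
        using that[of a' b'] that[of b' a'] by (cases "a' < b'") auto
      then have "(\<pi> ^^ a) x = (\<pi> ^^ a) ((\<pi> ^^ (b - a)) x)"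
        using funpow_add[of a "b - a" \<pi>] by simp
      then have "x = (\<pi> ^^ (b - a)) x" using cancel x itX by blast
      then show ?thesis using ab by (intro exI[of _ "b - a"]) auto
    qed
    define m where "m = (LEAST m. m > 0 \<and> (\<pi> ^^ m) x = x)"
    have m: "m > 0" "(\<pi> ^^ m) x = x"
      using LeastI_ex[OF \<open>\<exists>m>0. (\<pi> ^^ m) x = x\<close>[unfolded Bex_def]] unfolding m_def by auto
    have least: "(\<pi> ^^ j) x \<noteq> x" if "0 < j" "j < m" for j
      using not_less_Least[of j "\<lambda>m. m > 0 \<and> (\<pi> ^^ m) x = x"] that unfolding m_def by auto
    define Ob where "Ob = (\<lambda>j. (\<pi> ^^ j) x) ` {..<m}"
    have injO: "inj_on (\<lambda>j. (\<pi> ^^ j) x) {..<m}"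
    proof (rule linorder_inj_onI)
      fix a b assume ab: "a < b" "a \<in> {..<m}" "b \<in> {..<m}"
      show "(\<pi> ^^ a) x \<noteq> (\<pi> ^^ b) x"
      proof
        assume "(\<pi> ^^ a) x = (\<pi> ^^ b) x"
        then have "(\<pi> ^^ a) x = (\<pi> ^^ a) ((\<pi> ^^ (b - a)) x)"
          using ab funpow_add[of a "b - a" \<pi>] by simp
        then have "(\<pi> ^^ (b - a)) x = x" using cancel[of a x] x itX by metis
        moreover have "0 < b - a" "b - a < m" using ab by auto
        ultimately show False using least by blast
      qed
    qed auto
    have OX: "Ob \<subseteq> Z" unfolding Ob_def using itX x by auto
    have piO: "\<pi> ` Ob = Ob"
    proof (rule card_subset_eq)
      show "finite Ob" unfolding Ob_def by simp
      show "\<pi> ` Ob \<subseteq> Ob"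
      proof
        fix y assume "y \<in> \<pi> ` Ob"
        then obtain j where j: "j < m" "y = (\<pi> ^^ Suc j) x" unfolding Ob_def by auto
        show "y \<in> Ob"
        proof (cases "Suc j = m")
          case True
          then have "y = (\<pi> ^^ 0) x" using j m(2) by simp
          then show ?thesis using m(1) unfolding Ob_def by blast
        next
          case False
          then have "Suc j \<in> {..<m}" using j by auto
          then show ?thesis using j unfolding Ob_def by blast
        qed
      qed
      show "card (\<pi> ` Ob) = card Ob" using inj OX by (meson card_image inj_on_subset)
    qed
    have bij: "bij_betw \<pi> (Z - Ob) (Z - Ob)"
      unfolding bij_betw_def using inj im piO OX inj_on_image_set_diff[OF inj, of Z Ob] inj_on_diff by auto
    have "card (Z - Ob) < card Z"
      using m(1) x less.prems(1) OX by (intro psubset_card_mono) (auto simp: Ob_def)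
    then have 1: "finprod G f (Z - Ob) = \<one>"
      using less.hyps[OF _ _ bij] less.prems(1,3,4) by auto
    have "finprod G f Ob = finprod G (\<lambda>j. f ((\<pi> ^^ j) x)) {..<m}"
      unfolding Ob_def using finprod_reindex[OF _ injO, of f] less.prems(3) itX x by auto
    then have 2: "finprod G f Ob = \<one>" using less.prems(4)[OF x m least] by simp
    have "finprod G f (Ob \<union> (Z - Ob)) = finprod G f Ob \<otimes> finprod G f (Z - Ob)"
      using less.prems(1,3) OX by (intro finprod_Un_disjoint) (auto intro: finite_subset)
    then show ?thesis using 1 2 OX by (simp add: Un_absorb1)
  qed simp
qed

text \<open>For \<open>g\<close> outside \<open>S\<close>, the product of \<open>S\<close> with its
  conjugate by \<open>g\<close> misses \<open>inv g\<close>, so the intersection of the two has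
  index below \<open>p\<close> in \<open>S\<close>. No divisor of the order other than 1 is below
  \<open>p\<close>, so \<open>S\<close> equals its conjugate.\<close>

lemma (in group) smallest_prime_index_normal:
  assumes fin: "finite (carrier G)" and p: "Factorial_Ring.prime p"
    and min: "\<And>q. Factorial_Ring.prime q \<Longrightarrow> q dvd order G \<Longrightarrow> p \<le> q"
    and S: "subgroup S G" and card: "order G = p * card S"
  shows "S \<lhd> G"
proof -
  note cS = subgroup.mem_carrier[OF S]
  have "g \<otimes> s \<otimes> inv g \<in> S" if s: "s \<in> S" and g: "g \<in> carrier G" for s g
  proof (cases "g \<in> S")
    case True
    then show ?thesis using s S by (simp add: subgroup.m_closed subgroup.m_inv_closed)
  next
    case False
    let ?h = "\<lambda>x. g \<otimes> x \<otimes> inv g"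
    have hom: "?h \<in> hom G G"
    proof (rule homI)
      fix x y assume "x \<in> carrier G" "y \<in> carrier G"
      then show "?h (x \<otimes> y) = ?h x \<otimes> ?h y" using g by (simp add: m_assoc)
    qed (use g in simp)
    interpret h: group_hom G G ?h using hom by unfold_locales
    let ?B = "?h ` S"
    have B: "subgroup ?B G" using h.subgroup_img_is_subgroup[OF S] .
    have injh: "inj_on ?h (carrier G)" using g by (auto intro!: inj_onI)
    then have cB: "card ?B = card S" using card_image inj_on_subset subgroup.subset[OF S] by blast
    have "inv g \<notin> S <#> ?B"
    proof
      assume "inv g \<in> S <#> ?B"
      then obtain a b where ab: "a \<in> S" "b \<in> S" "inv g = a \<otimes> (g \<otimes> b \<otimes> inv g)"
        unfolding set_mult_def by auto
      have "inv g \<otimes> g = a \<otimes> (g \<otimes> b \<otimes> inv g) \<otimes> g" using ab(3) by (rule arg_cong)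
      then have "inv g \<otimes> g = a \<otimes> g \<otimes> b" using g cS ab(1,2) by (simp add: m_assoc)
      then have "a \<otimes> g \<otimes> b = \<one>" using g by simp
      then have "g = inv a \<otimes> inv b" using g ab cS
        by (metis inv_closed inv_solve_left inv_solve_right l_one m_assoc m_closed r_one)
      then show False using False ab S by (simp add: subgroup.m_closed subgroup.m_inv_closed)
    qed
    then have "S <#> ?B \<noteq> carrier G" using g by auto
    moreover have "S <#> ?B \<subseteq> carrier G"
      using set_mult_closed subgroup.subset[OF S] subgroup.subset[OF B] by blast
    ultimately have lt: "card (S <#> ?B) < order G"
      unfolding order_def using fin by (intro psubset_card_mono) auto
    have I: "subgroup (S \<inter> ?B) G" using subgroups_Inter_pair S B by blast
    obtain d where d: "card S = card (S \<inter> ?B) * d"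
      using card_subgroup_dvd[OF I S] by (metis inf_le1 dvdE)
    have pos: "card (S \<inter> ?B) > 0" "card S > 0" using finite_subgroup_pos[OF fin] I S by auto
    have "card (S <#> ?B) * card (S \<inter> ?B) = card S * (card (S \<inter> ?B) * d)"
      using card_set_mult[OF S B fin] cB d by simp
    then have "card (S <#> ?B) = card S * d" using pos by simp
    then have "d < p" using lt card pos by simp
    moreover have "d dvd order G" using d card by (metis dvd_mult dvd_triv_right)
    ultimately have "d = 1" using min prime_factor_nat[of d] pos d
      by (metis dvd_trans dvd_imp_le leD less_le_trans mult_0_right neq0_conv)
    then have "S \<inter> ?B = S"
      using d finite_subgroup_pos[OF fin S] by (intro card_subset_eq) auto
    then have "S = ?B" using cB finite_subgroup_pos[OF fin B] by (intro card_subset_eq) auto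
    then show ?thesis using s by blast
  qed
  then show ?thesis using normal_invI[OF S] by blast
qed

lemma (in group) cyclic_in_order:
  assumes P: "subgroup P G" and u: "u \<in> P" and gen: "\<And>y. y \<in> P \<Longrightarrow> \<exists>k::nat. y = u [^] k"
    and fin: "finite (carrier G)"
  shows "ord u = card P"
proof -
  have uc: "u \<in> carrier G" using u subgroup.mem_carrier[OF P] by blast
  have "generate G {u} = P"
  proof
    show "generate G {u} \<subseteq> P" using generate_subgroup_incl[OF _ P] u by simp
    show "P \<subseteq> generate G {u}"
    proof
      fix y assume "y \<in> P"
      then obtain k :: nat where "y = u [^] k" using gen by blast
      then have "y = u [^] int k" by (simp add: int_pow_int)
      then show "y \<in> generate G {u}" using generate_pow[OF uc] by blast
    qed
  qed
  then show ?thesis using generate_pow_card[OF uc] by simp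
qed

text \<open>The fixed points of \<open>u\<close> on the cosets lie in the normalizer of
  \<open>P\<close>, which acts trivially on \<open>P/M\<close> because \<open>p\<close> is the smallest prime; the other orbits
  contribute conjugates of proper powers of \<open>u\<close>, which lie in \<open>M\<close>.\<close>

lemma (in group) cyclic_sylow_transfer:
  assumes fin: "finite (carrier G)" and p: "Factorial_Ring.prime p"
    and min: "\<And>q. Factorial_Ring.prime q \<Longrightarrow> q dvd order G \<Longrightarrow> p \<le> q"
    and P: "subgroup P G" "card P = p ^ multiplicity p (order G)" and pd: "p dvd order G"
    and u: "u \<in> P" and gen: "\<And>y. y \<in> P \<Longrightarrow> \<exists>k::nat. y = u [^] k"
    and A: "comm_group A" "order A = p" and lam: "lam \<in> hom (G\<lparr>carrier := P\<rparr>) A"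
    and t: "transversal G P t"
  shows "finprod A (\<lambda>C. lam (transfer_factor G t C u)) (rcosets P) = lam u [^]\<^bsub>A\<^esub> card (rcosets P)"
proof -
  interpret A: comm_group A by fact
  interpret PG: group "G\<lparr>carrier := P\<rparr>" using P(1) subgroup_imp_group by blast
  interpret lam: group_hom "G\<lparr>carrier := P\<rparr>" A lam using lam by unfold_locales
  note cP = subgroup.mem_carrier[OF P(1)]
  note uc = cP[OF u]
  have ou: "ord u = card P" using cyclic_in_order[OF P(1) u gen fin] .
  have lamc: "lam x \<in> carrier A" if "x \<in> P" for x using lam.hom_closed that by simp
  have lampow: "lam (x [^] (k::nat)) = lam x [^]\<^bsub>A\<^esub> k" if "x \<in> P" for x k
    using lam.hom_nat_pow[of x k] that nat_pow_consistent[of x k P] by simp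
  have Ap: "y [^]\<^bsub>A\<^esub> (p * k) = \<one>\<^bsub>A\<^esub>" if "y \<in> carrier A" for y and k :: nat
    using A.pow_order_eq_1[OF that] A(2) that by (simp add: A.nat_pow_pow[symmetric])
  have "multiplicity p (order G) \<noteq> 0"
    using multiplicity_neq_zero[OF p _ pd] fin order_gt_0_iff_finite by simp
  then have pP: "p dvd card P" using P(2) dvd_power[of "multiplicity p (order G)" p] by simp
  define n where "n = card (rcosets P)"
  define a where "a = transfer_factor G t"
  have rc: "C #> g \<in> rcosets P" if "C \<in> rcosets P" "g \<in> carrier G" for C g
    using rcosets_r_coset_closed[OF P(1) that] .
  have aP: "a C g \<in> P" if "C \<in> rcosets P" "g \<in> carrier G" for C g
    unfolding a_def using transfer_factor_closed[OF P(1) t that] .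
  have amult: "a C (g \<otimes> h) = a C g \<otimes> a (C #> g) h" if "C \<in> rcosets P" "g \<in> carrier G" "h \<in> carrier G" for C g h
    unfolding a_def using transfer_factor_mult[OF P(1) t that] .
  have it: "((\<lambda>C. C #> u) ^^ j) C = C #> u [^] j" if "C \<in> rcosets P" for C and j :: nat
    using that uc rcosets_subset_carrier[OF P(1)]
    by (induction j) (auto simp: coset_mult_assoc)
  \<comment> \<open>Dividing each factor by \<open>lam u\<close> turns the claim into the triviality
    of a product, which can be tested on each cycle of \<open>u\<close> on the cosets.\<close>
  define f where "f C = lam (a C u) \<otimes>\<^bsub>A\<^esub> inv\<^bsub>A\<^esub> lam u" for C
  have fc: "f C \<in> carrier A" if "C \<in> rcosets P" for C
    unfolding f_def using lamc aP[OF that uc] u by simp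
  \<comment> \<open>Along a cycle the cocycle identity telescopes: the first \<open>m\<close>
    factors at \<open>u\<close> combine into one factor at \<open>u [^] m\<close>.\<close>
  have part: "finprod A (\<lambda>j. f (C #> u [^] j)) {..<m} = lam (a C (u [^] m)) \<otimes>\<^bsub>A\<^esub> inv\<^bsub>A\<^esub> (lam u [^]\<^bsub>A\<^esub> m)"
    if C: "C \<in> rcosets P" for C and m :: nat
  proof (induction m)
    case 0
    have "C #> \<one> = C" using rcosets_subset_carrier[OF P(1) C] by simp
    then have "a C \<one> = \<one>" unfolding a_def transfer_factor_def
      using transversal_closed[OF P(1) t C] by simp
    then show ?case using lam.hom_one by simp
  next
    case (Suc m)
    have Cm: "C #> u [^] m \<in> rcosets P" using rc C uc by simp
    have "finprod A (\<lambda>j. f (C #> u [^] j)) {..<Suc m}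
        = f (C #> u [^] m) \<otimes>\<^bsub>A\<^esub> finprod A (\<lambda>j. f (C #> u [^] j)) {..<m}"
      using fc rc C uc by (simp add: lessThan_Suc)
    also have "\<dots> = lam (a C (u [^] m) \<otimes> a (C #> u [^] m) u) \<otimes>\<^bsub>A\<^esub> inv\<^bsub>A\<^esub> (lam u [^]\<^bsub>A\<^esub> Suc m)"
      unfolding Suc unfolding f_def[of "C #> u [^] m"] using lam.hom_mult[of "a C (u [^] m)" "a (C #> u [^] m) u"]
        lamc aP[OF Cm uc] aP[OF C, of "u [^] m"] u uc
      by (simp add: A.inv_mult A.m_ac)
    also have "a C (u [^] m) \<otimes> a (C #> u [^] m) u = a C (u [^] Suc m)"
      using amult[OF C, of "u [^] m" u] uc by simp
    finally show ?case .
  qed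
  have "finprod A f (rcosets P) = \<one>\<^bsub>A\<^esub>"
  proof (rule A.finprod_orbits_eq_one[where \<pi> = "\<lambda>C. C #> u"])
    show "finite (rcosets P)" using fin P(1) by (simp add: RCOSETS_def)
    show "bij_betw (\<lambda>C. C #> u) (rcosets P) (rcosets P)" using bij_betw_rcosets[OF P(1) uc] .
  next
    fix C m assume C: "C \<in> rcosets P" and m: "m > 0" "((\<lambda>C. C #> u) ^^ m) C = C"
      "\<And>j. 0 < j \<Longrightarrow> j < m \<Longrightarrow> ((\<lambda>C. C #> u) ^^ j) C \<noteq> C"
    note tC = transversal_closed[OF P(1) t C]
    have Cm: "C #> u [^] m = C" using m(2) it[OF C] by simp
    have aeq: "a C (u [^] m) = t C \<otimes> u [^] m \<otimes> inv (t C)"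
      unfolding a_def transfer_factor_def using Cm by simp
    have apm: "a C (u [^] m) = (t C \<otimes> u \<otimes> inv (t C)) [^] m" using aeq conj_pow[OF tC(1) uc] by simp
    have "lam (a C (u [^] m)) = lam u [^]\<^bsub>A\<^esub> m"
    proof (cases "m = 1")
      case True
      \<comment> \<open>A fixed coset: \<open>g\<close> conjugates \<open>u\<close> to
        \<open>u [^] s\<close>. Iterating over the order of \<open>g\<close>, and by Fermat, the
        order of \<open>s\<close> modulo \<open>p\<close> divides both the order of \<open>G\<close>
        and \<open>p - 1\<close>. These are coprime because \<open>p\<close> is the smallest prime
        divisor, so \<open>s\<close> is 1 modulo \<open>p\<close>.\<close>
      define g where "g = t C"
      have gc: "g \<in> carrier G" using tC g_def by simp
      have "g \<otimes> u \<otimes> inv g \<in> P" using aP[OF C uc] aeq True uc unfolding g_def by simp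
      then obtain s :: nat where s: "g \<otimes> u \<otimes> inv g = u [^] s" using gen by blast
      have iter: "g [^] k \<otimes> u \<otimes> inv (g [^] k) = u [^] (s ^ k)" for k :: nat
      proof (induction k)
        case (Suc k)
        have "g [^] Suc k \<otimes> u \<otimes> inv (g [^] Suc k) = g \<otimes> (g [^] k \<otimes> u \<otimes> inv (g [^] k)) \<otimes> inv g"
          unfolding nat_pow_Suc2[OF gc] using gc uc by (simp add: inv_mult_group m_assoc)
        also have "\<dots> = u [^] (s ^ Suc k)"
          unfolding Suc conj_pow[OF gc uc, symmetric] s using uc by (simp add: nat_pow_pow)
        finally show ?case .
      qed (use uc in simp)
      have "u [^] (s ^ order G) = u [^] (1::nat)"
        using iter[of "order G"] pow_order_eq_1[OF gc] uc by simp
      then have "[s ^ order G = 1] (mod p)"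
        using pow_eq_iff_cong[OF uc] ou pP cong_dvd_modulus_nat by metis
      moreover have "coprime (p - 1) (order G)"
      proof (rule ccontr)
        assume "\<not> coprime (p - 1) (order G)"
        then have "gcd (p - 1) (order G) \<noteq> 1" using coprime_iff_gcd_eq_1 by blast
        then obtain q where "Factorial_Ring.prime q" "q dvd gcd (p - 1) (order G)"
          using prime_factor_nat by blast
        then have q: "Factorial_Ring.prime q" "q dvd p - 1" "q dvd order G" by auto
        then have "q \<le> p - 1" using prime_gt_1_nat[OF p] by (intro dvd_imp_le) auto
        then show False using min[OF q(1,3)] prime_gt_1_nat[OF p] by simp
      qed
      moreover from \<open>[s ^ order G = 1] (mod p)\<close> have "\<not> p dvd s"
      proof -
        have "order G > 0" using fin order_gt_0_iff_finite by simp
        then show ?thesis using \<open>[s ^ order G = 1] (mod p)\<close> p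
          by (metis cong_dvd_iff dvd_power dvd_trans not_prime_unit)
      qed
      then have "[s ^ (p - 1) = 1] (mod p)" using fermat_theorem[OF p] by simp
      ultimately have "[s = 1] (mod p)"
        by (metis ord_divides coprime_common_divisor_nat dvd_refl power_one_right)
      then have "int p dvd int s - 1" using cong_iff_dvd_diff cong_int_iff by (metis of_nat_1)
      then obtain z where z: "int s - 1 = int p * z" by blast
      have "lam (u [^] s) = lam u [^]\<^bsub>A\<^esub> int s" using lampow[OF u] by (simp add: int_pow_int)
      also have "int s = int p * z + 1" using z by linarith
      also have "lam u [^]\<^bsub>A\<^esub> (int p * z + 1) = (lam u [^]\<^bsub>A\<^esub> int p) [^]\<^bsub>A\<^esub> z \<otimes>\<^bsub>A\<^esub> lam u"
        using lamc[OF u] by (simp only: A.int_pow_mult[OF lamc[OF u]] A.int_pow_pow[OF lamc[OF u]] A.int_pow_1)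
      also have "lam u [^]\<^bsub>A\<^esub> int p = \<one>\<^bsub>A\<^esub>" using Ap[OF lamc[OF u], of 1] by (simp add: int_pow_int)
      finally have "lam (u [^] s) = lam u" using lamc[OF u] by simp
      then show ?thesis using aeq True s lamc[OF u] uc unfolding g_def by simp
    next
      case False
      \<comment> \<open>The power \<open>card P\<close> of \<open>u\<close> is trivial and fixes
        every coset, so the least return time divides \<open>card P\<close> and is a power of
        \<open>p\<close>.\<close>
      have "m dvd card P"
      proof (rule ccontr)
        assume nd: "\<not> m dvd card P"
        define r where "r = card P mod m"
        have r: "0 < r" "r < m" using nd m(1) unfolding r_def by (auto simp: dvd_eq_mod_eq_0)
        have fix': "C #> u [^] (m * j) = C" for j :: nat
        proof (induction j)
          case (Suc j)
          have "C #> u [^] (m * Suc j) = C #> u [^] m #> u [^] (m * j)"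
            using coset_mult_assoc[OF rcosets_subset_carrier[OF P(1) C]] uc by (simp add: nat_pow_mult)
          then show ?case using Cm Suc by simp
        qed (use rcosets_subset_carrier[OF P(1) C] in simp)
        have "u [^] card P = \<one>" using pow_card_subgroup_eq_one[OF P(1) u] .
        then have "C = C #> u [^] (m * (card P div m) + r)"
          using rcosets_subset_carrier[OF P(1) C] unfolding r_def by simp
        also have "\<dots> = C #> u [^] (m * (card P div m)) #> u [^] r"
          using coset_mult_assoc[OF rcosets_subset_carrier[OF P(1) C]] uc by (simp add: nat_pow_mult)
        also have "\<dots> = C #> u [^] r" using fix' by simp
        finally show False using m(3)[OF r] it[OF C] by simp
      qed
      then obtain i where i: "m = p ^ i" using P(2) divides_primepow_nat[OF p, of m] by auto
      then have pm: "p dvd m" using False by (cases i) auto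
      obtain k :: nat where k: "a C (u [^] m) = u [^] k" using gen[OF aP[OF C, of "u [^] m"]] uc by auto
      \<comment> \<open>Otherwise \<open>u [^] k\<close> would generate \<open>P\<close>, but it is
        conjugate to \<open>u [^] m\<close> and therefore killed by the smaller exponent
        \<open>card P div m\<close>. With \<open>p\<close> dividing both \<open>k\<close> and
        \<open>m\<close>, \<open>lam\<close> sends both powers to the identity.\<close>
      have "p dvd k"
      proof (rule ccontr)
        assume "\<not> p dvd k"
        then have "coprime k (card P)" using prime_not_dvd_coprime_power[OF p] P(2) by simp
        moreover have "u [^] (k * (card P div m)) = \<one>"
        proof -
          have "u [^] (k * (card P div m)) = (a C (u [^] m)) [^] (card P div m)"
            using k uc by (simp add: nat_pow_pow)
          also have "\<dots> = (t C \<otimes> u \<otimes> inv (t C)) [^] card P"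
            using apm tC(1) uc \<open>m dvd card P\<close> by (simp add: nat_pow_pow)
          also have "\<dots> = \<one>" using conj_pow[OF tC(1) uc] pow_card_subgroup_eq_one[OF P(1) u] tC(1) by simp
          finally show ?thesis .
        qed
        then have "card P dvd k * (card P div m)" using ou pow_eq_id[OF uc] by simp
        ultimately have "card P dvd card P div m" using coprime_dvd_mult_right_iff coprime_commute by blast
        moreover have "card P div m > 0" "card P div m < card P"
          using finite_subgroup_pos[OF fin P(1)] \<open>m dvd card P\<close> m(1) False
          by (auto simp: div_greater_zero_iff dvd_imp_le)
        ultimately show False using dvd_imp_le by fastforce
      qed
      then obtain k' where "k = p * k'" by blast
      moreover obtain m' where "m = p * m'" using pm by blast
      ultimately show ?thesis using k lampow[OF u, of k] Ap[OF lamc[OF u]] by simp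
    qed
    then show "finprod A (\<lambda>j. f (((\<lambda>C. C #> u) ^^ j) C)) {..<m} = \<one>\<^bsub>A\<^esub>"
      using part[OF C, of m] it[OF C] lamc[OF u] by simp
  qed (use fc in auto)
  moreover have "finprod A f (rcosets P) \<otimes>\<^bsub>A\<^esub> finprod A (\<lambda>C. lam u) (rcosets P)
      = finprod A (\<lambda>C. lam (a C u)) (rcosets P)"
  proof -
    have "finprod A f (rcosets P) \<otimes>\<^bsub>A\<^esub> finprod A (\<lambda>C. lam u) (rcosets P)
        = finprod A (\<lambda>C. f C \<otimes>\<^bsub>A\<^esub> lam u) (rcosets P)"
      using fc lamc[OF u] by (intro A.finprod_multf[symmetric]) auto
    also have "\<dots> = finprod A (\<lambda>C. lam (a C u)) (rcosets P)"
      using lamc[OF u] lamc aP uc by (intro A.finprod_cong') (auto simp: f_def A.m_assoc)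
    finally show ?thesis .
  qed
  moreover have "finprod A (\<lambda>C. lam u) (rcosets P) = lam u [^]\<^bsub>A\<^esub> n"
    unfolding n_def by (rule A.finprod_const[OF lamc[OF u]])
  ultimately show ?thesis unfolding a_def n_def using lamc[OF u] by simp
qed

section \<open>Groups of prime order, and \<open>p\<close>-nilpotency for the smallest prime\<close>

lemma (in normal) order_FactGroup: "order (G Mod H) * card H = order G"
  using lagrange[OF subgroup_axioms] by (simp add: order_def FactGroup_def)

lemma (in group) prime_order_cyclic_in:
  assumes N: "subgroup N G" and p: "Factorial_Ring.prime (card N)" and a: "a \<in> N" "a \<noteq> \<one>"
  shows "ord a = card N" "\<And>y. y \<in> N \<Longrightarrow> \<exists>k::nat. y = a [^] k"
proof -
  have ac: "a \<in> carrier G" using subgroup.mem_carrier[OF N a(1)] .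
  have fN: "finite N" using p by (metis card.infinite not_prime_0)
  have "ord a dvd card N" using pow_card_subgroup_eq_one[OF N a(1)] pow_eq_id[OF ac] by simp
  moreover have "ord a \<noteq> 1" using ord_eq_1[OF ac] a(2) by simp
  ultimately show o: "ord a = card N" using p by (metis One_nat_def prime_nat_iff)
  have "generate G {a} \<subseteq> N" using generate_subgroup_incl[OF _ N] a(1) by simp
  moreover have "card (generate G {a}) = card N" using generate_pow_card[OF ac] o by simp
  ultimately have gen: "generate G {a} = N" using fN by (intro card_subset_eq) auto
  fix y assume "y \<in> N"
  then obtain k :: int where k: "y = a [^] k" using gen generate_pow[OF ac] by auto
  have "a [^] k = a [^] (k mod int (card N))"
    using int_pow_eq[OF ac] o by (simp add: mod_eq_dvd_iff[symmetric] )
  also have "k mod int (card N) = int (nat (k mod int (card N)))"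
    using prime_gt_0_nat[OF p] by simp
  finally show "\<exists>k::nat. y = a [^] k" using k int_pow_int by metis
qed

lemma (in group) prime_order_comm_group:
  assumes p: "Factorial_Ring.prime (order G)"
  shows "comm_group G"
proof (rule group_comm_groupI)
  fix x y assume xy: "x \<in> carrier G" "y \<in> carrier G"
  show "x \<otimes> y = y \<otimes> x"
  proof (cases "x = \<one>")
    case False
    then obtain k :: nat where "y = x [^] k"
      using prime_order_cyclic_in(2)[OF subgroup_self _ xy(1)] p xy(2) unfolding order_def by blast
    then show ?thesis using xy by (metis nat_pow_Suc nat_pow_Suc2)
  qed (use xy in simp)
qed

text \<open>\<open>P/M\<close> has prime order and is therefore abelian, which makes it a possible
  target for a transfer.\<close>

lemma (in group) nilpotent_maximal_quotient:
  assumes fin: "finite (carrier G)" and p: "Factorial_Ring.prime p"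
    and nil: "nilpotent_in G P" and card: "card P = p ^ k" and M: "maximal_in G M P"
  obtains A :: "'a set monoid" and lam where "comm_group A" "order A = p" "lam \<in> hom (G\<lparr>carrier := P\<rparr>) A"
    "\<And>u. u \<in> P \<Longrightarrow> lam u = \<one>\<^bsub>A\<^esub> \<longleftrightarrow> u \<in> M"
proof -
  note M' = maximal_inD[OF M]
  have P: "subgroup P G" using nil nilpotent_in_imp_subgroup by blast
  let ?P = "G\<lparr>carrier := P\<rparr>"
  interpret PG: group ?P using subgroup_imp_group[OF P] .
  have "M \<lhd> ?P"
    using normal_in_restrictI[OF P M'(1,2)] nilpotent_maximal_normal[OF nil M] by blast
  then interpret Mn: normal M ?P .
  define A where "A = ?P Mod M"
  define lam where "lam = (\<lambda>z. M #>\<^bsub>?P\<^esub> z)"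
  interpret A: group A unfolding A_def using Mn.factorgroup_is_group .
  obtain q where q: "Factorial_Ring.prime q" "card P = q * card M"
    using nilpotent_maximal_prime_index[OF nil finite_subgroup_pos(2)[OF fin P] M] .
  have "q dvd card P" using q(2) by simp
  then have "q dvd p" using card prime_dvd_power[OF q(1)] by metis
  then have "q = p" using primes_dvd_imp_eq[OF q(1) p] by simp
  then have oA: "order A = p"
    using Mn.order_FactGroup q(2) finite_subgroup_pos(1)[OF fin M'(1)]
    unfolding A_def by (simp add: order_def)
  have "lam u = \<one>\<^bsub>A\<^esub> \<longleftrightarrow> u \<in> M" if "u \<in> P" for u
    using PG.rcos_self[OF _ Mn.subgroup_axioms, of u] Mn.rcos_const[OF PG.group_axioms, of u] that
    by (auto simp: lam_def A_def)
  moreover have "lam \<in> hom ?P A" unfolding lam_def A_def using Mn.r_coset_hom_Mod .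
  ultimately show thesis using that A.prime_order_comm_group oA p by blast
qed

lemma (in group) transversal_exists:
  assumes "subgroup P G"
  obtains t where "transversal G P t"
proof -
  have "\<exists>t. \<forall>C\<in>rcosets P. t C \<in> C"
    using subgroup.rcosets_non_empty[OF assms] by (intro bchoice) auto
  then show thesis using that unfolding transversal_def by blast
qed

lemma (in group) sylow_not_subset:
  assumes fin: "finite (carrier G)" and p: "Factorial_Ring.prime p" and pd: "p dvd order G"
    and P: "subgroup P G" "card P = p ^ multiplicity p (order G)"
    and S: "subgroup S G" "order G = p * card S"
  shows "\<not> P \<subseteq> S"
proof
  assume "P \<subseteq> S"
  then have "card P dvd card S" using card_subgroup_dvd[OF P(1) S(1)] by blast
  then have "p ^ Suc (multiplicity p (order G)) dvd order G" using S(2) P(2) by simp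
  then show False
    using not_dvd_Suc_multiplicity[OF p, of "order G"] fin order_gt_0_iff_finite by simp
qed

lemma (in group) p_residual_index_p:
  assumes p: "Factorial_Ring.prime p" and S: "S \<lhd> G" and fin: "finite (carrier G)"
    and card: "order G = p * card S"
  shows "p_residual G p \<subseteq> S"
proof -
  interpret S: normal S G by fact
  interpret Q: group "G Mod S" using S.factorgroup_is_group .
  have oG: "order G > 0" using fin order_gt_0_iff_finite by simp
  have "order (G Mod S) = p ^ 1"
    using S.order_FactGroup card oG by simp
  moreover have "(\<lambda>x. S #> x) \<in> hom (G\<lparr>carrier := carrier G\<rparr>) (G Mod S)"
    using S.r_coset_hom_Mod by simp
  ultimately have "S #> x = S" if "x \<in> p_residual G p" for x
    using p_residual_hom_trivial[OF p subgroup_self Q.group_axioms] that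
      subgroup.subset[OF normal_imp_subgroup[OF p_residual_normal]] by fastforce
  moreover have "x \<in> carrier G" if "x \<in> p_residual G p" for x
    using that subgroup.mem_carrier[OF normal_imp_subgroup[OF p_residual_normal]] by blast
  ultimately show ?thesis using rcos_self[OF _ S.subgroup_axioms] by blast
qed

text \<open>A proper \<open>M\<close> lies in some maximal \<open>M'\<close> of \<open>P\<close>.
  The subgroup \<open>S\<close> of index \<open>p\<close> above \<open>M'\<close> is normal, hence
  contains the residual, and meets \<open>P\<close> exactly in \<open>M'\<close>; so both factors of
  the product stay inside \<open>M'\<close>.\<close>

lemma (in group) p_residual_nongenerators_noncyclic:
  assumes fin: "finite (carrier G)" and p: "Factorial_Ring.prime p" and pd: "p dvd order G"
    and min: "\<And>q. Factorial_Ring.prime q \<Longrightarrow> q dvd order G \<Longrightarrow> p \<le> q"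
    and P: "subgroup P G" "card P = p ^ multiplicity p (order G)"
    and max: "\<And>M. maximal_in G M P \<Longrightarrow> \<exists>S. subgroup S G \<and> M \<subseteq> S \<and> order G = p * card S"
    and M: "subgroup M G" "M \<subseteq> P" "(P \<inter> p_residual G p) <#> M = P"
  shows "M = P"
proof (rule ccontr)
  assume "M \<noteq> P"
  then obtain M' where M': "maximal_in G M' P" "M \<subseteq> M'"
    using maximal_in_exists[OF M(1), of P] M(2) finite_subgroup_pos[OF fin P(1)] by blast
  obtain S where S: "subgroup S G" "M' \<subseteq> S" "order G = p * card S" using max[OF M'(1)] by blast
  have "S \<lhd> G" using smallest_prime_index_normal[OF fin p min S(1,3)] .
  then have NS: "p_residual G p \<subseteq> S" using p_residual_index_p[OF p _ fin S(3)] by blast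
  have "P \<inter> S = M'"
    using maximal_inD[OF M'(1)] S(2) subgroups_Inter_pair[OF P(1) S(1)]
      sylow_not_subset[OF fin p pd P S(1,3)] by (metis inf.cobounded1 inf.orderI le_inf_iff)
  then have "P \<inter> p_residual G p \<subseteq> M'" using NS by blast
  then have "(P \<inter> p_residual G p) <#> M \<subseteq> M'"
    using M'(2) subgroup.m_closed[OF maximal_inD(1)[OF M'(1)]] unfolding set_mult_def by blast
  then show False using M(3) maximal_inD[OF M'(1)] by auto
qed

text \<open>The transfer to the quotient of \<open>P\<close> by a maximal subgroup is nontrivial at
  a generator \<open>u\<close> but kills the residual. Elements of \<open>P\<close> in the residual
  are thus \<open>u [^] i\<close> with \<open>p\<close> dividing \<open>i\<close>, so in
  \<open>u = k \<otimes> m\<close> the factor \<open>m\<close> already generates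
  \<open>P\<close>.\<close>

lemma (in group) p_residual_nongenerators_cyclic:
  assumes fin: "finite (carrier G)" and p: "Factorial_Ring.prime p" and pd: "p dvd order G"
    and min: "\<And>q. Factorial_Ring.prime q \<Longrightarrow> q dvd order G \<Longrightarrow> p \<le> q"
    and P: "subgroup P G" "card P = p ^ multiplicity p (order G)" and nil: "nilpotent_in G P"
    and cyc: "cyclic_in G P"
    and M: "subgroup M G" "M \<subseteq> P" "(P \<inter> p_residual G p) <#> M = P"
  shows "M = P"
proof -
  obtain u where u: "u \<in> P" and gen: "\<And>y. y \<in> P \<Longrightarrow> \<exists>k::nat. y = u [^] k"
    using cyc unfolding cyclic_in_def by blast
  note cP = subgroup.mem_carrier[OF P(1)]
  note uc = cP[OF u]
  have ou: "ord u = card P" using cyclic_in_order[OF P(1) u gen fin] .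
  have fP: "finite P" using finite_subgroup_pos[OF fin P(1)] by simp
  have oG: "order G > 0" using fin order_gt_0_iff_finite by simp
  have "multiplicity p (order G) \<noteq> 0" using multiplicity_neq_zero[OF p oG pd] .
  then have pP: "p dvd card P" using P(2) dvd_power[of "multiplicity p (order G)" p] by simp
  have "card P \<noteq> 1" using pP p by (metis nat_dvd_1_iff_1 not_prime_1)
  then have "P \<noteq> {\<one>}" by auto
  then obtain R where R: "maximal_in G R P"
    using maximal_in_exists[OF triv_subgroup, of P] fP subgroup.one_closed[OF P(1)] by blast
  note R' = maximal_inD[OF R]
  obtain A :: "'a set monoid" and lam where A: "comm_group A" and oA: "order A = p"
    and lam: "lam \<in> hom (G\<lparr>carrier := P\<rparr>) A" and lamR: "\<And>u. u \<in> P \<Longrightarrow> lam u = \<one>\<^bsub>A\<^esub> \<longleftrightarrow> u \<in> R"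
    using nilpotent_maximal_quotient[OF fin p nil P(2) R] by blast
  interpret A: comm_group A by fact
  obtain t where t: "transversal G P t" using transversal_exists[OF P(1)] .
  define V where "V = (\<lambda>g. finprod A (\<lambda>C. lam (transfer_factor G t C g)) (rcosets P))"
  have V: "V \<in> hom G A" unfolding V_def
    using transfer_hom[OF P(1) fin A.comm_group_axioms lam t] .
  then interpret V: group_hom G A V by unfold_locales
  have Vu: "V u = lam u [^]\<^bsub>A\<^esub> card (rcosets P)" unfolding V_def
    using cyclic_sylow_transfer[OF fin p min P pd u gen A.comm_group_axioms oA lam t] .
  have lamu: "lam u \<in> carrier A" using hom_in_carrier[OF lam] u by simp
  have lamu1: "lam u \<noteq> \<one>\<^bsub>A\<^esub>"
  proof
    assume "lam u = \<one>\<^bsub>A\<^esub>"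
    then have "u \<in> R" using lamR[OF u] by blast
    then have "u [^] (k::nat) \<in> R" for k
      using subgroup_int_pow_closed[OF R'(1), of u "int k"] by (simp add: int_pow_int)
    then have "P \<subseteq> R" using gen by blast
    then show False using R'(2,3) by blast
  qed
  note ndn = sylow_index_not_dvd[OF fin p P]
  have Vu1: "V u \<noteq> \<one>\<^bsub>A\<^esub>"
  proof
    assume "V u = \<one>\<^bsub>A\<^esub>"
    moreover have "lam u [^]\<^bsub>A\<^esub> p = \<one>\<^bsub>A\<^esub>" using A.pow_order_eq_1[OF lamu] oA by simp
    ultimately show False
      using A.pow_coprime_one[OF lamu, of "card (rcosets P)" p] Vu lamu1
        prime_not_dvd_coprime_power[OF p ndn, of 1] by simp
  qed
  have V1: "V k = \<one>\<^bsub>A\<^esub>" if "k \<in> p_residual G p" for k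
    using p_residual_hom_trivial[OF p subgroup_self A.group_axioms, of 1 V k] V oA that
      subgroup.subset[OF normal_imp_subgroup[OF p_residual_normal]] by simp
  obtain k m where km: "k \<in> P \<inter> p_residual G p" "m \<in> M" "u = k \<otimes> m"
    using u M(3) unfolding set_mult_def by blast
  obtain i j :: nat where ij: "k = u [^] i" "m = u [^] j" using gen km M(2) by blast
  have "p dvd i"
  proof (rule ccontr)
    assume "\<not> p dvd i"
    moreover have "V u [^]\<^bsub>A\<^esub> i = \<one>\<^bsub>A\<^esub>" using V1[of k] km(1) ij(1) V.hom_nat_pow[OF uc, of i] by simp
    moreover have "V u [^]\<^bsub>A\<^esub> p = \<one>\<^bsub>A\<^esub>" using A.pow_order_eq_1[of "V u"] oA uc by simp
    ultimately show False
      using A.pow_coprime_one[of "V u" i p] Vu1 uc prime_not_dvd_coprime_power[OF p, of i 1] by simp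
  qed
  have "u [^] (i + j) = k \<otimes> m" using ij uc by (simp add: nat_pow_mult)
  then have "u [^] (i + j) = u [^] (1::nat)" using km(3)[symmetric] uc by simp
  then have "[i + j = 1] (mod card P)" using pow_eq_iff_cong[OF uc] ou by metis
  then have "[i + j = 1] (mod p)" using pP cong_dvd_modulus_nat by blast
  then have "\<not> p dvd i + j" using p by (metis cong_dvd_iff nat_dvd_1_iff_1 not_prime_1)
  then have "\<not> p dvd j" using \<open>p dvd i\<close> dvd_add by blast
  then have "coprime j (card P)" using prime_not_dvd_coprime_power[OF p] P(2) by simp
  then obtain r where "[j * r = 1] (mod card P)" using cong_solve_coprime_nat by auto
  then have "u [^] (j * r) = u [^] (1::nat)" by (simp only: pow_eq_iff_cong[OF uc] ou)
  then have "u = m [^] r" using ij uc by (simp add: nat_pow_pow)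
  then have "u \<in> M" using km(2) subgroup_int_pow_closed[OF M(1), of m "int r"] by (simp add: int_pow_int)
  then have "u [^] (k::nat) \<in> M" for k
    using subgroup_int_pow_closed[OF M(1), of u "int k"] by (simp add: int_pow_int)
  then show "M = P" using gen M(2) by blast
qed

text \<open>The order formula expresses that \<open>O^p(G)\<close> is a normal
  \<open>p\<close>-complement. It follows because Tate's criterion makes \<open>P\<close> and the
  residual meet trivially while their product is \<open>G\<close>.\<close>

lemma (in group) smallest_prime_p_nilpotent:
  assumes fin: "finite (carrier G)" and p: "Factorial_Ring.prime p" and pd: "p dvd order G"
    and min: "\<And>q. Factorial_Ring.prime q \<Longrightarrow> q dvd order G \<Longrightarrow> p \<le> q"
    and P: "subgroup P G" "card P = p ^ multiplicity p (order G)" and nil: "nilpotent_in G P"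
    and cm: "cyclic_in G P \<or>
      (\<forall>M. maximal_in G M P \<longrightarrow> (\<exists>S. subgroup S G \<and> M \<subseteq> S \<and> order G = p * card S))"
  shows "order G = p ^ multiplicity p (order G) * card (p_residual G p)"
proof -
  let ?N = "p_residual G p"
  have "P \<inter> ?N = {\<one>}"
    using tate[OF fin p P nil] p_residual_nongenerators_noncyclic[OF fin p pd min P]
      p_residual_nongenerators_cyclic[OF fin p pd min P nil] cm by blast
  then show ?thesis
    using card_set_mult[OF P(1) normal_imp_subgroup[OF p_residual_normal] fin, of p]
      sylow_mult_p_residual[OF fin p P] P(2) by (simp add: order_def)
qed

section \<open>The Sylow tower\<close>

lemma (in group) commutator_restrict:
  assumes "subgroup N G" "x \<in> N" "y \<in> N"
  shows "commutator (G\<lparr>carrier := N\<rparr>) x y = commutator G x y"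
  unfolding commutator_def using m_inv_consistent[OF assms(1)] assms by simp

lemma (in group) nilpotent_in_restrict:
  assumes N: "subgroup N G" and U: "nilpotent_in G U" "U \<subseteq> N"
  shows "nilpotent_in (G\<lparr>carrier := N\<rparr>) U"
proof -
  obtain W n where "central_series G W n U" using nilpotent_in_series[OF U(1)] by blast
  note W = central_seriesD[OF this]
  have "commutator (G\<lparr>carrier := N\<rparr>) x g \<in> W i" if i: "i < n" and x: "x \<in> W (Suc i)" and g: "g \<in> U" for i x g
  proof -
    have "x \<in> N" "g \<in> N" using W(4)[of "Suc i"] i x g U(2) by auto
    then show ?thesis using W(6)[OF i x g] commutator_restrict[OF N] by simp
  qed
  moreover have "subgroup (W i) (G\<lparr>carrier := N\<rparr>)" if "i \<le> n" for i
    using subgroup_restrict_iff[OF N] W(3,4)[OF that] U(2) by blast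
  moreover have "subgroup U (G\<lparr>carrier := N\<rparr>)"
    using subgroup_restrict_iff[OF N] nilpotent_in_imp_subgroup[OF U(1)] U(2) by blast
  ultimately show ?thesis
    unfolding nilpotent_in_def using W(1,2,5) by (intro conjI exI[of _ n] exI[of _ W]) auto
qed

lemma (in group) cyclic_in_restrict:
  assumes N: "subgroup N G" and U: "cyclic_in G U" "U \<subseteq> N"
  shows "cyclic_in (G\<lparr>carrier := N\<rparr>) U"
  using subgroup_restrict_iff[OF N] U nat_pow_consistent unfolding cyclic_in_def by simp

lemma (in group) maximal_in_restrict:
  assumes N: "subgroup N G" and U: "U \<subseteq> N"
  shows "maximal_in (G\<lparr>carrier := N\<rparr>) M U \<longleftrightarrow> maximal_in G M U"
  unfolding maximal_in_def subgroup_restrict_iff[OF N] using U by (metis subset_trans)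

text \<open>The coset of \<open>x\<close> is killed by a power of \<open>q\<close> in a quotient
  whose order is prime to \<open>q\<close>.\<close>

lemma (in group) normal_sylow_contains:
  assumes fin: "finite (carrier G)" and q: "Factorial_Ring.prime q"
    and Q: "Q \<lhd> G" "card Q = q ^ multiplicity q (order G)"
    and x: "x \<in> carrier G" "x [^] (q ^ b) = \<one>"
  shows "x \<in> Q"
proof -
  interpret Q: normal Q G by fact
  interpret F: group "G Mod Q" using Q.factorgroup_is_group .
  interpret f: group_hom G "G Mod Q" "\<lambda>z. Q #> z" using Q.r_coset_hom_Mod by unfold_locales
  have oG: "order G > 0" using fin order_gt_0_iff_finite by simp
  have "\<not> q dvd order (G Mod Q)"
  proof
    assume "q dvd order (G Mod Q)"
    then have "q * card Q dvd order G" using Q.order_FactGroup by (metis dvd_refl mult_dvd_mono)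
    then show False using not_dvd_Suc_multiplicity[OF q oG] Q(2) by simp
  qed
  then have cop: "coprime (order (G Mod Q)) (q ^ b)" using prime_not_dvd_coprime_power[OF q] by blast
  have c: "Q #> x \<in> carrier (G Mod Q)" using f.hom_closed x(1) by blast
  have "(Q #> x) [^]\<^bsub>G Mod Q\<^esub> (q ^ b) = \<one>\<^bsub>G Mod Q\<^esub>"
    using f.hom_nat_pow[OF x(1), of "q ^ b"] x(2) f.hom_one by simp
  then have "Q #> x = \<one>\<^bsub>G Mod Q\<^esub>"
    using F.pow_coprime_one[OF c F.pow_order_eq_1[OF c] _ cop] by blast
  then show ?thesis using rcos_self[OF x(1) Q.subgroup_axioms] by simp
qed

text \<open>A normal Sylow subgroup of \<open>N\<close> contains every element of \<open>N\<close>
  of \<open>q\<close>-power order, and conjugation by \<open>G\<close> preserves this set of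
  elements.\<close>

lemma (in group) normal_sylow_of_normal:
  assumes fin: "finite (carrier G)" and q: "Factorial_Ring.prime q" and N: "N \<lhd> G"
    and Q: "Q \<lhd> (G\<lparr>carrier := N\<rparr>)" "card Q = q ^ multiplicity q (card N)"
  shows "Q \<lhd> G"
proof -
  have sN: "subgroup N G" using N normal_imp_subgroup by blast
  interpret NG: group "G\<lparr>carrier := N\<rparr>" using sN subgroup_imp_group by blast
  have sQ: "subgroup Q G" "Q \<subseteq> N"
    using subgroup_restrict_iff[OF sN, of Q] normal_imp_subgroup[OF Q(1)] by auto
  have "g \<otimes> x \<otimes> inv g \<in> Q" if x: "x \<in> Q" and g: "g \<in> carrier G" for x g
  proof -
    have xc: "x \<in> carrier G" using subgroup.mem_carrier[OF sQ(1) x] .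
    have "(g \<otimes> x \<otimes> inv g) [^] (q ^ multiplicity q (card N)) = \<one>"
      using conj_pow[OF g xc] pow_card_subgroup_eq_one[OF sQ(1) x] Q(2) g by simp
    moreover have "g \<otimes> x \<otimes> inv g \<in> N" using normal.inv_op_closed2[OF N g] x sQ(2) by blast
    ultimately show ?thesis
      using NG.normal_sylow_contains[OF _ q Q(1), of "g \<otimes> x \<otimes> inv g" "multiplicity q (card N)"]
        Q(2) finite_subgroup_pos[OF fin sN] nat_pow_consistent by (simp add: order_def)
  qed
  then show ?thesis by (intro normal_invI[OF sQ(1)]) auto
qed

lemma multiplicity_mult_other_prime_power:
  assumes "Factorial_Ring.prime (p::nat)" "Factorial_Ring.prime q" "q \<noteq> p" "k > 0"
  shows "multiplicity q (p ^ a * k) = multiplicity q k"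
proof -
  have "multiplicity q (p ^ a) = 0"
    using assms prime_dvd_power primes_dvd_imp_eq not_dvd_imp_multiplicity_0 by metis
  then show ?thesis
    using assms prime_elem_multiplicity_mult_distrib[of q "p ^ a" k] by (simp add: prime_gt_0_nat)
qed

text \<open>Chosen to be inherited by the normal complement of the smallest prime, so that the tower
  can be built by induction.\<close>

definition sylow_tower_condition :: "('a, 'b) monoid_scheme \<Rightarrow> bool"
  where "sylow_tower_condition G \<longleftrightarrow> (\<forall>p. Factorial_Ring.prime p \<and> p dvd order G \<longrightarrow>
    (\<exists>P. subgroup P G \<and> card P = p ^ multiplicity p (order G) \<and> nilpotent_in G P \<and>
      (cyclic_in G P \<or>
        (\<forall>M. maximal_in G M P \<longrightarrow> (\<exists>S. subgroup S G \<and> M \<subseteq> S \<and> order G = p * card S)))))"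

text \<open>The index of \<open>S\<close> in \<open>S <#> N\<close> divides \<open>r\<close>. If it
  were 1, \<open>N\<close> would lie in \<open>S\<close> and force the whole \<open>r\<close>-part
  of the order of \<open>G\<close> into \<open>S\<close>.\<close>

lemma (in group) prime_index_inter_normal:
  assumes fin: "finite (carrier G)" and r: "Factorial_Ring.prime r"
    and S: "subgroup S G" "order G = r * card S"
    and N: "N \<lhd> G" and mult: "multiplicity r (card N) = multiplicity r (order G)"
  shows "card N = r * card (N \<inter> S)"
proof -
  have sN: "subgroup N G" using N normal_imp_subgroup by blast
  have oG: "order G > 0" using fin order_gt_0_iff_finite by simp
  have SN: "subgroup (S <#> N) G"
    using subgroup_mult_normal[OF S(1) N] .
  note sub = subset_set_mult_subgroup[OF S(1) sN]
  obtain c where c: "card (S <#> N) = card S * c" using card_subgroup_dvd[OF S(1) SN sub(1)] by blast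
  have "card S * c dvd card S * r"
    using card_subgroup_dvd_order[OF SN] c S(2) by (simp add: mult.commute)
  then have "c dvd r" using finite_subgroup_pos(1)[OF fin S(1)] by simp
  moreover have "c \<noteq> 1"
  proof
    assume "c = 1"
    then have "card N dvd card S" using card_subgroup_dvd[OF sN SN sub(2)] c by simp
    then have "r ^ multiplicity r (order G) dvd card S" using mult multiplicity_dvd dvd_trans by metis
    then have "r ^ Suc (multiplicity r (order G)) dvd order G" using S(2) by simp
    then show False using not_dvd_Suc_multiplicity[OF r oG] by blast
  qed
  ultimately have "c = r" using r by (metis One_nat_def prime_nat_iff)
  then have "r * card S * card (S \<inter> N) = card S * card N"
    using card_set_mult[OF S(1) sN fin] c by (simp add: mult.commute)
  then show ?thesis using finite_subgroup_pos(1)[OF fin S(1)] by (simp add: Int_commute mult.assoc mult.left_commute)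
qed

text \<open>Passing to the normal complement of the smallest prime strips primes from below until
  only \<open>q\<close> is left, where the whole group is its own Sylow subgroup. Going back up uses
  that a normal Sylow subgroup of a normal subgroup is normal in the whole group.\<close>

lemma largest_prime_sylow_normal:
  fixes G :: "('a, 'b) monoid_scheme"
  assumes "group G" "finite (carrier G)" "sylow_tower_condition G"
    and "Factorial_Ring.prime q" "q dvd order G"
    and "\<And>r. Factorial_Ring.prime r \<Longrightarrow> r dvd order G \<Longrightarrow> r \<le> q"
  shows "\<exists>Q. Q \<lhd> G \<and> card Q = q ^ multiplicity q (order G)"
  using assms
proof (induction "order G" arbitrary: G rule: less_induct)
  case (less G)
  interpret group G by fact
  note fin = less.prems(2) and q = less.prems(4)
  have oG: "order G > 0" using fin order_gt_0_iff_finite by simp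
  define p where "p = (LEAST p. Factorial_Ring.prime p \<and> p dvd order G)"
  have p: "Factorial_Ring.prime p" "p dvd order G"
    using LeastI[of "\<lambda>p. Factorial_Ring.prime p \<and> p dvd order G" q] less.prems(4,5) p_def by auto
  have min: "p \<le> r" if "Factorial_Ring.prime r" "r dvd order G" for r
    unfolding p_def using that by (intro Least_le) auto
  show ?case
  proof (cases "p = q")
    case True
    then have "r = q" if "Factorial_Ring.prime r" "r dvd order G" for r
      using min[OF that] less.prems(6)[OF that] by simp
    then obtain e where "order G = q ^ e" using prime_power_if_unique_prime_factor[OF oG q] by blast
    then have "card (carrier G) = q ^ multiplicity q (order G)"
      using q by (simp add: order_def multiplicity_same_power' not_prime_unit prime_gt_0_nat)
    then show ?thesis using normal_self by blast
  next
    case False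
    define N where "N = p_residual G p"
    have N: "N \<lhd> G" "subgroup N G" unfolding N_def using p_residual_normal normal_imp_subgroup by blast+
    let ?N = "G\<lparr>carrier := N\<rparr>"
    interpret NG: group ?N using N(2) subgroup_imp_group by blast
    have finN: "finite N" "card N > 0" using finite_subgroup_pos[OF fin N(2)] by auto
    obtain P where "subgroup P G" "card P = p ^ multiplicity p (order G)" "nilpotent_in G P"
      "cyclic_in G P \<or>
        (\<forall>M. maximal_in G M P \<longrightarrow> (\<exists>S. subgroup S G \<and> M \<subseteq> S \<and> order G = p * card S))"
      using less.prems(3) p unfolding sylow_tower_condition_def by blast
    then have oN: "order G = p ^ multiplicity p (order G) * card N"
      using smallest_prime_p_nilpotent[OF fin p min] unfolding N_def by blast
    have multr: "multiplicity r (card N) = multiplicity r (order G)"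
      if "Factorial_Ring.prime r" "r \<noteq> p" for r
      using multiplicity_mult_other_prime_power[OF p(1) that finN(2)] oN by metis
    have "multiplicity p (order G) \<noteq> 0" using multiplicity_neq_zero[OF p(1) oG p(2)] .
    then have "p ^ multiplicity p (order G) > 1" using one_less_power[OF prime_gt_1_nat[OF p(1)]] by simp
    then have "1 * card N < p ^ multiplicity p (order G) * card N"
      using finN(2) by (intro mult_strict_right_mono)
    then have "card N < order G" using oN by linarith
    then have lt: "order ?N < order G" by (simp add: order_def)
    have npN: "\<not> p dvd card N"
    proof
      assume "p dvd card N"
      then have "p ^ Suc (multiplicity p (order G)) dvd order G" using oN by (metis mult_dvd_mono dvd_refl power_Suc2)
      then show False using not_dvd_Suc_multiplicity[OF p(1) oG] by blast
    qed
    have dvdN: "r dvd order G" if "r dvd card N" for r using that oN by (metis dvd_mult)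
    have cond: "sylow_tower_condition ?N"
      unfolding sylow_tower_condition_def
    proof (intro allI impI)
      fix r assume "Factorial_Ring.prime r \<and> r dvd order ?N"
      then have r: "Factorial_Ring.prime r" "r dvd card N" by (auto simp: order_def)
      have rp: "r \<noteq> p" using r npN by blast
      obtain R where R: "subgroup R G" "card R = r ^ multiplicity r (order G)" "nilpotent_in G R"
        "cyclic_in G R \<or>
          (\<forall>M. maximal_in G M R \<longrightarrow> (\<exists>S. subgroup S G \<and> M \<subseteq> S \<and> order G = r * card S))"
        using less.prems(3) r(1) dvdN[OF r(2)] unfolding sylow_tower_condition_def by blast
      \<comment> \<open>Elements of order prime to \<open>p\<close> generate the residual, so
        \<open>R\<close> survives intact in \<open>N\<close>.\<close>
      have "\<not> p dvd card R"
        using R(2) p(1) r(1) rp prime_dvd_power primes_dvd_imp_eq by metis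
      then have RN: "R \<subseteq> N"
        using p_residual_mem[of _ p "card R"] pow_card_subgroup_eq_one[OF R(1)]
          subgroup.mem_carrier[OF R(1)] unfolding N_def by auto
      have "\<exists>S. subgroup S ?N \<and> M \<subseteq> S \<and> order ?N = r * card S"
        if S: "subgroup S G" "M \<subseteq> S" "order G = r * card S" and M: "maximal_in G M R" for M S
        using prime_index_inter_normal[OF fin r(1) S(1,3) N(1) multr[OF r(1) rp]]
          S(2) maximal_inD(2)[OF M] RN subgroups_Inter_pair[OF N(2) S(1)] subgroup_restrict_iff[OF N(2)]
        by (intro exI[of _ "N \<inter> S"]) (auto simp: order_def)
      then have "cyclic_in ?N R \<or>
          (\<forall>M. maximal_in ?N M R \<longrightarrow> (\<exists>S. subgroup S ?N \<and> M \<subseteq> S \<and> order ?N = r * card S))"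
        using R(4) cyclic_in_restrict[OF N(2) _ RN] maximal_in_restrict[OF N(2) RN] by metis
      moreover have "subgroup R ?N" using subgroup_restrict_iff[OF N(2)] R(1) RN by blast
      moreover have "card R = r ^ multiplicity r (order ?N)"
        using R(2) multr[OF r(1) rp] by (simp add: order_def)
      ultimately show "\<exists>P. subgroup P ?N \<and> card P = r ^ multiplicity r (order ?N) \<and> nilpotent_in ?N P \<and>
          (cyclic_in ?N P \<or>
          (\<forall>M. maximal_in ?N M P \<longrightarrow> (\<exists>S. subgroup S ?N \<and> M \<subseteq> S \<and> order ?N = r * card S)))"
        using nilpotent_in_restrict[OF N(2) R(3) RN] by blast
    qed
    have "coprime q (p ^ multiplicity p (order G))"
      using prime_not_dvd_coprime_power[OF p(1)] p(1) q False primes_dvd_imp_eq by metis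
    then have qN: "q dvd order ?N"
      using less.prems(5) oN coprime_dvd_mult_right_iff by (metis order_def partial_object.select_convs(1) partial_object.surjective partial_object.update_convs(1))
    have "\<exists>Q. Q \<lhd> ?N \<and> card Q = q ^ multiplicity q (order ?N)"
    proof (rule less.hyps[OF lt NG.group_axioms _ cond q qN])
      show "finite (carrier ?N)" using finN by simp
      show "r \<le> q" if "Factorial_Ring.prime r" "r dvd order ?N" for r
        using less.prems(6)[OF that(1)] dvdN that(2) by (simp add: order_def)
    qed
    then obtain Q where Q: "Q \<lhd> ?N" "card Q = q ^ multiplicity q (card N)" by (auto simp: order_def)
    then show ?thesis
      using normal_sylow_of_normal[OF fin q N(1) Q] multr[OF q] False by metis
  qed
qed

section \<open>Quotients\<close>

text \<open>The part of the hypotheses that passes to quotients by normal subgroups inside \<open>E\<close> and suffices for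
  the induction; \<open>H\<close> and \<open>S\<close> stand for a Hall subgroup \<open>H\<^sub>i\<close> and a sylowizer.\<close>

definition sylowizer_condition :: "('a, 'b) monoid_scheme \<Rightarrow> 'a set \<Rightarrow> bool"
  where "sylowizer_condition G E \<longleftrightarrow> E \<lhd> G \<and> (\<forall>p. Factorial_Ring.prime p \<and> p dvd card E \<longrightarrow>
    (\<exists>P. subgroup P G \<and> P \<subseteq> E \<and> card P = p ^ multiplicity p (card E) \<and> nilpotent_in G P \<and>
      (cyclic_in G P \<or> (\<exists>H. nilpotent_in G H \<and> P \<subseteq> H \<and>
        (\<forall>M. maximal_in G M P \<longrightarrow>
          (\<exists>S. subgroup S G \<and> M \<subseteq> S \<and> S <#>\<^bsub>G\<^esub> H = carrier G \<and> card E = p * card (E \<inter> S)))))))"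

lemma (in group_hom) nilpotent_in_image:
  assumes "nilpotent_in G U"
  shows "nilpotent_in H (h ` U)"
proof -
  obtain W n where "central_series G W n U" using G.nilpotent_in_series[OF assms] by blast
  note W = G.central_seriesD[OF this]
  have U: "subgroup U G" using assms G.nilpotent_in_imp_subgroup by blast
  have comm: "commutator H (h x) (h y) = h (commutator G x y)" if "x \<in> carrier G" "y \<in> carrier G" for x y
    unfolding commutator_def using that by simp
  have "commutator H (h x) (h g) \<in> h ` W i" if i: "i < n" and x: "x \<in> W (Suc i)" and g: "g \<in> U" for i x g
  proof -
    have "x \<in> U" using W(4)[of "Suc i"] i x by auto
    then show ?thesis using W(6)[OF i x g] comm subgroup.mem_carrier[OF U] g by auto
  qed
  moreover have "h ` {\<one>} = {\<one>\<^bsub>H\<^esub>}" by simp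
  moreover have "h ` W i \<subseteq> h ` W (Suc i)" if "i < n" for i using W(5)[OF that] by blast
  ultimately show ?thesis
    unfolding nilpotent_in_def using W(1,2,3) subgroup_img_is_subgroup U
    by (intro conjI exI[of _ n] exI[of _ "\<lambda>i. h ` W i"]) auto
qed

lemma (in group_hom) cyclic_in_image:
  assumes "cyclic_in G U"
  shows "cyclic_in H (h ` U)"
proof -
  obtain x where x: "subgroup U G" "x \<in> U" "\<And>y. y \<in> U \<Longrightarrow> \<exists>k::nat. y = x [^] k"
    using assms unfolding cyclic_in_def by blast
  have "\<exists>k::nat. h y = h x [^]\<^bsub>H\<^esub> k" if "y \<in> U" for y
    using x(3)[OF that] hom_nat_pow subgroup.mem_carrier[OF x(1,2)] by metis
  then show ?thesis unfolding cyclic_in_def using x subgroup_img_is_subgroup by blast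
qed

lemma (in group_hom) card_subgroup_image_inter:
  assumes P: "subgroup P G" and fin: "finite (carrier G)"
  shows "card P = card (P \<inter> kernel G H h) * card (h ` P)"
proof -
  interpret PG: group "G\<lparr>carrier := P\<rparr>" using G.subgroup_imp_group[OF P] .
  have "h \<in> hom (G\<lparr>carrier := P\<rparr>) H" using subgroup.mem_carrier[OF P] by (auto intro!: homI)
  then interpret P: group_hom "G\<lparr>carrier := P\<rparr>" H h by unfold_locales
  have "kernel (G\<lparr>carrier := P\<rparr>) H h = P \<inter> kernel G H h"
    using subgroup.subset[OF P] by (auto simp: kernel_def)
  then show ?thesis
    using P.card_subgroup_image[OF PG.subgroup_self] G.finite_subgroup_pos[OF fin P]
    by (simp add: kernel_def)
qed

text \<open>\<open>P\<close> may miss part of the kernel, so the preimage is taken inside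
  \<open>P\<close>. It contains the intersection of \<open>P\<close> with the kernel, so a subgroup
  above it with the same image as \<open>P\<close> is \<open>P\<close> itself.\<close>

lemma (in group_hom) maximal_in_vimage:
  assumes P: "subgroup P G" and M: "maximal_in H M (h ` P)"
  shows "maximal_in G {x \<in> P. h x \<in> M} P" and "h ` {x \<in> P. h x \<in> M} = M"
proof -
  let ?M = "{x \<in> P. h x \<in> M}"
  note M' = H.maximal_inD[OF M]
  show im: "h ` ?M = M"
  proof
    show "M \<subseteq> h ` ?M" using M'(2) by blast
  qed blast
  have "?M = P \<inter> {x \<in> carrier G. h x \<in> M}" using subgroup.subset[OF P] by auto
  then have sM: "subgroup ?M G"
    using G.subgroups_Inter_pair[OF P subgroup_vimage[OF M'(1)]] by simp
  show "maximal_in G ?M P"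
    unfolding maximal_in_def
  proof (intro conjI allI impI)
    show "?M \<noteq> P" using im M'(3) by metis
    fix K assume K: "subgroup K G \<and> ?M \<subseteq> K \<and> K \<subseteq> P"
    then have "subgroup (h ` K) H" "M \<subseteq> h ` K" "h ` K \<subseteq> h ` P"
      using subgroup_img_is_subgroup im by blast+
    then consider "h ` K = M" | "h ` K = h ` P" using M'(4) by blast
    then show "K = ?M \<or> K = P"
    proof cases
      case 1
      then have "K \<subseteq> ?M" using K by blast
      then show ?thesis using K by blast
    next
      case 2
      have "P \<subseteq> K"
      proof
        fix x assume x: "x \<in> P"
        then obtain k where k: "k \<in> K" "h x = h k" using 2 by blast
        have c: "x \<in> carrier G" "k \<in> carrier G" using x k K subgroup.mem_carrier[OF P] by auto
        have "h (x \<otimes> inv k) = \<one>\<^bsub>H\<^esub>" using c k by simp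
        moreover have "x \<otimes> inv k \<in> P"
          using x k K P by (meson subgroup.m_closed subgroup.m_inv_closed subsetD)
        ultimately have "x \<otimes> inv k \<in> K" using K subgroup.one_closed[OF M'(1)] by auto
        then have "x \<otimes> inv k \<otimes> k \<in> K" using K k subgroup.m_closed by metis
        then show "x \<in> K" using c by (simp add: G.m_assoc)
      qed
      then show ?thesis using K by blast
    qed
  qed (use sM in auto)
qed

text \<open>The exponents of \<open>p\<close> for the image of \<open>P\<close> and for its part in
  the kernel add up to the exponent for \<open>E\<close>. Each is bounded by its own Sylow exponent,
  and these also add up to it, so both bounds are attained.\<close>

lemma (in group_hom) sylow_image:
  assumes fin: "finite (carrier G)" and p: "Factorial_Ring.prime p"
    and E: "subgroup E G" "kernel G H h \<subseteq> E"
    and P: "subgroup P G" "P \<subseteq> E" "card P = p ^ multiplicity p (card E)"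
  shows "card (h ` P) = p ^ multiplicity p (card (h ` E))"
    and "card (P \<inter> kernel G H h) = p ^ multiplicity p (card (kernel G H h))"
proof -
  let ?K = "kernel G H h"
  have K: "subgroup ?K G" using subgroup_kernel .
  have PK: "subgroup (P \<inter> ?K) G" using G.subgroups_Inter_pair P(1) K by blast
  have cE: "card E = card ?K * card (h ` E)" using card_subgroup_image[OF E fin] .
  have cP: "card P = card (P \<inter> ?K) * card (h ` P)" using card_subgroup_image_inter[OF P(1) fin] .
  have pos: "card E > 0" "card ?K > 0" "card P > 0"
    using G.finite_subgroup_pos(1)[OF fin] E(1) K P(1) by blast+
  then have posh: "card (h ` E) > 0" using cE by (metis gr0I mult_0_right)
  have me: "multiplicity p (card E) = multiplicity p (card ?K) + multiplicity p (card (h ` E))"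
    using cE prime_elem_multiplicity_mult_distrib[of p "card ?K" "card (h ` E)"] p pos posh by simp
  obtain i where i: "card (P \<inter> ?K) = p ^ i"
    using cP P(3) divides_primepow_nat[OF p] by (metis dvd_triv_left)
  obtain j where j: "card (h ` P) = p ^ j"
    using cP P(3) divides_primepow_nat[OF p] by (metis dvd_triv_right)
  have "p ^ (i + j) = p ^ multiplicity p (card E)" using cP P(3) i j by (simp add: power_add)
  then have ij: "i + j = multiplicity p (card E)" using prime_gt_1_nat[OF p] by (metis power_inject_exp)
  have "p ^ i dvd card ?K" using G.card_subgroup_dvd[OF PK K] i by simp
  then have "i \<le> multiplicity p (card ?K)" using pos p not_prime_unit by (intro multiplicity_geI) auto
  moreover have "card (h ` P) dvd card (h ` E)"
    using H.card_subgroup_dvd[OF subgroup_img_is_subgroup[OF P(1)] subgroup_img_is_subgroup[OF E(1)]] P(2) by blast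
  then have "j \<le> multiplicity p (card (h ` E))" using j posh p not_prime_unit by (intro multiplicity_geI) auto
  ultimately have "i = multiplicity p (card ?K)" "j = multiplicity p (card (h ` E))"
    using ij me by linarith+
  then show "card (h ` P) = p ^ multiplicity p (card (h ` E))"
    and "card (P \<inter> ?K) = p ^ multiplicity p (card ?K)" using i j by auto
qed

text \<open>The delicate point is that \<open>S\<close> contains the kernel. Otherwise the kernel
  would have a subgroup of index \<open>p\<close> inside \<open>S\<close>, yet \<open>S\<close>
  contains the part of \<open>P\<close> in the kernel, a full Sylow \<open>p\<close>-subgroup of it.
  Consequently intersecting with \<open>E\<close> commutes with taking images, and the index
  \<open>p\<close> is preserved.\<close>

lemma (in group_hom) sylowizer_condition_image:
  assumes fin: "finite (carrier G)" and surj: "h ` carrier G = carrier H"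
    and cond: "sylowizer_condition G E" and ker: "kernel G H h \<subseteq> E"
  shows "sylowizer_condition H (h ` E)"
proof -
  let ?K = "kernel G H h"
  have K: "?K \<lhd> G" "subgroup ?K G" using normal_kernel subgroup_kernel by auto
  have E: "E \<lhd> G" "subgroup E G" using cond normal_imp_subgroup unfolding sylowizer_condition_def by blast+
  have cE: "card E = card ?K * card (h ` E)" using card_subgroup_image[OF E(2) ker fin] .
  have pos: "card E > 0" "card ?K > 0" using G.finite_subgroup_pos[OF fin] E K by auto
  have "h ` E \<lhd> H" using normal.surj_hom_normal_subgroup[OF E(1) group_hom_axioms surj] .
  moreover have "\<exists>P. subgroup P H \<and> P \<subseteq> h ` E \<and> card P = p ^ multiplicity p (card (h ` E)) \<and> nilpotent_in H P \<and>
      (cyclic_in H P \<or> (\<exists>U. nilpotent_in H U \<and> P \<subseteq> U \<and>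
        (\<forall>M. maximal_in H M P \<longrightarrow> (\<exists>S. subgroup S H \<and> M \<subseteq> S \<and> S <#>\<^bsub>H\<^esub> U = carrier H \<and>
          card (h ` E) = p * card (h ` E \<inter> S)))))"
    if p: "Factorial_Ring.prime p" "p dvd card (h ` E)" for p
  proof -
    have "p dvd card E" using p(2) cE by simp
    then obtain P where P: "subgroup P G" "P \<subseteq> E" "card P = p ^ multiplicity p (card E)" "nilpotent_in G P"
      and cm: "cyclic_in G P \<or> (\<exists>U. nilpotent_in G U \<and> P \<subseteq> U \<and>
        (\<forall>M. maximal_in G M P \<longrightarrow> (\<exists>S. subgroup S G \<and> M \<subseteq> S \<and> S <#> U = carrier G \<and>
          card E = p * card (E \<inter> S))))"
      using cond p(1) unfolding sylowizer_condition_def by blast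
    note syl = sylow_image[OF fin p(1) E(2) ker P(1-3)]
    have "cyclic_in H (h ` P) \<or> (\<exists>U. nilpotent_in H U \<and> h ` P \<subseteq> U \<and>
        (\<forall>M. maximal_in H M (h ` P) \<longrightarrow> (\<exists>S. subgroup S H \<and> M \<subseteq> S \<and> S <#>\<^bsub>H\<^esub> U = carrier H \<and>
          card (h ` E) = p * card (h ` E \<inter> S))))"
      using cm
    proof (elim disjE exE conjE)
      assume "cyclic_in G P" then show ?thesis using cyclic_in_image by blast
    next
      fix U assume U: "nilpotent_in G U" "P \<subseteq> U"
        and max: "\<forall>M. maximal_in G M P \<longrightarrow> (\<exists>S. subgroup S G \<and> M \<subseteq> S \<and> S <#> U = carrier G \<and>
          card E = p * card (E \<inter> S))"
      have "\<exists>S. subgroup S H \<and> M \<subseteq> S \<and> S <#>\<^bsub>H\<^esub> (h ` U) = carrier H \<and>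
          card (h ` E) = p * card (h ` E \<inter> S)" if M: "maximal_in H M (h ` P)" for M
      proof -
        let ?M = "{x \<in> P. h x \<in> M}"
        obtain S where S: "subgroup S G" "?M \<subseteq> S" "S <#> U = carrier G" "card E = p * card (E \<inter> S)"
          using max maximal_in_vimage(1)[OF P(1) M] by blast
        let ?T = "E \<inter> S"
        have T: "subgroup ?T G" using G.subgroups_Inter_pair E(2) S(1) by blast
        have "P \<inter> ?K \<subseteq> ?M" using subgroup.one_closed[OF H.maximal_inD(1)[OF M]] by (auto simp: kernel_def)
        then have PKT: "P \<inter> ?K \<subseteq> ?T \<inter> ?K" using S(2) ker by blast
        have KT: "?K \<subseteq> ?T"
        proof -
          have TK: "subgroup (?T <#> ?K) G"
            using G.subgroup_mult_normal[OF T K(1)] .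
          have TKE: "?T <#> ?K \<subseteq> E" using ker subgroup.m_closed[OF E(2)] unfolding set_mult_def by blast
          note sub = G.subset_set_mult_subgroup[OF T K(2)]
          obtain c where c: "card (?T <#> ?K) = card ?T * c" using G.card_subgroup_dvd[OF T TK sub(1)] by blast
          have posT: "card ?T > 0" using G.finite_subgroup_pos[OF fin T] by blast
          have "card ?T * c dvd card ?T * p"
            using G.card_subgroup_dvd[OF TK E(2) TKE] c S(4) by (simp add: mult.commute)
          then have "c dvd p" using posT by simp
          moreover have "c \<noteq> p"
          proof
            assume "c = p"
            then have "card ?T * p * card (?T \<inter> ?K) = card ?T * card ?K"
              using G.card_set_mult[OF T K(2) fin] c by simp
            then have "card ?K = p * card (?T \<inter> ?K)" using posT by simp
            moreover have TK': "subgroup (?T \<inter> ?K) G" using G.subgroups_Inter_pair T K(2) by blast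
            have "card (P \<inter> ?K) dvd card (?T \<inter> ?K)"
              using G.card_subgroup_dvd[OF G.subgroups_Inter_pair[OF P(1) K(2)] TK' PKT] .
            ultimately have "p ^ Suc (multiplicity p (card ?K)) dvd card ?K"
              using syl(2) by (metis mult_dvd_mono dvd_refl power_Suc)
            then show False using not_dvd_Suc_multiplicity[OF p(1) pos(2)] by blast
          qed
          ultimately have "c = 1" using p(1) by (metis One_nat_def prime_nat_iff)
          then have "?T = ?T <#> ?K"
            using c sub(1) G.finite_subgroup_pos[OF fin TK] by (intro card_subset_eq) auto
          then show ?thesis using sub(2) by simp
        qed
        have "h ` E \<inter> h ` S = h ` ?T"
        proof
          show "h ` E \<inter> h ` S \<subseteq> h ` ?T"
          proof
            fix y assume "y \<in> h ` E \<inter> h ` S"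
            then obtain e s where es: "e \<in> E" "s \<in> S" "y = h e" "h e = h s" by auto
            have c: "e \<in> carrier G" "s \<in> carrier G"
              using es subgroup.mem_carrier[OF E(2)] subgroup.mem_carrier[OF S(1)] by auto
            have "e \<otimes> inv s \<in> ?K" using es(4) c by (simp add: kernel_def)
            then have "e \<otimes> inv s \<otimes> s \<in> S" using KT es(2) subgroup.m_closed[OF S(1)] by blast
            then have "e \<in> S" using c by (simp add: G.m_assoc)
            then show "y \<in> h ` ?T" using es by blast
          qed
        qed blast
        then have "card ?T = card ?K * card (h ` E \<inter> h ` S)" using card_subgroup_image[OF T KT fin] by simp
        then have "card ?K * card (h ` E) = card ?K * (p * card (h ` E \<inter> h ` S))"
          using trans[OF cE[symmetric] S(4)] by (simp only: mult.left_commute)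
        then have "card (h ` E) = p * card (h ` E \<inter> h ` S)" using pos(2) by auto
        moreover have "M \<subseteq> h ` S" using maximal_in_vimage(2)[OF P(1) M] S(2) by blast
        moreover have "h ` S <#>\<^bsub>H\<^esub> h ` U = carrier H"
          using set_mult_hom[OF homh, of S U] S(1,3) U(1) surj subgroup.subset G.nilpotent_in_imp_subgroup by metis
        ultimately show ?thesis using subgroup_img_is_subgroup[OF S(1)] by blast
      qed
      then show ?thesis using nilpotent_in_image[OF U(1)] U(2) by blast
    qed
    then show ?thesis
      using subgroup_img_is_subgroup[OF P(1)] P(2) syl(1) nilpotent_in_image[OF P(4)] by blast
  qed
  ultimately show ?thesis unfolding sylowizer_condition_def by blast
qed

section \<open>Saturated formations\<close>

lemma in_class_iso:
  assumes "in_class F G" "G \<cong> H" "group G"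
  shows "in_class F H"
  using assms group.iso_sym iso_trans unfolding in_class_def by blast

text \<open>Closure under quotients speaks of members over the naturals, so the epimorphism is first
  composed with an isomorphism from such a representative.\<close>

lemma in_class_epi:
  assumes F: "formation F" and G: "in_class F G" "group G" and H: "group H"
    and h: "h \<in> hom G H" "h ` carrier G = carrier H"
  shows "in_class F H"
proof -
  obtain K where K: "K \<in> F" "G \<cong> K" using G(1) unfolding in_class_def by blast
  have gK: "group K" using F K(1) unfolding formation_def group_class_def by blast
  obtain g where g: "g \<in> iso K G" using group.iso_sym[OF G(2) K(2)] unfolding is_iso_def by blast
  have hg: "h \<circ> g \<in> hom K H" using hom_compose[OF _ h(1)] g unfolding iso_def by blast
  interpret c: group_hom K H "h \<circ> g" using gK H hg by (simp add: group_hom_def group_hom_axioms_def)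
  have "g ` carrier K = carrier G" using g unfolding iso_def bij_betw_def by blast
  then have "(h \<circ> g) ` carrier K = carrier H" using h(2) by (metis image_comp)
  then have iso: "K Mod kernel K H (h \<circ> g) \<cong> H" using c.FactGroup_iso by blast
  have "in_class F (K Mod kernel K H (h \<circ> g))"
    using F K(1) c.normal_kernel unfolding formation_def by blast
  then show ?thesis
    using in_class_iso[OF _ iso] normal.factorgroup_is_group[OF c.normal_kernel] by blast
qed

lemma in_class_Mod_mono:
  assumes F: "formation F" and N: "N \<lhd> G" "N' \<lhd> G" "N \<subseteq> N'" and c: "in_class F (G Mod N)"
  shows "in_class F (G Mod N')"
proof -
  interpret N: normal N G by fact
  interpret N': normal N' G by fact
  have h: "(\<lambda>x. N' #>\<^bsub>G\<^esub> x) \<in> hom G (G Mod N')" using N'.r_coset_hom_Mod .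
  have "N' #>\<^bsub>G\<^esub> x = N' #>\<^bsub>G\<^esub> y"
    if xy: "x \<in> carrier G" "y \<in> carrier G" "N #>\<^bsub>G\<^esub> x = N #>\<^bsub>G\<^esub> y" for x y
  proof -
    have "x \<in> N #>\<^bsub>G\<^esub> y" using N.rcos_self[OF xy(1) N.subgroup_axioms] xy(3) by simp
    then have "x \<in> N' #>\<^bsub>G\<^esub> y" using N(3) unfolding r_coset_def by blast
    then show ?thesis using N.repr_independence[OF _ xy(2) N'.subgroup_axioms] by simp
  qed
  then obtain g where g: "g \<in> hom (G Mod N) (G Mod N')" "\<And>x. x \<in> carrier G \<Longrightarrow> g (N #>\<^bsub>G\<^esub> x) = N' #>\<^bsub>G\<^esub> x"
    using FactGroup_universal[OF h N(1)] by blast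
  have "g ` carrier (G Mod N) = carrier (G Mod N')"
    unfolding carrier_FactGroup using g(2) by (auto simp: image_image)
  then show ?thesis
    using in_class_epi[OF F c N.factorgroup_is_group N'.factorgroup_is_group g(1)] by blast
qed

lemma (in group) iso_Mod_triv: "G Mod {\<one>} \<cong> G"
  using trivial_factor_iso unfolding is_iso_def by blast

lemma (in group) maximal_subgroup_iff: "maximal_subgroup M G \<longleftrightarrow> maximal_in G M (carrier G)"
  using maximal_in_iff[OF subgroup_self, of M] by simp

lemma (in group) conj_group_hom:
  assumes "g \<in> carrier G"
  shows "group_hom G G (\<lambda>x. g \<otimes> x \<otimes> inv g)" "(\<lambda>x. g \<otimes> x \<otimes> inv g) ` carrier G = carrier G"
proof -
  have "(\<lambda>x. g \<otimes> x \<otimes> inv g) \<in> hom G G"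
    using assms by (intro homI) (simp_all add: m_assoc)
  then show "group_hom G G (\<lambda>x. g \<otimes> x \<otimes> inv g)" by unfold_locales
  show "(\<lambda>x. g \<otimes> x \<otimes> inv g) ` carrier G = carrier G"
  proof
    show "carrier G \<subseteq> (\<lambda>x. g \<otimes> x \<otimes> inv g) ` carrier G"
    proof
      fix y assume "y \<in> carrier G"
      then have "y = g \<otimes> (inv g \<otimes> y \<otimes> g) \<otimes> inv g" "inv g \<otimes> y \<otimes> g \<in> carrier G"
        using assms by (simp_all add: m_assoc)
      then show "y \<in> (\<lambda>x. g \<otimes> x \<otimes> inv g) ` carrier G" by blast
    qed
  qed (use assms in auto)
qed

text \<open>Conjugation by \<open>g\<close> pulls maximal subgroups back to maximal
  subgroups.\<close>

lemma (in group) frattini_normal: "frattini G \<lhd> G"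
proof -
  have "subgroup (carrier G \<inter> \<Inter>{M. maximal_subgroup M G}) G"
  proof (cases "{M. maximal_subgroup M G} = {}")
    case True then show ?thesis using subgroup_self by simp
  next
    case False
    then have "subgroup (\<Inter>{M. maximal_subgroup M G}) G"
      by (intro subgroups_Inter) (auto simp: maximal_subgroup_def)
    then show ?thesis using subgroups_Inter_pair[OF subgroup_self] by blast
  qed
  then have "subgroup (frattini G) G" unfolding frattini_def .
  moreover have "g \<otimes> x \<otimes> inv g \<in> frattini G" if x: "x \<in> frattini G" and g: "g \<in> carrier G" for x g
  proof -
    interpret c: group_hom G G "\<lambda>x. g \<otimes> x \<otimes> inv g" using conj_group_hom(1)[OF g] .
    have xc: "x \<in> carrier G" using x unfolding frattini_def by blast
    have "g \<otimes> x \<otimes> inv g \<in> M" if "maximal_subgroup M G" for M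
    proof -
      have "maximal_in G M ((\<lambda>x. g \<otimes> x \<otimes> inv g) ` carrier G)"
        using that maximal_subgroup_iff conj_group_hom(2)[OF g] by simp
      then have "maximal_subgroup {x \<in> carrier G. g \<otimes> x \<otimes> inv g \<in> M} G"
        using c.maximal_in_vimage(1)[OF subgroup_self] maximal_subgroup_iff by blast
      then show ?thesis using x unfolding frattini_def by blast
    qed
    then show ?thesis using xc g unfolding frattini_def by auto
  qed
  ultimately show ?thesis by (intro normal_invI) auto
qed

section \<open>Action on a normal subgroup of prime order\<close>

lemma prime_residue_eq_primroot_power:
  assumes p: "Factorial_Ring.prime (p::nat)" and r: "residue_primroot p r" and s: "\<not> p dvd s"
  obtains i where "[s = r ^ i] (mod p)"
proof -
  have p1: "p > 1" using prime_gt_1_nat[OF p] .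
  have "s mod p \<in> totatives p"
  proof -
    have "s mod p > 0" using s by (simp add: dvd_eq_mod_eq_0)
    moreover have "coprime (s mod p) p" using s p prime_imp_coprime by (simp add: coprime_commute)
    moreover have "s mod p \<le> p" using p1 by (simp add: less_imp_le)
    ultimately show ?thesis by (simp add: totatives_def)
  qed
  then obtain i where "s mod p = r ^ i mod p"
    using residue_primroot_is_generator[OF p1 r] by (auto simp: bij_betw_def)
  then show thesis using that unfolding cong_def by blast
qed

text \<open>The automorphism group of a group of prime order is cyclic: the action of \<open>g\<close> on
  \<open>N = \<langle>a\<rangle>\<close> raises \<open>a\<close> to a power of a fixed primitive root, and \<open>x\<close> is chosen with the least
  positive exponent.\<close>

lemma (in group) centralizer_prime_order_quotient_cyclic:
  assumes fin: "finite (carrier G)" and N: "N \<lhd> G" and p: "Factorial_Ring.prime (card N)"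
  obtains x where "x \<in> carrier G" "\<And>g. g \<in> carrier G \<Longrightarrow>
    \<exists>k::nat. \<exists>z\<in>carrier G. g = z \<otimes> x [^] k \<and> (\<forall>n\<in>N. z \<otimes> n = n \<otimes> z)"
proof -
  define p' where "p' = card N"
  have pp: "Factorial_Ring.prime p'" using p p'_def by simp
  have sN: "subgroup N G" using N normal_imp_subgroup by blast
  have "N \<noteq> {\<one>}" using p by (metis card_1_singleton_iff not_prime_1 One_nat_def)
  then obtain a where a: "a \<in> N" "a \<noteq> \<one>" using subgroup.one_closed[OF sN] by blast
  have ac: "a \<in> carrier G" using subgroup.mem_carrier[OF sN a(1)] .
  note oa = prime_order_cyclic_in(1)[OF sN p a] and gen = prime_order_cyclic_in(2)[OF sN p a]
  have cong: "a [^] i = a [^] j \<longleftrightarrow> [i = j] (mod p')" for i j :: nat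
    using pow_eq_iff_cong[OF ac] oa p'_def by simp
  obtain r where r: "residue_primroot p' r" using prime_primitive_root_exists[OF prime_gt_1_nat[OF pp] pp] by blast
  have cr: "coprime r p'" using r unfolding residue_primroot_def by (simp add: coprime_commute)
  have ex: "\<exists>i. g \<otimes> a \<otimes> inv g = a [^] (r ^ i)" if g: "g \<in> carrier G" for g
  proof -
    have "g \<otimes> a \<otimes> inv g \<in> N" using normal.inv_op_closed2[OF N g a(1)] .
    then obtain s :: nat where s: "g \<otimes> a \<otimes> inv g = a [^] s" using gen by blast
    have "\<not> p' dvd s"
    proof
      assume "p' dvd s"
      then have "g \<otimes> a \<otimes> inv g = \<one>" using s pow_eq_id[OF ac] oa p'_def by simp
      then have "inv g \<otimes> (g \<otimes> a \<otimes> inv g) \<otimes> g = \<one>" using g by simp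
      then show False using a g ac by (simp add: m_assoc)
    qed
    then obtain i where "[s = r ^ i] (mod p')" using prime_residue_eq_primroot_power[OF pp r] by blast
    then show ?thesis using s cong by metis
  qed
  define S where "S = {i. i > 0 \<and> (\<exists>g\<in>carrier G. g \<otimes> a \<otimes> inv g = a [^] (r ^ i))}"
  \<comment> \<open>By Fermat the identity element realizes the positive exponent
    \<open>p' - 1\<close>, so a least positive exponent \<open>d\<close> exists.\<close>
  have "[r ^ (p' - 1) = 1] (mod p')" using fermat_theorem[OF pp] cr pp
    by (metis coprime_absorb_right dvd_refl not_prime_unit)
  then have "p' - 1 \<in> S"
    unfolding S_def using cong[of "r ^ (p' - 1)" 1] prime_gt_1_nat[OF pp] ac by (auto intro!: bexI[of _ \<one>])
  define d where "d = (LEAST i. i \<in> S)"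
  have d: "d \<in> S" unfolding d_def using \<open>p' - 1 \<in> S\<close> by (rule LeastI)
  have least: "i \<notin> S" if "i < d" for i using not_less_Least that unfolding d_def by blast
  obtain x where x: "x \<in> carrier G" "x \<otimes> a \<otimes> inv x = a [^] (r ^ d)" using d unfolding S_def by blast
  have xk: "x [^] k \<otimes> a \<otimes> inv (x [^] k) = a [^] (r ^ (d * k))" for k :: nat
  proof (induction k)
    case (Suc k)
    have "x [^] Suc k \<otimes> a \<otimes> inv (x [^] Suc k) = x \<otimes> (x [^] k \<otimes> a \<otimes> inv (x [^] k)) \<otimes> inv x"
      unfolding nat_pow_Suc2[OF x(1)] using x ac by (simp add: inv_mult_group m_assoc)
    also have "\<dots> = (a [^] (r ^ d)) [^] (r ^ (d * k))"
      unfolding Suc conj_pow[OF x(1) ac, symmetric] x(2) ..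
    also have "\<dots> = a [^] (r ^ (d * Suc k))" using ac by (simp add: nat_pow_pow power_add)
    finally show ?case .
  qed (use ac in simp)
  show thesis
  proof (rule that[OF x(1)])
    fix g assume g: "g \<in> carrier G"
    obtain i where i: "g \<otimes> a \<otimes> inv g = a [^] (r ^ i)" using ex[OF g] by blast
    \<comment> \<open>Division with remainder: \<open>z\<close> acts on \<open>a\<close> with
      exponent \<open>i mod d\<close>, which minimality of \<open>d\<close> forces to be 0, so
      \<open>z\<close> centralizes \<open>N\<close>.\<close>
    define k where "k = i div d"
    define z where "z = g \<otimes> inv (x [^] k)"
    have zc: "z \<in> carrier G" unfolding z_def using g x by simp
    have gz: "g = z \<otimes> x [^] k" unfolding z_def using g x by (simp add: m_assoc)
    obtain j :: nat where j: "z \<otimes> a \<otimes> inv z = a [^] j"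
      using gen normal.inv_op_closed2[OF N zc a(1)] by blast
    have "g \<otimes> a \<otimes> inv g = z \<otimes> (x [^] k \<otimes> a \<otimes> inv (x [^] k)) \<otimes> inv z"
      unfolding gz using zc x ac by (simp add: inv_mult_group m_assoc)
    also have "\<dots> = a [^] (j * r ^ (d * k))"
      unfolding xk conj_pow[OF zc ac, symmetric] j using ac by (simp add: nat_pow_pow)
    finally have "[r ^ i = j * r ^ (d * k)] (mod p')" using i cong by metis
    moreover have "i = i mod d + d * k" unfolding k_def by simp
    ultimately have "[r ^ (i mod d) * r ^ (d * k) = j * r ^ (d * k)] (mod p')"
      by (metis power_add)
    then have jr: "[r ^ (i mod d) = j] (mod p')"
      using cong_mult_rcancel_nat[of "r ^ (d * k)" p'] cr by simp
    then have zj: "z \<otimes> a \<otimes> inv z = a [^] (r ^ (i mod d))" using j cong by metis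
    have "i mod d < d" using d unfolding S_def by simp
    moreover have "i mod d \<in> S" if "i mod d \<noteq> 0"
      using that zj zc unfolding S_def by (auto intro!: bexI[of _ z])
    ultimately have "i mod d = 0" using least by blast
    then have za: "z \<otimes> a \<otimes> inv z = a" using zj ac by simp
    have "z \<otimes> n = n \<otimes> z" if n: "n \<in> N" for n
    proof -
      obtain l :: nat where l: "n = a [^] l" using gen[OF n] by blast
      have "z \<otimes> n \<otimes> inv z = n" using conj_pow[OF zc ac, of l] za l by simp
      then have "z \<otimes> n \<otimes> inv z \<otimes> z = n \<otimes> z" by simp
      then show ?thesis using zc subgroup.mem_carrier[OF sN n] by (simp add: m_assoc)
    qed
    then show "\<exists>k::nat. \<exists>z\<in>carrier G. g = z \<otimes> x [^] k \<and> (\<forall>n\<in>N. z \<otimes> n = n \<otimes> z)"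
      using gz zc by blast
  qed
qed

definition centralizer :: "('a, 'b) monoid_scheme \<Rightarrow> 'a set \<Rightarrow> 'a set"
  where "centralizer G T = {x \<in> carrier G. \<forall>u\<in>T. x \<otimes>\<^bsub>G\<^esub> u = u \<otimes>\<^bsub>G\<^esub> x}"

lemma (in group) centralizer_subgroup:
  assumes T: "T \<subseteq> carrier G"
  shows "subgroup (centralizer G T) G"
proof (rule subgroupI)
  show "centralizer G T \<subseteq> carrier G" unfolding centralizer_def by blast
  have "\<one> \<in> centralizer G T" unfolding centralizer_def using T by auto
  then show "centralizer G T \<noteq> {}" by blast
next
  fix a assume a: "a \<in> centralizer G T"
  have "inv a \<otimes> n = n \<otimes> inv a" if n: "n \<in> T" for n
  proof -
    have "a \<otimes> n = n \<otimes> a" "a \<in> carrier G" "n \<in> carrier G" using a n T unfolding centralizer_def by auto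
    then show ?thesis by (metis inv_closed inv_solve_left inv_solve_right m_assoc m_closed)
  qed
  then show "inv a \<in> centralizer G T" using a unfolding centralizer_def by simp
next
  fix a b assume ab: "a \<in> centralizer G T" "b \<in> centralizer G T"
  have "a \<otimes> b \<otimes> n = n \<otimes> (a \<otimes> b)" if n: "n \<in> T" for n
  proof -
    have "a \<in> carrier G" "b \<in> carrier G" "n \<in> carrier G" "a \<otimes> n = n \<otimes> a" "b \<otimes> n = n \<otimes> b"
      using ab n T unfolding centralizer_def by auto
    then show ?thesis by (metis m_assoc)
  qed
  then show "a \<otimes> b \<in> centralizer G T" using ab unfolding centralizer_def by blast
qed

lemma (in group) centralizer_normal:
  assumes T: "T \<lhd> G"
  shows "centralizer G T \<lhd> G"
proof (rule normal_invI)
  note cT = subgroup.mem_carrier[OF normal_imp_subgroup[OF T]]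
  show "subgroup (centralizer G T) G" using centralizer_subgroup cT by blast
  fix g z assume g: "g \<in> carrier G" and z: "z \<in> centralizer G T"
  have zc: "z \<in> carrier G" using z unfolding centralizer_def by blast
  have "g \<otimes> z \<otimes> inv g \<otimes> k = k \<otimes> (g \<otimes> z \<otimes> inv g)" if k: "k \<in> T" for k
  proof -
    have "inv g \<otimes> k \<otimes> g \<in> T" using normal.inv_op_closed1[OF T g k] .
    then have zk: "z \<otimes> (inv g \<otimes> k \<otimes> g) = inv g \<otimes> k \<otimes> g \<otimes> z" using z unfolding centralizer_def by blast
    have "g \<otimes> z \<otimes> inv g \<otimes> k = g \<otimes> (z \<otimes> (inv g \<otimes> k \<otimes> g)) \<otimes> inv g"
      using g zc cT[OF k] by (simp add: m_assoc)
    also have "\<dots> = k \<otimes> (g \<otimes> z \<otimes> inv g)"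
      unfolding zk using g zc cT[OF k] by (simp add: m_assoc)
    finally show ?thesis .
  qed
  then show "g \<otimes> z \<otimes> inv g \<in> centralizer G T" using g zc unfolding centralizer_def by simp
qed

text \<open>The closure properties of the class and the induction on the order speak of groups on
  the naturals; a quotient is therefore exchanged for such a group together with an epimorphism of
  prescribed kernel.\<close>

lemma (in group) quotient_nat:
  assumes fin: "finite (carrier G)" and N: "N \<lhd> G"
  obtains K :: "nat monoid" and h where "group K" "finite (carrier K)" "group_hom G K h"
    "h ` carrier G = carrier K" "kernel G K h = N" "G Mod N \<cong> K"
proof -
  interpret N: normal N G by fact
  have fQ: "finite (carrier (G Mod N))" unfolding carrier_FactGroup using fin by simp
  obtain K :: "nat monoid" where K: "group K" "finite (carrier K)" "G Mod N \<cong> K"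
    using finite_group_iso_nat[OF N.factorgroup_is_group fQ] by blast
  obtain f where f: "f \<in> iso (G Mod N) K" using K(3) unfolding is_iso_def by blast
  let ?h = "f \<circ> (\<lambda>x. N #> x)"
  have "?h \<in> hom G K" using Group.hom_compose[OF N.r_coset_hom_Mod, of f K] f unfolding iso_def by blast
  then have h: "group_hom G K ?h" using K(1) by (simp add: group_hom_def group_hom_axioms_def)
  have bij: "inj_on f (carrier (G Mod N))" "f ` carrier (G Mod N) = carrier K"
    using f unfolding iso_def bij_betw_def by auto
  have surj: "?h ` carrier G = carrier K" using bij(2) unfolding carrier_FactGroup by (simp add: image_comp)
  have "kernel G K ?h = N"
  proof
    have one: "f N = \<one>\<^bsub>K\<^esub>"
      using group_hom.hom_one[OF h] N.subgroup_axioms coset_mult_one[OF subgroup.subset[OF N.subgroup_axioms]] by simp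
    have Nc: "N \<in> carrier (G Mod N)" using group.is_monoid[OF N.factorgroup_is_group] monoid.one_closed by fastforce
    show "kernel G K ?h \<subseteq> N"
    proof
      fix x assume "x \<in> kernel G K ?h"
      then have x: "x \<in> carrier G" "f (N #> x) = f N" using one by (auto simp: kernel_def)
      then have "N #> x = N" using inj_onD[OF bij(1) _ _ Nc] by (auto simp: carrier_FactGroup)
      then show "x \<in> N" using rcos_self[OF x(1) N.subgroup_axioms] by simp
    qed
    show "N \<subseteq> kernel G K ?h"
      using one subgroup.rcos_const[OF N.subgroup_axioms is_group] N.subset by (auto simp: kernel_def)
  qed
  then show thesis using that K h surj by blast
qed

lemma formation_inter:
  fixes G :: "nat monoid"
  assumes F: "formation F" and G: "group G" "finite (carrier G)" and N: "N1 \<lhd> G" "N2 \<lhd> G"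
    and c: "in_class F (G Mod N1)" "in_class F (G Mod N2)"
  shows "in_class F (G Mod (N1 \<inter> N2))"
  using F[unfolded formation_def, THEN conjunct2, THEN conjunct2, rule_format, of G N1 N2] G N c
  by simp

lemma supersoluble_of_cyclic_normal:
  assumes K: "group K" and T: "T \<lhd> K"
    and c1: "cyclic_group (K\<lparr>carrier := T\<rparr>)" and c2: "cyclic_group (K Mod T)"
  shows "supersoluble K"
proof -
  interpret K: group K by fact
  have sT: "subgroup T K" using T normal_imp_subgroup by blast
  interpret KT: group "K\<lparr>carrier := T\<rparr>" using K.subgroup_imp_group[OF sT] .
  \<comment> \<open>The first factor of the series is the quotient of \<open>T\<close> by the
    trivial subgroup, a structure different from \<open>T\<close>; cyclicity is carried over along
    the projection.\<close>
  have "{\<one>\<^bsub>K\<^esub>} \<lhd> (K\<lparr>carrier := T\<rparr>)" using KT.one_is_normal by simp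
  then interpret o: normal "{\<one>\<^bsub>K\<^esub>}" "K\<lparr>carrier := T\<rparr>" .
  have "(\<lambda>x. {\<one>\<^bsub>K\<^esub>} #>\<^bsub>K\<lparr>carrier := T\<rparr>\<^esub> x) \<in> epi (K\<lparr>carrier := T\<rparr>) (K\<lparr>carrier := T\<rparr> Mod {\<one>\<^bsub>K\<^esub>})"
    unfolding epi_def using o.r_coset_hom_Mod by (auto simp: FactGroup_def RCOSETS_def)
  then have c1': "cyclic_group (K\<lparr>carrier := T\<rparr> Mod {\<one>\<^bsub>K\<^esub>})"
    using KT.cyclic_group_epimorphic_image[OF _ c1 o.factorgroup_is_group] by blast
  let ?N = "\<lambda>i::nat. if i = 0 then {\<one>\<^bsub>K\<^esub>} else if i = 1 then T else carrier K"
  have "?N i \<subseteq> ?N (Suc i) \<and> cyclic_group (K\<lparr>carrier := ?N (Suc i)\<rparr> Mod ?N i)" if "i < 2" for i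
  proof (cases "i = 0")
    case True
    then show ?thesis using c1' subgroup.one_closed[OF sT] by simp
  next
    case False
    then have "i = 1" using that by simp
    then show ?thesis using c2 subgroup.subset[OF sT] by simp
  qed
  moreover have "?N i \<lhd> K" if "i \<le> 2" for i
    using K.one_is_normal T K.normal_self by simp
  ultimately show ?thesis
    unfolding supersoluble_def by (intro exI[of _ 2] exI[of _ ?N]) simp
qed

lemma (in group) cyclic_group_iff_cyclic_in:
  assumes "finite (carrier G)"
  shows "cyclic_group G \<longleftrightarrow> cyclic_in G (carrier G)"
  using cyclic_in_iff[OF subgroup_self assms] by simp

text \<open>If \<open>N\<close> is not contained in the Frattini subgroup, it has a complement \<open>M\<close>; the centralizer
  \<open>C\<close> of \<open>N\<close> in \<open>M\<close> is normal in \<open>G\<close>, meets \<open>N\<close> trivially, and \<open>G/C\<close> is supersoluble.\<close>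

lemma normal_prime_order_in_class:
  fixes G :: "nat monoid" (structure)
  assumes F: "saturated_formation F"
    and super: "\<forall>K :: nat monoid. group K \<and> finite (carrier K) \<and> supersoluble K \<longrightarrow> K \<in> F"
    and G: "group G" and fin: "finite (carrier G)"
    and N: "N \<lhd> G" and p: "Factorial_Ring.prime (card N)" and c: "in_class F (G Mod N)"
  shows "G \<in> F"
proof -
  interpret group G by fact
  have form: "formation F" and gc: "group_class F"
    using F unfolding saturated_formation_def formation_def by blast+
  have sN: "subgroup N G" using N normal_imp_subgroup by blast
  show ?thesis
  proof (cases "N \<subseteq> frattini G")
    case True
    then have "in_class F (G Mod frattini G)" using in_class_Mod_mono[OF form N frattini_normal _ c] by blast
    then show ?thesis using F G fin unfolding saturated_formation_def by blast
  next
    case False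
    then obtain M where "maximal_subgroup M G" and NM: "\<not> N \<subseteq> M"
      unfolding frattini_def using subgroup.subset[OF sN] by blast
    then have max: "maximal_in G M (carrier G)" using maximal_subgroup_iff by blast
    note M = maximal_inD[OF max]
    have MN: "M <#> N = carrier G"
    proof -
      have "subgroup (M <#> N) G"
        using subgroup_mult_normal[OF M(1) N] .
      then show ?thesis using M(4)[of "M <#> N"] subset_set_mult_subgroup[OF M(1) sN] NM subgroup.subset by blast
    qed
    have fN: "finite N" using finite_subgroup_pos[OF fin sN] by blast
    have I: "subgroup (N \<inter> M) G" using subgroups_Inter_pair sN M(1) by blast
    have "card (N \<inter> M) dvd card N" using card_subgroup_dvd[OF I sN] by blast
    moreover have "card (N \<inter> M) \<noteq> card N" using NM card_subset_eq[OF fN, of "N \<inter> M"] by blast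
    ultimately have "card (N \<inter> M) = 1" using p by (metis One_nat_def prime_nat_iff)
    then have NM1: "N \<inter> M = {\<one>}" using card_subgroup_eq_one[OF I] by blast
    define C where "C = M \<inter> centralizer G N"
    note cM = subgroup.mem_carrier[OF M(1)] and cN = subgroup.mem_carrier[OF sN]
    have CN: "centralizer G N \<lhd> G" using centralizer_normal[OF N] .
    have C: "subgroup C G"
      unfolding C_def using subgroups_Inter_pair[OF M(1) normal_imp_subgroup[OF CN]] .
    \<comment> \<open>Every element of \<open>G\<close> is a product of one from \<open>M\<close>
      and one from \<open>N\<close>. Elements of \<open>N\<close> fix \<open>C\<close> pointwise
      under conjugation, while \<open>M\<close> normalizes both itself and the centralizer of
      \<open>N\<close>.\<close>
    have Cn: "C \<lhd> G"
    proof (rule normal_invI[OF C])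
      fix g x assume g: "g \<in> carrier G" and x: "x \<in> C"
      obtain m n where mn: "m \<in> M" "n \<in> N" "g = m \<otimes> n" using g MN unfolding set_mult_def by blast
      have cc: "m \<in> carrier G" "n \<in> carrier G" "x \<in> carrier G"
        using mn x cM cN unfolding C_def by auto
      have "n \<otimes> x = x \<otimes> n" using x mn(2) unfolding C_def centralizer_def by auto
      then have "n \<otimes> x \<otimes> inv n = x" using cc by (simp add: m_assoc)
      moreover have "g \<otimes> x \<otimes> inv g = m \<otimes> (n \<otimes> x \<otimes> inv n) \<otimes> inv m"
        unfolding mn(3) using cc by (simp add: inv_mult_group m_assoc)
      ultimately have "g \<otimes> x \<otimes> inv g = m \<otimes> x \<otimes> inv m" by simp
      moreover have "m \<otimes> x \<otimes> inv m \<in> M"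
        using mn(1) x subgroup.m_closed[OF M(1)] subgroup.m_inv_closed[OF M(1)] unfolding C_def by simp
      moreover have "m \<otimes> x \<otimes> inv m \<in> centralizer G N"
        using normal.inv_op_closed2[OF CN cc(1)] x unfolding C_def by blast
      ultimately show "g \<otimes> x \<otimes> inv g \<in> C" unfolding C_def by simp
    qed
    obtain K :: "nat monoid" and h where K: "group K" "finite (carrier K)" "group_hom G K h"
      "h ` carrier G = carrier K" "kernel G K h = C" "G Mod C \<cong> K"
      using quotient_nat[OF fin Cn] by blast
    interpret K: group K by fact
    interpret h: group_hom G K h by fact
    let ?T = "h ` N"
    have T: "?T \<lhd> K" using normal.surj_hom_normal_subgroup[OF N h.group_hom_axioms K(4)] .
    have sT: "subgroup ?T K" using T normal_imp_subgroup by blast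
    obtain a where a: "a \<in> N" "a \<noteq> \<one>"
      using p subgroup.one_closed[OF sN] by (metis card_1_singleton_iff is_singletonI' is_singleton_altdef not_prime_1 empty_iff)
    have "cyclic_in G N" unfolding cyclic_in_def using sN a(1) prime_order_cyclic_in(2)[OF sN p a] by blast
    then have c1: "cyclic_group (K\<lparr>carrier := ?T\<rparr>)"
      using h.cyclic_in_image K.cyclic_in_iff[OF sT] fN by simp
    obtain x where x: "x \<in> carrier G" "\<And>g. g \<in> carrier G \<Longrightarrow>
        \<exists>k::nat. \<exists>z\<in>carrier G. g = z \<otimes> x [^] k \<and> (\<forall>n\<in>N. z \<otimes> n = n \<otimes> z)"
      using centralizer_prime_order_quotient_cyclic[OF fin N p] by blast
    interpret T: normal ?T K by fact
    interpret Q: group "K Mod ?T" using T.factorgroup_is_group .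
    interpret t: group_hom K "K Mod ?T" "\<lambda>y. ?T #>\<^bsub>K\<^esub> y" using T.r_coset_hom_Mod by unfold_locales
    \<comment> \<open>The image of \<open>x\<close> is a generator. A general \<open>g\<close> is
      \<open>z \<otimes> x [^] k\<close> with \<open>z\<close> centralizing \<open>N\<close>;
      writing \<open>z = m \<otimes> n\<close> and using that \<open>N\<close> is abelian puts
      \<open>m\<close> into \<open>C\<close>, so \<open>z\<close> maps into
      \<open>?T\<close>.\<close>
    have "cyclic_in (K Mod ?T) (carrier (K Mod ?T))"
      unfolding cyclic_in_def
    proof (intro conjI bexI[of _ "?T #>\<^bsub>K\<^esub> h x"] ballI)
      show "subgroup (carrier (K Mod ?T)) (K Mod ?T)" using Q.subgroup_self .
      show "?T #>\<^bsub>K\<^esub> h x \<in> carrier (K Mod ?T)"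
        using t.hom_closed[OF h.hom_closed[OF x(1)]] .
      fix y assume "y \<in> carrier (K Mod ?T)"
      then obtain g where g: "g \<in> carrier G" "y = ?T #>\<^bsub>K\<^esub> h g"
        unfolding carrier_FactGroup K(4)[symmetric] by blast
      obtain k :: nat and z where z: "z \<in> carrier G" "g = z \<otimes> x [^] k" "\<And>n. n \<in> N \<Longrightarrow> z \<otimes> n = n \<otimes> z"
        using x(2)[OF g(1)] by blast
      obtain m n where mn: "m \<in> M" "n \<in> N" "z = m \<otimes> n" using z(1) MN unfolding set_mult_def by blast
      have "m \<otimes> l = l \<otimes> m" if l: "l \<in> N" for l
      proof -
        have cc: "m \<in> carrier G" "n \<in> carrier G" "l \<in> carrier G" using mn l cM cN by auto
        obtain i j :: nat where ij: "n = a [^] i" "l = a [^] j"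
          using prime_order_cyclic_in(2)[OF sN p a] mn(2) l by metis
        have "n \<otimes> l = l \<otimes> n" using ij cN[OF a(1)] by (simp add: nat_pow_mult add.commute)
        then have "m \<otimes> l \<otimes> n = l \<otimes> m \<otimes> n" using z(3)[OF l] mn(3) cc by (simp add: m_assoc)
        then show ?thesis using cc by simp
      qed
      then have "m \<in> C" unfolding C_def centralizer_def using mn(1) cM by blast
      then have "h m = \<one>\<^bsub>K\<^esub>" using K(5) unfolding kernel_def by blast
      then have "h z = h n" using mn h.hom_mult[of m n] cM cN by simp
      then have "h g = h n \<otimes>\<^bsub>K\<^esub> h x [^]\<^bsub>K\<^esub> k" using z x(1) h.hom_nat_pow[OF x(1), of k] by simp
      then have "y = (?T #>\<^bsub>K\<^esub> h n) \<otimes>\<^bsub>K Mod ?T\<^esub> (?T #>\<^bsub>K\<^esub> h x [^]\<^bsub>K\<^esub> k)"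
        using g(2) t.hom_mult[of "h n" "h x [^]\<^bsub>K\<^esub> k"] cN[OF mn(2)] x(1) by simp
      also have "?T #>\<^bsub>K\<^esub> h n = \<one>\<^bsub>K Mod ?T\<^esub>" using T.rcos_const[OF K(1)] mn(2) by simp
      also have "?T #>\<^bsub>K\<^esub> h x [^]\<^bsub>K\<^esub> k = (?T #>\<^bsub>K\<^esub> h x) [^]\<^bsub>K Mod ?T\<^esub> k"
        using t.hom_nat_pow[of "h x" k] x(1) by simp
      also have "\<one>\<^bsub>K Mod ?T\<^esub> \<otimes>\<^bsub>K Mod ?T\<^esub> (?T #>\<^bsub>K\<^esub> h x) [^]\<^bsub>K Mod ?T\<^esub> k
          = (?T #>\<^bsub>K\<^esub> h x) [^]\<^bsub>K Mod ?T\<^esub> k"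
        using x(1) t.hom_closed by (intro Q.l_one Q.nat_pow_closed) auto
      finally show "\<exists>k::nat. y = (?T #>\<^bsub>K\<^esub> h x) [^]\<^bsub>K Mod ?T\<^esub> k" by blast
    qed
    moreover have "finite (carrier (K Mod ?T))" unfolding carrier_FactGroup using K(2) by simp
    ultimately have c2: "cyclic_group (K Mod ?T)" using Q.cyclic_group_iff_cyclic_in by blast
    have "K \<in> F" using super K(1,2) supersoluble_of_cyclic_normal[OF K(1) T c1 c2] by blast
    then have "in_class F (G Mod C)" using K(6) unfolding in_class_def by blast
    then have "in_class F (G Mod (N \<inter> C))"
      using formation_inter[OF form G fin N Cn c] by blast
    moreover have "N \<inter> C = {\<one>}" using NM1 subgroup.one_closed[OF C] subgroup.one_closed[OF sN] unfolding C_def by blast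
    ultimately have "in_class F G"
      using in_class_iso[OF _ iso_Mod_triv] normal.factorgroup_is_group[OF one_is_normal] by simp
    then show ?thesis using in_class_nat[OF gc G] by simp
  qed
qed

section \<open>The minimal counterexample\<close>

lemma (in group) sylowizer_condition_imp_tower:
  assumes cond: "sylowizer_condition G E"
  shows "sylow_tower_condition (G\<lparr>carrier := E\<rparr>)"
  unfolding sylow_tower_condition_def
proof (intro allI impI)
  have sE: "subgroup E G" using cond normal_imp_subgroup unfolding sylowizer_condition_def by blast
  let ?E = "G\<lparr>carrier := E\<rparr>"
  have oE: "order ?E = card E" by (simp add: order_def)
  fix p assume "Factorial_Ring.prime p \<and> p dvd order ?E"
  then have p: "Factorial_Ring.prime p" "p dvd card E" using oE by auto
  obtain P where P: "subgroup P G" "P \<subseteq> E" "card P = p ^ multiplicity p (card E)" "nilpotent_in G P"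
    and cm: "cyclic_in G P \<or> (\<exists>H. nilpotent_in G H \<and> P \<subseteq> H \<and>
        (\<forall>M. maximal_in G M P \<longrightarrow>
          (\<exists>S. subgroup S G \<and> M \<subseteq> S \<and> S <#> H = carrier G \<and> card E = p * card (E \<inter> S))))"
    using cond p unfolding sylowizer_condition_def by blast
  have "\<exists>S. subgroup S ?E \<and> M \<subseteq> S \<and> order ?E = p * card S"
    if S: "subgroup S G" "M \<subseteq> S" "card E = p * card (E \<inter> S)" and M: "maximal_in G M P" for M S
    using S maximal_inD(2)[OF M] P(2) subgroups_Inter_pair[OF sE S(1)] subgroup_restrict_iff[OF sE] oE
    by (intro exI[of _ "E \<inter> S"]) auto
  then have "cyclic_in ?E P \<or>
      (\<forall>M. maximal_in ?E M P \<longrightarrow> (\<exists>S. subgroup S ?E \<and> M \<subseteq> S \<and> order ?E = p * card S))"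
    using cm cyclic_in_restrict[OF sE _ P(2)] maximal_in_restrict[OF sE P(2)] by metis
  moreover have "subgroup P ?E" using subgroup_restrict_iff[OF sE] P by blast
  ultimately show "\<exists>P. subgroup P ?E \<and> card P = p ^ multiplicity p (order ?E) \<and> nilpotent_in ?E P \<and>
      (cyclic_in ?E P \<or>
      (\<forall>M. maximal_in ?E M P \<longrightarrow> (\<exists>S. subgroup S ?E \<and> M \<subseteq> S \<and> order ?E = p * card S)))"
    using nilpotent_in_restrict[OF sE P(4,2)] P(3) oE by auto
qed

text \<open>The tower supplies a normal Sylow \<open>q\<close>-subgroup of \<open>E\<close> for the
  largest prime \<open>q\<close>. It contains, and by order equals, the subgroup \<open>P\<close>
  from the condition, so the normal subgroup also comes with the supplements.\<close>

lemma (in group) sylowizer_condition_normal_sylow: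
  assumes fin: "finite (carrier G)" and cond: "sylowizer_condition G E" and E: "E \<noteq> {\<one>}"
  obtains q P where "Factorial_Ring.prime q" "P \<lhd> G" "P \<subseteq> E" "P \<noteq> {\<one>}" "nilpotent_in G P"
    "card P = q ^ multiplicity q (card E)"
    "cyclic_in G P \<or> (\<exists>H. nilpotent_in G H \<and> P \<subseteq> H \<and>
        (\<forall>M. maximal_in G M P \<longrightarrow>
          (\<exists>S. subgroup S G \<and> M \<subseteq> S \<and> S <#> H = carrier G \<and> card E = q * card (E \<inter> S))))"
proof -
  have nE: "E \<lhd> G" "subgroup E G" using cond normal_imp_subgroup unfolding sylowizer_condition_def by blast+
  let ?E = "G\<lparr>carrier := E\<rparr>"
  interpret EG: group ?E using subgroup_imp_group[OF nE(2)] .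
  have fE: "finite E" "card E > 0" using finite_subgroup_pos[OF fin nE(2)] by auto
  have oE: "order ?E = card E" by (simp add: order_def)
  define R where "R = {r. Factorial_Ring.prime r \<and> r dvd card E}"
  have "finite R" unfolding R_def using fE(2) by (intro finite_subset[OF _ finite_divisors_nat[OF fE(2)]]) auto
  have "card E \<noteq> 1" using E card_subgroup_eq_one[OF nE(2)] by blast
  then have "R \<noteq> {}" unfolding R_def using prime_factor_nat by auto
  define q where "q = Max R"
  have "q \<in> R" unfolding q_def using Max_in[OF \<open>finite R\<close> \<open>R \<noteq> {}\<close>] .
  then have q: "Factorial_Ring.prime q" "q dvd card E" unfolding R_def by auto
  have largest: "r \<le> q" if "Factorial_Ring.prime r" "r dvd order ?E" for r
    unfolding q_def using that oE \<open>finite R\<close> by (intro Max_ge) (auto simp: R_def)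
  obtain Q where Q: "Q \<lhd> ?E" "card Q = q ^ multiplicity q (card E)"
    using largest_prime_sylow_normal[OF EG.group_axioms _ sylowizer_condition_imp_tower[OF cond] q(1) _ largest]
      fE q(2) oE by auto
  obtain P where P: "subgroup P G" "P \<subseteq> E" "card P = q ^ multiplicity q (card E)" "nilpotent_in G P"
    and cm: "cyclic_in G P \<or> (\<exists>H. nilpotent_in G H \<and> P \<subseteq> H \<and>
        (\<forall>M. maximal_in G M P \<longrightarrow>
          (\<exists>S. subgroup S G \<and> M \<subseteq> S \<and> S <#> H = carrier G \<and> card E = q * card (E \<inter> S))))"
    using cond q unfolding sylowizer_condition_def by blast
  have "P \<subseteq> Q"
  proof
    fix x assume x: "x \<in> P"
    have "x [^]\<^bsub>?E\<^esub> (q ^ multiplicity q (card E)) = \<one>\<^bsub>?E\<^esub>"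
      using pow_card_subgroup_eq_one[OF P(1) x] P(3) nat_pow_consistent[of x _ E] by simp
    then show "x \<in> Q"
      using EG.normal_sylow_contains[OF _ q(1) Q(1)] Q(2) oE fE x P(2) by auto
  qed
  moreover have "finite Q" using Q normal_imp_subgroup subgroup.subset fE finite_subset by fastforce
  ultimately have "P = Q" using P(3) Q(2) by (intro card_subset_eq) auto
  then have "P \<lhd> G" using normal_sylow_of_normal[OF fin q(1) nE(1) Q] by simp
  moreover have "P \<noteq> {\<one>}"
  proof
    assume "P = {\<one>}"
    then have "q ^ multiplicity q (card E) = 1" using P(3) by simp
    then have "multiplicity q (card E) = 0" using prime_gt_1_nat[OF q(1)] by simp
    then show False using multiplicity_neq_zero[OF q(1) fE(2) q(2)] by simp
  qed
  ultimately show thesis using that[OF q(1) _ P(2) _ P(4,3) cm] by blast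
qed

lemma (in group) minimal_normal_exists:
  assumes fin: "finite (carrier G)" and Z: "Z \<lhd> G" "Z \<noteq> {\<one>}"
  obtains N where "N \<lhd> G" "N \<subseteq> Z" "N \<noteq> {\<one>}"
    "\<And>N'. N' \<lhd> G \<Longrightarrow> N' \<subseteq> N \<Longrightarrow> N' \<noteq> {\<one>} \<Longrightarrow> N' = N"
proof -
  let ?S = "{N. N \<lhd> G \<and> N \<subseteq> Z \<and> N \<noteq> {\<one>}}"
  have "finite Z" using finite_subgroup_pos[OF fin normal_imp_subgroup[OF Z(1)]] by blast
  then have "finite ?S" by (rule_tac finite_subset[of _ "Pow Z"]) auto
  moreover have "Z \<in> ?S" using Z by blast
  ultimately obtain N where N: "N \<in> ?S" "\<And>K. K \<in> ?S \<Longrightarrow> K \<subseteq> N \<Longrightarrow> N = K"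
    by (metis (no_types, lifting) finite_has_minimal empty_iff)
  show thesis
  proof (rule that)
    fix N' assume "N' \<lhd> G" "N' \<subseteq> N" "N' \<noteq> {\<one>}"
    then show "N' = N" using N by blast
  qed (use N in auto)
qed

text \<open>The \<open>q\<close>-th powers of a cyclic \<open>P\<close> form a proper subgroup that
  is normal in \<open>G\<close>, which minimality makes trivial.\<close>

lemma (in group) minimal_normal_cyclic_prime_order:
  assumes fin: "finite (carrier G)" and q: "Factorial_Ring.prime q" and qP: "q dvd card P"
    and P: "P \<lhd> G" and cyc: "cyclic_in G P"
    and min: "\<And>N'. N' \<lhd> G \<Longrightarrow> N' \<subseteq> P \<Longrightarrow> N' \<noteq> {\<one>} \<Longrightarrow> N' = P"
  shows "card P = q"
proof -
  have sP: "subgroup P G" using P normal_imp_subgroup by blast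
  note cP = subgroup.mem_carrier[OF sP]
  obtain u where u: "u \<in> P" and gen: "\<And>y. y \<in> P \<Longrightarrow> \<exists>k::nat. y = u [^] k"
    using cyc unfolding cyclic_in_def by blast
  note uc = cP[OF u]
  have ou: "ord u = card P" using cyclic_in_order[OF sP u gen fin] .
  have powP: "x [^] (k::nat) \<in> P" if "x \<in> P" for x k
    using subgroup_int_pow_closed[OF sP that, of "int k"] by (simp add: int_pow_int)
  let ?T = "(\<lambda>x. x [^] q) ` P"
  have TP: "?T \<subseteq> P" using powP by blast
  have "subgroup ?T G"
  proof (rule subgroupI)
    show "?T \<subseteq> carrier G" using cP by auto
    show "?T \<noteq> {}" using u by blast
  next
    fix a assume "a \<in> ?T"
    then obtain x where "x \<in> P" "a = x [^] q" by blast
    then have "inv a = inv x [^] q" "inv x \<in> P"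
      using nat_pow_inv[OF cP, of x q] subgroup.m_inv_closed[OF sP, of x] by simp_all
    then show "inv a \<in> ?T" by blast
  next
    fix a b assume "a \<in> ?T" "b \<in> ?T"
    then obtain x y where xy: "x \<in> P" "y \<in> P" "a = x [^] q" "b = y [^] q" by blast
    obtain i j :: nat where ij: "x = u [^] i" "y = u [^] j" using gen[OF xy(1)] gen[OF xy(2)] by blast
    have "x \<otimes> y = y \<otimes> x" using ij uc by (simp add: nat_pow_mult add.commute)
    then have "a \<otimes> b = (x \<otimes> y) [^] q"
      unfolding xy(3,4) using pow_mult_distrib[OF _ cP[OF xy(1)] cP[OF xy(2)], of q] by simp
    then show "a \<otimes> b \<in> ?T" using subgroup.m_closed[OF sP xy(1,2)] by blast
  qed
  moreover have "g \<otimes> a \<otimes> inv g \<in> ?T" if g: "g \<in> carrier G" and a: "a \<in> ?T" for g a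
  proof -
    obtain x where x: "x \<in> P" "a = x [^] q" using a by blast
    then have "g \<otimes> a \<otimes> inv g = (g \<otimes> x \<otimes> inv g) [^] q" using conj_pow[OF g cP] by simp
    then show ?thesis using normal.inv_op_closed2[OF P g x(1)] by blast
  qed
  ultimately have T: "?T \<lhd> G" by (rule normal_invI)
  \<comment> \<open>If the generator were itself a \<open>q\<close>-th power, some multiple of
    \<open>q\<close> would be congruent to 1 modulo \<open>card P\<close>, hence modulo
    \<open>q\<close>.\<close>
  have "?T \<noteq> P"
  proof
    assume "?T = P"
    then obtain x where x: "x \<in> P" "u = x [^] q" using u by blast
    then obtain i :: nat where "x = u [^] i" using gen by blast
    then have "u [^] (i * q) = x [^] q" using uc by (simp add: nat_pow_pow)
    then have "u [^] (i * q) = u [^] (1::nat)" using x(2)[symmetric] uc by simp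
    then have "[i * q = 1] (mod q)" using pow_eq_iff_cong[OF uc] ou qP cong_dvd_modulus_nat by metis
    then have "q dvd 1" using cong_dvd_iff by (metis dvd_triv_right)
    then show False using q not_prime_unit by blast
  qed
  then have "?T = {\<one>}" using min[OF T TP] by blast
  then have "u [^] q = \<one>" using u by blast
  then have "card P dvd q" using pow_eq_id[OF uc] ou by simp
  then show ?thesis using qP dvd_antisym by blast
qed

text \<open>Since \<open>H\<close> is nilpotent, \<open>[P, H]\<close> is proper in
  \<open>P\<close>, and any maximal subgroup \<open>M\<close> of \<open>P\<close> above it is
  normalized by \<open>H\<close>. The Sylow subgroup \<open>P\<close> of \<open>E\<close> does not
  fit into \<open>S\<close>, because \<open>E \<inter> S\<close> has index \<open>q\<close> in
  \<open>E\<close>; so \<open>P \<inter> S = M\<close>, and normality of \<open>P\<close> lets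
  \<open>S\<close> normalize \<open>M\<close>.\<close>

lemma (in group) minimal_normal_sylowizer_prime_order:
  assumes fin: "finite (carrier G)" and q: "Factorial_Ring.prime q"
    and P: "P \<lhd> G" "P \<subseteq> E" "P \<noteq> {\<one>}" "card P = q ^ multiplicity q (card E)" and E: "subgroup E G"
    and H: "nilpotent_in G H" "P \<subseteq> H"
    and syl: "\<And>M. maximal_in G M P \<Longrightarrow>
      \<exists>S. subgroup S G \<and> M \<subseteq> S \<and> S <#> H = carrier G \<and> card E = q * card (E \<inter> S)"
    and min: "\<And>N'. N' \<lhd> G \<Longrightarrow> N' \<subseteq> P \<Longrightarrow> N' \<noteq> {\<one>} \<Longrightarrow> N' = P"
  shows "Factorial_Ring.prime (card P)"
proof -
  have sP: "subgroup P G" using P normal_imp_subgroup by blast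
  note cP = subgroup.mem_carrier[OF sP]
  have sH: "subgroup H G" using H(1) nilpotent_in_imp_subgroup by blast
  note cH = subgroup.mem_carrier[OF sH]
  have fP: "finite P" using finite_subgroup_pos[OF fin sP] by blast
  obtain L where L: "subgroup L G" "L \<subset> P" "\<And>k u. k \<in> P \<Longrightarrow> u \<in> H \<Longrightarrow> commutator G k u \<in> L"
    using nilpotent_descends[OF H(1) sP H(2) P(3)] normal.inv_op_closed2[OF P(1)] cH by metis
  obtain M where M: "maximal_in G M P" "L \<subseteq> M" using maximal_in_exists[OF L(1,2) fP] .
  note M' = maximal_inD[OF M(1)]
  obtain S where S: "subgroup S G" "M \<subseteq> S" "S <#> H = carrier G" "card E = q * card (E \<inter> S)"
    using syl[OF M(1)] by blast
  have "\<not> P \<subseteq> S"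
  proof
    assume "P \<subseteq> S"
    then have "card P dvd card (E \<inter> S)"
      using card_subgroup_dvd[OF sP subgroups_Inter_pair[OF E S(1)]] P(2) by blast
    then have "q ^ Suc (multiplicity q (card E)) dvd card E" using P(4) S(4) by simp
    then show False using not_dvd_Suc_multiplicity[OF q] finite_subgroup_pos(1)[OF fin E] by blast
  qed
  then have PS: "P \<inter> S = M"
    using M'(2) M'(4)[OF subgroups_Inter_pair[OF sP S(1)]] S(2) by blast
  note cM = subgroup.mem_carrier[OF M'(1)] and cS = subgroup.mem_carrier[OF S(1)]
  have conjH: "u \<otimes> m \<otimes> inv u \<in> M" if m: "m \<in> M" and u: "u \<in> H" for m u
  proof -
    have "commutator G (inv m) u \<in> M"
      using L(3)[of "inv m" u] M(2) m u M'(2) subgroup.m_inv_closed[OF sP, of m] by blast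
    then show ?thesis
      using conj_eq_commutator[OF cM[OF m] cH[OF u]] subgroup.m_closed[OF M'(1) m] by simp
  qed
  have "M \<lhd> G"
  proof (rule normal_invI[OF M'(1)])
    fix g m assume g: "g \<in> carrier G" and m: "m \<in> M"
    obtain s u where su: "s \<in> S" "u \<in> H" "g = s \<otimes> u" using g S(3) unfolding set_mult_def by blast
    have "g \<otimes> m \<otimes> inv g = s \<otimes> (u \<otimes> m \<otimes> inv u) \<otimes> inv s"
      unfolding su(3) using cS[OF su(1)] cH[OF su(2)] cM[OF m] by (simp add: inv_mult_group m_assoc)
    moreover have "s \<otimes> k \<otimes> inv s \<in> M" if k: "k \<in> M" for k
    proof -
      have "s \<otimes> k \<otimes> inv s \<in> P" using normal.inv_op_closed2[OF P(1) cS[OF su(1)]] M'(2) k by blast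
      moreover have "s \<otimes> k \<otimes> inv s \<in> S"
        using su(1) k S(2) subgroup.m_closed[OF S(1)] subgroup.m_inv_closed[OF S(1)] by auto
      ultimately show ?thesis using PS by blast
    qed
    ultimately show "g \<otimes> m \<otimes> inv g \<in> M" using conjH[OF m su(2)] by simp
  qed
  then have M1: "M = {\<one>}" using min M'(2,3) by blast
  obtain r where "Factorial_Ring.prime r" "card P = r * card M"
  proof (rule maximal_normal_prime_index[OF sP fP M(1)])
    show "\<And>m u. m \<in> M \<Longrightarrow> u \<in> P \<Longrightarrow> u \<otimes> m \<otimes> inv u \<in> M" using conjH H(2) by blast
  qed
  then show ?thesis using M1 by simp
qed

text \<open>Serves twice: a nontrivial \<open>D\<close> gives the descent in the induction, and the
  trivial \<open>D\<close> moves a group over an arbitrary type to the naturals.\<close>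

lemma (in group) quotient_sylowizer_condition:
  assumes fin: "finite (carrier G)" and F: "formation F"
    and cond: "sylowizer_condition G E" and GE: "in_class F (G Mod E)"
    and D: "D \<lhd> G" "D \<subseteq> E"
  obtains K :: "nat monoid" and E' where "group K" "finite (carrier K)" "order G = card D * order K"
    "sylowizer_condition K E'" "in_class F (K Mod E')" "G Mod D \<cong> K"
proof -
  obtain K :: "nat monoid" and h where K: "group K" "finite (carrier K)" "group_hom G K h"
    "h ` carrier G = carrier K" "kernel G K h = D" "G Mod D \<cong> K"
    using quotient_nat[OF fin D(1)] by blast
  interpret K: group K by fact
  interpret h: group_hom G K h by fact
  have E: "E \<lhd> G" using cond unfolding sylowizer_condition_def by blast
  interpret E: normal E G by fact
  have hE: "h ` E \<lhd> K" using E.surj_hom_normal_subgroup[OF h.group_hom_axioms K(4)] .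
  interpret hE: normal "h ` E" K by fact
  interpret Q: group "K Mod h ` E" using hE.factorgroup_is_group .
  have c: "sylowizer_condition K (h ` E)"
    using h.sylowizer_condition_image[OF fin K(4) cond] K(5) D(2) by blast
  have sD: "subgroup D G" using D(1) normal_imp_subgroup by blast
  have oG: "order G = card D * order K"
    using h.card_subgroup_image[OF subgroup_self _ fin] K(4,5) subgroup.subset[OF sD] by (simp add: order_def)
  have "(\<lambda>y. h ` E #>\<^bsub>K\<^esub> y) \<circ> h \<in> hom G (K Mod h ` E)"
    using Group.hom_compose[OF h.homh hE.r_coset_hom_Mod] .
  then interpret f: group_hom G "K Mod h ` E" "(\<lambda>y. h ` E #>\<^bsub>K\<^esub> y) \<circ> h" by unfold_locales
  \<comment> \<open>With this kernel the first isomorphism theorem identifies \<open>G Mod E\<close>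
    with the quotient of \<open>K\<close> by the image of \<open>E\<close>, and class membership
    follows along.\<close>
  have "kernel G (K Mod h ` E) ((\<lambda>y. h ` E #>\<^bsub>K\<^esub> y) \<circ> h) = E"
  proof
    show "E \<subseteq> kernel G (K Mod h ` E) ((\<lambda>y. h ` E #>\<^bsub>K\<^esub> y) \<circ> h)"
      using hE.rcos_const[OF K(1)] E.subset by (auto simp: kernel_def)
    show "kernel G (K Mod h ` E) ((\<lambda>y. h ` E #>\<^bsub>K\<^esub> y) \<circ> h) \<subseteq> E"
    proof
      fix x assume "x \<in> kernel G (K Mod h ` E) ((\<lambda>y. h ` E #>\<^bsub>K\<^esub> y) \<circ> h)"
      then have x: "x \<in> carrier G" "h ` E #>\<^bsub>K\<^esub> h x = h ` E" by (auto simp: kernel_def)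
      then have "h x \<in> h ` E" using K.rcos_self[OF _ hE.subgroup_axioms, of "h x"] by simp
      then obtain e where e: "e \<in> E" "h x = h e" by blast
      have ec: "e \<in> carrier G" using e(1) E.subset by blast
      have "x \<otimes> inv e \<in> kernel G K h" using x(1) ec e(2) by (simp add: kernel_def)
      then have "x \<otimes> inv e \<in> E" using K(5) D(2) by blast
      then have "x \<otimes> inv e \<otimes> e \<in> E" using e(1) E.m_closed by blast
      then show "x \<in> E" using x(1) ec by (simp add: m_assoc)
    qed
  qed
  moreover have "((\<lambda>y. h ` E #>\<^bsub>K\<^esub> y) \<circ> h) ` carrier G = carrier (K Mod h ` E)"
    unfolding carrier_FactGroup K(4)[symmetric] by (simp add: image_comp)
  ultimately have "G Mod E \<cong> K Mod h ` E" using f.FactGroup_iso by simp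
  then have "in_class F (K Mod h ` E)" using in_class_iso[OF GE _ E.factorgroup_is_group] by blast
  then show thesis using that K(1,2,6) oG c by blast
qed

lemma sylowizer_condition_in_class:
  fixes G :: "nat monoid" (structure)
  assumes F: "saturated_formation F"
    and super: "\<forall>K :: nat monoid. group K \<and> finite (carrier K) \<and> supersoluble K \<longrightarrow> K \<in> F"
    and "group G" "finite (carrier G)" "sylowizer_condition G E" "in_class F (G Mod E)"
  shows "G \<in> F"
  using assms(3-)
proof (induction "order G" arbitrary: G E rule: less_induct)
  case (less G E)
  interpret group G by fact
  note fin = less.prems(2) and cond = less.prems(3)
  have form: "formation F" and gc: "group_class F"
    using F unfolding saturated_formation_def formation_def by blast+
  have triv: "G \<in> F" if "in_class F (G Mod {\<one>\<^bsub>G\<^esub>})"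
    using in_class_iso[OF that iso_Mod_triv normal.factorgroup_is_group[OF one_is_normal]]
      in_class_nat[OF gc less.prems(1)] by simp
  show ?case
  proof (cases "E = {\<one>\<^bsub>G\<^esub>}")
    case True
    then show ?thesis using triv less.prems(4) by simp
  next
    case False
    have quot: "in_class F (G Mod D)" if D: "D \<lhd> G" "D \<subseteq> E" "D \<noteq> {\<one>\<^bsub>G\<^esub>}" for D
    proof -
      obtain K :: "nat monoid" and E' where K: "group K" "finite (carrier K)" "order G = card D * order K"
        "sylowizer_condition K E'" "in_class F (K Mod E')" "G Mod D \<cong> K"
        using quotient_sylowizer_condition[OF fin form cond less.prems(4) D(1,2)] .
      have sD: "subgroup D G" using D(1) normal_imp_subgroup by blast
      have "card D \<noteq> 1" using D(3) card_subgroup_eq_one[OF sD] by blast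
      then have "card D > 1" using finite_subgroup_pos(1)[OF fin sD] by simp
      moreover have "order K > 0" using K(1,2) by (simp add: group.is_monoid monoid.order_gt_0_iff_finite)
      ultimately have lt: "order K < order G" using K(3) by simp
      have "K \<in> F" using less.hyps[OF lt K(1,2,4,5)] .
      then show ?thesis using K(6) unfolding in_class_def by blast
    qed
    obtain q P where q: "Factorial_Ring.prime q" and P: "P \<lhd> G" "P \<subseteq> E" "P \<noteq> {\<one>\<^bsub>G\<^esub>}" "nilpotent_in G P"
      "card P = q ^ multiplicity q (card E)"
      and cm: "cyclic_in G P \<or> (\<exists>H. nilpotent_in G H \<and> P \<subseteq> H \<and>
        (\<forall>M. maximal_in G M P \<longrightarrow>
          (\<exists>S. subgroup S G \<and> M \<subseteq> S \<and> S <#>\<^bsub>G\<^esub> H = carrier G \<and> card E = q * card (E \<inter> S))))"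
      using sylowizer_condition_normal_sylow[OF fin cond False] .
    have sE: "subgroup E G" using cond normal_imp_subgroup unfolding sylowizer_condition_def by blast
    have sP: "subgroup P G" using P(1) normal_imp_subgroup by blast
    note cP = subgroup.mem_carrier[OF sP]
    \<comment> \<open>The centre of \<open>P\<close>. Choosing \<open>N\<close> inside it is what
      later makes \<open>N\<close> centralize \<open>P \<inter> L\<close>.\<close>
    let ?Z = "P \<inter> centralizer G P"
    have "\<exists>z\<in>?Z. z \<noteq> \<one>\<^bsub>G\<^esub>"
    proof (rule nilpotent_center[OF P(4,3)])
      fix z assume "z \<in> P" "z \<noteq> \<one>\<^bsub>G\<^esub>" "\<And>u. u \<in> P \<Longrightarrow> z \<otimes>\<^bsub>G\<^esub> u = u \<otimes>\<^bsub>G\<^esub> z"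
      then show ?thesis using cP unfolding centralizer_def by auto
    qed
    then have "?Z \<noteq> {\<one>\<^bsub>G\<^esub>}" by blast
    then obtain N where N: "N \<lhd> G" "N \<subseteq> ?Z" "N \<noteq> {\<one>\<^bsub>G\<^esub>}"
      and min: "\<And>N'. N' \<lhd> G \<Longrightarrow> N' \<subseteq> N \<Longrightarrow> N' \<noteq> {\<one>\<^bsub>G\<^esub>} \<Longrightarrow> N' = N"
      using minimal_normal_exists[OF fin normal_subgroup_intersect[OF P(1) centralizer_normal[OF P(1)]]] by blast
    have NP: "N \<subseteq> P" using N(2) by blast
    have sN: "subgroup N G" using N(1) normal_imp_subgroup by blast
    note cN = subgroup.mem_carrier[OF sN]
    have GN: "in_class F (G Mod N)" using quot[OF N(1) _ N(3)] NP P(2) by blast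
    show ?thesis
    proof (cases "N \<subseteq> frattini G")
      case True
      then have "in_class F (G Mod frattini G)" using in_class_Mod_mono[OF form N(1) frattini_normal _ GN] by blast
      then show ?thesis using F less.prems(1) fin unfolding saturated_formation_def by blast
    next
      case False
      then obtain L where "maximal_subgroup L G" and NL: "\<not> N \<subseteq> L"
        unfolding frattini_def using subgroup.subset[OF sN] by blast
      then have max: "maximal_in G L (carrier G)" using maximal_subgroup_iff by blast
      note L = maximal_inD[OF max]
      note cL = subgroup.mem_carrier[OF L(1)]
      have LN: "L <#>\<^bsub>G\<^esub> N = carrier G"
      proof -
        have "subgroup (L <#>\<^bsub>G\<^esub> N) G"
          using subgroup_mult_normal[OF L(1) N(1)] .
        then show ?thesis
          using L(4)[of "L <#>\<^bsub>G\<^esub> N"] subset_set_mult_subgroup[OF L(1) sN] NL subgroup.subset by blast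
      qed
      let ?K = "P \<inter> L"
      have K: "?K \<lhd> G"
      proof (rule normal_invI)
        show "subgroup ?K G" using subgroups_Inter_pair[OF sP L(1)] .
        fix g k assume g: "g \<in> carrier G" and k: "k \<in> ?K"
        obtain l n where ln: "l \<in> L" "n \<in> N" "g = l \<otimes>\<^bsub>G\<^esub> n" using g LN unfolding set_mult_def by blast
        have cc: "l \<in> carrier G" "n \<in> carrier G" "k \<in> carrier G" using ln k cL cN by auto
        have nk: "n \<otimes>\<^bsub>G\<^esub> k = k \<otimes>\<^bsub>G\<^esub> n" using ln(2) k N(2) unfolding centralizer_def by auto
        have "g \<otimes>\<^bsub>G\<^esub> k \<otimes>\<^bsub>G\<^esub> inv\<^bsub>G\<^esub> g = l \<otimes>\<^bsub>G\<^esub> (n \<otimes>\<^bsub>G\<^esub> k) \<otimes>\<^bsub>G\<^esub> inv\<^bsub>G\<^esub> n \<otimes>\<^bsub>G\<^esub> inv\<^bsub>G\<^esub> l"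
          unfolding ln(3) using cc by (simp add: inv_mult_group m_assoc)
        also have "\<dots> = l \<otimes>\<^bsub>G\<^esub> k \<otimes>\<^bsub>G\<^esub> inv\<^bsub>G\<^esub> l"
          unfolding nk using cc by (simp add: m_assoc)
        finally have "g \<otimes>\<^bsub>G\<^esub> k \<otimes>\<^bsub>G\<^esub> inv\<^bsub>G\<^esub> g = l \<otimes>\<^bsub>G\<^esub> k \<otimes>\<^bsub>G\<^esub> inv\<^bsub>G\<^esub> l" .
        moreover have "l \<otimes>\<^bsub>G\<^esub> k \<otimes>\<^bsub>G\<^esub> inv\<^bsub>G\<^esub> l \<in> L"
          using ln(1) k subgroup.m_closed[OF L(1)] subgroup.m_inv_closed[OF L(1)] by simp
        ultimately show "g \<otimes>\<^bsub>G\<^esub> k \<otimes>\<^bsub>G\<^esub> inv\<^bsub>G\<^esub> g \<in> ?K"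
          using normal.inv_op_closed2[OF P(1) g, of k] k by simp
      qed
      show ?thesis
      proof (cases "?K = {\<one>\<^bsub>G\<^esub>}")
        case False
        then have GK: "in_class F (G Mod ?K)" using quot[OF K] P(2) by blast
        \<comment> \<open>This normal subgroup lies in \<open>N\<close> but differs from it because
          \<open>N\<close> is not inside \<open>L\<close>; minimality leaves only the trivial
          group.\<close>
        have "N \<inter> ?K \<lhd> G" using normal_subgroup_intersect[OF N(1) K] .
        then have "N \<inter> ?K = {\<one>\<^bsub>G\<^esub>}" using min NL by blast
        then have "in_class F (G Mod {\<one>\<^bsub>G\<^esub>})"
          using formation_inter[OF form less.prems(1) fin N(1) K GN GK] by simp
        then show ?thesis using triv by blast
      next
        case True
        \<comment> \<open>Dedekind's argument: for \<open>x = l \<otimes> n\<close> in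
          \<open>P\<close>, the factor \<open>l\<close> lies in \<open>P \<inter> L\<close>, which
          is trivial.\<close>
        have "P \<subseteq> N"
        proof
          fix x assume x: "x \<in> P"
          obtain l n where ln: "l \<in> L" "n \<in> N" "x = l \<otimes>\<^bsub>G\<^esub> n"
            using cP[OF x] LN unfolding set_mult_def by blast
          have "l = x \<otimes>\<^bsub>G\<^esub> inv\<^bsub>G\<^esub> n" using ln cL cN by (simp add: m_assoc)
          moreover have "x \<otimes>\<^bsub>G\<^esub> inv\<^bsub>G\<^esub> n \<in> P"
            using x ln(2) NP subgroup.m_closed[OF sP] subgroup.m_inv_closed[OF sP] by blast
          ultimately have "l \<in> ?K" using ln(1) by simp
          then have "l = \<one>\<^bsub>G\<^esub>" using True by blast
          then show "x \<in> N" using ln cN by simp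
        qed
        then have PN: "P = N" using NP by blast
        have "card P \<noteq> 1" using P(3) card_subgroup_eq_one[OF sP] by blast
        then have "multiplicity q (card E) \<noteq> 0" using P(5) by (metis power_0)
        then have qP: "q dvd card P" using P(5) dvd_power[of "multiplicity q (card E)" q] by simp
        have "Factorial_Ring.prime (card P)"
          using cm
        proof (elim disjE exE conjE)
          assume "cyclic_in G P"
          then show ?thesis
            using minimal_normal_cyclic_prime_order[OF fin q qP P(1)] min PN q by metis
        next
          fix H assume "nilpotent_in G H" "P \<subseteq> H" "\<forall>M. maximal_in G M P \<longrightarrow>
            (\<exists>S. subgroup S G \<and> M \<subseteq> S \<and> S <#>\<^bsub>G\<^esub> H = carrier G \<and> card E = q * card (E \<inter> S))"
          then show ?thesis
            using minimal_normal_sylowizer_prime_order[OF fin q P(1-3,5) sE] min PN by metis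
        qed
        then show ?thesis
          using normal_prime_order_in_class[OF F super less.prems(1) fin P(1) _] GN PN by simp
      qed
    qed
  qed
qed

section \<open>From sylowizers to supplements\<close>

lemma (in group) nilpotent_in_subgroup:
  assumes U: "nilpotent_in G U" and V: "subgroup V G" "V \<subseteq> U"
  shows "nilpotent_in G V"
proof -
  obtain W n where "central_series G W n U" using nilpotent_in_series[OF U] by blast
  note W = central_seriesD[OF this]
  have comm: "commutator G x g \<in> W i \<inter> V" if i: "i < n" and x: "x \<in> W (Suc i) \<inter> V" and g: "g \<in> V" for i x g
  proof -
    have "commutator G x g \<in> V" unfolding commutator_def
      using x g subgroup.m_closed[OF V(1)] subgroup.m_inv_closed[OF V(1)] by simp
    then show ?thesis using W(6)[OF i, of x g] x g V(2) by blast
  qed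
  have "W 0 \<inter> V = {\<one>}" using W(1) subgroup.one_closed[OF V(1)] by blast
  moreover have "W n \<inter> V = V" using W(2) V(2) by blast
  moreover have "subgroup (W i \<inter> V) G" if "i \<le> n" for i using subgroups_Inter_pair[OF W(3)[OF that] V(1)] .
  moreover have "W i \<inter> V \<subseteq> W (Suc i) \<inter> V" if "i < n" for i using W(5)[OF that] by blast
  ultimately show ?thesis
    unfolding nilpotent_in_def using V(1) comm
    by (intro conjI exI[of _ n] exI[of _ "\<lambda>i. W i \<inter> V"]) auto
qed

lemma (in group) prime_index_maximal_in:
  assumes fin: "finite (carrier G)" and p: "Factorial_Ring.prime p"
    and U: "subgroup U G" and M: "subgroup M G" "M \<subseteq> U" "card U = p * card M"
  shows "maximal_in G M U"
  unfolding maximal_in_def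
proof (intro conjI allI impI)
  have pos: "card M > 0" using finite_subgroup_pos[OF fin M(1)] by blast
  show "M \<noteq> U" using M(3) pos prime_gt_1_nat[OF p] by auto
  fix K assume K: "subgroup K G \<and> M \<subseteq> K \<and> K \<subseteq> U"
  obtain c where c: "card K = card M * c" using card_subgroup_dvd[OF M(1)] K by blast
  have "card K dvd card U" using card_subgroup_dvd[OF _ U] K by blast
  then have "c dvd p" using c M(3) pos by (simp add: mult.commute)
  then consider "c = 1" | "c = p" using p by (metis One_nat_def prime_nat_iff)
  then show "K = M \<or> K = U"
  proof cases
    case 1
    then have "M = K" using K c finite_subgroup_pos[OF fin] by (intro card_subset_eq) auto
    then show ?thesis by simp
  next
    case 2
    then have "K = U" using K c M(3) finite_subgroup_pos(2)[OF fin U] by (intro card_subset_eq) auto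
    then show ?thesis by simp
  qed
qed (use M in auto)

text \<open>Since elements of coprime order commute in a nilpotent group, the cosets of its Sylow subgroup \<open>P\<close>
  have representatives centralizing \<open>P\<close>, and \<open>M'\<close> is the kernel of the transfer to \<open>P/M\<close>.\<close>

lemma (in group) nilpotent_group_extend_maximal:
  assumes fin: "finite (carrier G)" and nil: "nilpotent_in G (carrier G)"
    and p: "Factorial_Ring.prime p"
    and P: "subgroup P G" "card P = p ^ multiplicity p (order G)" and M: "maximal_in G M P"
  obtains M' where "subgroup M' G" "P \<inter> M' = M" "order G = p * card M'"
proof -
  note cP = subgroup.mem_carrier[OF P(1)]
  note M' = maximal_inD[OF M]
  have oG: "order G > 0" using fin order_gt_0_iff_finite by simp
  have nP: "nilpotent_in G P" using nilpotent_in_subgroup[OF nil P(1)] subgroup.subset[OF P(1)] .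
  have fP: "finite P" using finite_subgroup_pos[OF fin P(1)] by blast
  obtain A :: "'a set monoid" and lam where A: "comm_group A" and oA: "order A = p"
    and lam: "lam \<in> hom (G\<lparr>carrier := P\<rparr>) A" and lamM: "\<And>u. u \<in> P \<Longrightarrow> lam u = \<one>\<^bsub>A\<^esub> \<longleftrightarrow> u \<in> M"
    using nilpotent_maximal_quotient[OF fin p nP P(2) M] by blast
  interpret A: comm_group A by fact
  let ?N = "p_residual G p"
  have N: "subgroup ?N G" using p_residual_normal normal_imp_subgroup by blast
  let ?C = "centralizer G P"
  have C: "subgroup ?C G" using centralizer_subgroup subgroup.subset[OF P(1)] .
  have NC: "?N \<subseteq> ?C"
  proof (rule p_residual_subset[OF C])
    fix x k assume x: "x \<in> carrier G" "\<not> p dvd k" "x [^] (k::nat) = \<one>"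
    have "x \<otimes> u = u \<otimes> x" if u: "u \<in> P" for u
      using nilpotent_in_commute[OF nil x(1) cP[OF u] x(3) pow_card_subgroup_eq_one[OF P(1) u]]
        prime_not_dvd_coprime_power[OF p x(2)] P(2) by simp
    then show "x \<in> ?C" using x(1) unfolding centralizer_def by blast
  qed
  have "\<exists>t. \<forall>C\<in>rcosets P. t C \<in> C \<inter> ?N"
  proof (rule bchoice, rule ballI)
    fix C assume "C \<in> rcosets P"
    then obtain g where g: "g \<in> carrier G" "C = P #> g" unfolding RCOSETS_def by blast
    have "g \<in> P <#> ?N" using sylow_mult_p_residual[OF fin p P] g by simp
    then obtain u n where un: "u \<in> P" "n \<in> ?N" "g = u \<otimes> n" unfolding set_mult_def by blast
    have "n = inv u \<otimes> g" using un cP subgroup.mem_carrier[OF N] by simp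
    then have "n \<in> C" using g(2) subgroup.m_inv_closed[OF P(1) un(1)] unfolding r_coset_def by blast
    then show "\<exists>x. x \<in> C \<inter> ?N" using un by blast
  qed
  then obtain t where t: "\<And>C. C \<in> rcosets P \<Longrightarrow> t C \<in> C" "\<And>C. C \<in> rcosets P \<Longrightarrow> t C \<in> ?N" by auto
  have tr: "transversal G P t" unfolding transversal_def using t by blast
  define V where "V = (\<lambda>g. finprod A (\<lambda>C. lam (transfer_factor G t C g)) (rcosets P))"
  have V: "V \<in> hom G A" unfolding V_def using transfer_hom[OF P(1) fin A.comm_group_axioms lam tr] .
  then interpret V: group_hom G A V by unfold_locales
  \<comment> \<open>The representative commutes with \<open>u\<close>, so \<open>u\<close> can be
    moved to the left and absorbed by \<open>P\<close>; every coset is therefore fixed by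
    \<open>u\<close>.\<close>
  have tf: "transfer_factor G t C u = u" if C: "C \<in> rcosets P" and u: "u \<in> P" for C u
  proof -
    note tC = transversal_closed[OF P(1) tr C]
    have tu: "t C \<otimes> u = u \<otimes> t C" using t(2)[OF C] NC u unfolding centralizer_def by blast
    have "C #> u = P #> (t C \<otimes> u)"
      using coset_mult_assoc[OF subgroup.subset[OF P(1)] tC(1) cP[OF u]] tC(2) by simp
    also have "\<dots> = P #> u #> t C"
      unfolding tu using coset_mult_assoc[OF subgroup.subset[OF P(1)] cP[OF u] tC(1)] by simp
    also have "P #> u = P" using coset_join2[OF cP[OF u] P(1) u] .
    finally have "C #> u = C" using tC(2) by simp
    then show ?thesis unfolding transfer_factor_def tu using \<open>C #> u = C\<close> tC(1) cP[OF u] by (simp add: m_assoc)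
  qed
  let ?n = "card (rcosets P)"
  have lamc: "lam u \<in> carrier A" if "u \<in> P" for u using hom_in_carrier[OF lam] that by simp
  have VP: "V u = lam u [^]\<^bsub>A\<^esub> ?n" if u: "u \<in> P" for u
  proof -
    have "V u = finprod A (\<lambda>C. lam u) (rcosets P)"
      unfolding V_def using tf u lamc[OF u] by (intro A.finprod_cong') auto
    also have "\<dots> = lam u [^]\<^bsub>A\<^esub> ?n" by (rule A.finprod_const[OF lamc[OF u]])
    finally show ?thesis .
  qed
  note ndn = sylow_index_not_dvd[OF fin p P]
  have V1: "V u = \<one>\<^bsub>A\<^esub> \<longleftrightarrow> u \<in> M" if u: "u \<in> P" for u
  proof
    assume "V u = \<one>\<^bsub>A\<^esub>"
    then have "lam u [^]\<^bsub>A\<^esub> ?n = \<one>\<^bsub>A\<^esub>" using VP[OF u] by simp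
    moreover have "lam u [^]\<^bsub>A\<^esub> p = \<one>\<^bsub>A\<^esub>" using A.pow_order_eq_1[OF lamc[OF u]] oA by simp
    ultimately have "lam u = \<one>\<^bsub>A\<^esub>"
      using A.pow_coprime_one[OF lamc[OF u], of ?n p] prime_not_dvd_coprime_power[OF p ndn, of 1] by simp
    then show "u \<in> M" using lamM[OF u] by blast
  next
    assume "u \<in> M"
    then have "lam u = \<one>\<^bsub>A\<^esub>" using lamM[OF u] by blast
    then show "V u = \<one>\<^bsub>A\<^esub>" using VP[OF u] by simp
  qed
  let ?K = "kernel G A V"
  have K: "subgroup ?K G" using V.subgroup_kernel .
  have PK: "P \<inter> ?K = M" using V1 M'(2) cP by (auto simp: kernel_def)
  have oV: "order G = card ?K * card (V ` carrier G)"
    using V.card_subgroup_image[OF subgroup_self _ fin] subgroup.subset[OF K] by (simp add: order_def)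
  have img: "subgroup (V ` carrier G) A" using V.img_is_subgroup .
  have "card (V ` carrier G) dvd p" using A.card_subgroup_dvd_order[OF img] oA by simp
  moreover have "card (V ` carrier G) \<noteq> 1"
  proof
    assume "card (V ` carrier G) = 1"
    then have "V ` carrier G = {\<one>\<^bsub>A\<^esub>}" using A.card_subgroup_eq_one[OF img] by blast
    then have "V u = \<one>\<^bsub>A\<^esub>" if "u \<in> P" for u using cP[OF that] by blast
    then have "P \<subseteq> M" using V1 by blast
    then show False using M'(2,3) by blast
  qed
  ultimately have "card (V ` carrier G) = p" using p by (metis One_nat_def prime_nat_iff)
  then show thesis using that[OF K PK] oV by (simp add: mult.commute)
qed

lemma (in group) nilpotent_extend_maximal:
  assumes fin: "finite (carrier G)" and nil: "nilpotent_in G U" and p: "Factorial_Ring.prime p"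
    and P: "subgroup P G" "P \<subseteq> U" "card P = p ^ multiplicity p (card U)" and M: "maximal_in G M P"
  obtains M' where "maximal_in G M' U" "P \<inter> M' = M" "card U = p * card M'"
proof -
  have U: "subgroup U G" using nil nilpotent_in_imp_subgroup by blast
  let ?U = "G\<lparr>carrier := U\<rparr>"
  interpret UG: group ?U using subgroup_imp_group[OF U] .
  have "finite (carrier ?U)" using finite_subgroup_pos[OF fin U] by simp
  moreover have "nilpotent_in ?U (carrier ?U)" using nilpotent_in_restrict[OF U nil] by simp
  moreover have "subgroup P ?U" using subgroup_restrict_iff[OF U] P by blast
  moreover have "maximal_in ?U M P" using maximal_in_restrict[OF U P(2)] M by blast
  ultimately obtain M' where M': "subgroup M' ?U" "P \<inter> M' = M" "order ?U = p * card M'"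
    using UG.nilpotent_group_extend_maximal[OF _ _ p, of P M] P(3) by (auto simp: order_def)
  have "subgroup M' G" "M' \<subseteq> U" using M'(1) subgroup_restrict_iff[OF U] by auto
  moreover have "card U = p * card M'" using M'(3) by (simp add: order_def)
  ultimately show thesis using prime_index_maximal_in[OF fin p U] M'(2) that by blast
qed

lemma (in group) cyclic_in_subgroup:
  assumes fin: "finite (carrier G)" and U: "cyclic_in G U" and V: "subgroup V G" "V \<subseteq> U"
  shows "cyclic_in G V"
proof -
  obtain u where sU: "subgroup U G" and u: "u \<in> U" and gen: "\<And>y. y \<in> U \<Longrightarrow> \<exists>k::nat. y = u [^] k"
    using U unfolding cyclic_in_def by blast
  have uc: "u \<in> carrier G" using subgroup.mem_carrier[OF sU u] .
  define d :: nat where "d = (LEAST d. d > 0 \<and> u [^] d \<in> V)"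
  \<comment> \<open>The order of \<open>G\<close> is an admissible positive exponent, so the least
    one exists.\<close>
  have ex: "order G > 0 \<and> u [^] order G \<in> V"
    using pow_order_eq_1[OF uc] subgroup.one_closed[OF V(1)] fin order_gt_0_iff_finite by simp
  have d: "d > 0" "u [^] d \<in> V" using LeastI[of "\<lambda>d::nat. d > 0 \<and> u [^] d \<in> V", OF ex] unfolding d_def by auto
  have least: "k = 0" if "k < d" "u [^] k \<in> V" for k :: nat
    using not_less_Least[of k "\<lambda>d::nat. d > 0 \<and> u [^] d \<in> V"] that by (simp add: d_def)
  have "\<exists>k::nat. y = (u [^] d) [^] k" if y: "y \<in> V" for y
  proof -
    obtain i :: nat where i: "y = u [^] i" using gen y V(2) by blast
    have dk: "(u [^] d) [^] (i div d) \<in> V"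
      using subgroup_int_pow_closed[OF V(1) d(2), of "int (i div d)"] by (simp add: int_pow_int)
    have "y = (u [^] d) [^] (i div d) \<otimes> u [^] (i mod d)"
      using i uc by (simp add: nat_pow_pow nat_pow_mult)
    then have "u [^] (i mod d) = inv ((u [^] d) [^] (i div d)) \<otimes> y" using uc by simp
    then have "u [^] (i mod d) \<in> V"
      using dk y subgroup.m_closed[OF V(1)] subgroup.m_inv_closed[OF V(1)] by simp
    moreover have "i mod d < d" using d(1) by simp
    ultimately have "i mod d = 0" using least by blast
    then have "y = (u [^] d) [^] (i div d)" using \<open>y = (u [^] d) [^] (i div d) \<otimes> u [^] (i mod d)\<close> uc by simp
    then show ?thesis by blast
  qed
  then show ?thesis unfolding cyclic_in_def using V(1) d(2) by blast
qed

section \<open>Hall subgroups, conjugates and sylowizers\<close>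

text \<open>Both sides split one number into an \<open>s\<close>-part and a part prime to
  \<open>s\<close>: \<open>a\<close> is coprime to \<open>w\<close>, hence divides \<open>b\<close>,
  and symmetrically.\<close>

lemma pi_part_unique:
  fixes a :: nat
  assumes eq: "a * v = b * w" and pos: "a * v > 0"
    and a: "\<And>q. Factorial_Ring.prime q \<Longrightarrow> q dvd a \<Longrightarrow> q \<in> s" and b: "\<And>q. Factorial_Ring.prime q \<Longrightarrow> q dvd b \<Longrightarrow> q \<in> s"
    and v: "\<And>q. Factorial_Ring.prime q \<Longrightarrow> q dvd v \<Longrightarrow> q \<notin> s" and w: "\<And>q. Factorial_Ring.prime q \<Longrightarrow> q dvd w \<Longrightarrow> q \<notin> s"
  shows "a = b"
proof -
  have cop: "coprime x y"
    if "\<And>q. Factorial_Ring.prime q \<Longrightarrow> q dvd x \<Longrightarrow> q \<in> s" "\<And>q. Factorial_Ring.prime q \<Longrightarrow> q dvd y \<Longrightarrow> q \<notin> s" for x y :: nat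
  proof (rule ccontr)
    assume "\<not> coprime x y"
    then have "gcd x y \<noteq> 1" using coprime_iff_gcd_eq_1 by blast
    then obtain q where "Factorial_Ring.prime q" "q dvd gcd x y" using prime_factor_nat by blast
    then show False using that by auto
  qed
  have "a dvd b * w" "b dvd a * v" using eq by (metis dvd_triv_left)+
  then have "a dvd b" "b dvd a"
    using coprime_dvd_mult_left_iff[OF cop[OF a w]] coprime_dvd_mult_left_iff[OF cop[OF b v]] by auto
  then show ?thesis by (rule dvd_antisym)
qed

lemma (in group) subgroup_set_mult_commuting:
  assumes A: "subgroup A G" and B: "subgroup B G" and comm: "A <#> B = B <#> A"
  shows "subgroup (A <#> B) G"
proof (rule subgroupI)
  note sA = subgroup.subset[OF A] and sB = subgroup.subset[OF B]
  show "A <#> B \<subseteq> carrier G" using set_mult_closed[OF sA sB] .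
  show "A <#> B \<noteq> {}" using subset_set_mult_subgroup[OF A B] subgroup.one_closed[OF A] by blast
next
  fix x assume "x \<in> A <#> B"
  then obtain a b where ab: "a \<in> A" "b \<in> B" "x = a \<otimes> b" unfolding set_mult_def by blast
  have "inv x = inv b \<otimes> inv a"
    using ab subgroup.mem_carrier[OF A] subgroup.mem_carrier[OF B] by (simp add: inv_mult_group)
  then have "inv x \<in> B <#> A"
    using ab subgroup.m_inv_closed[OF A] subgroup.m_inv_closed[OF B] unfolding set_mult_def by blast
  then show "inv x \<in> A <#> B" using comm by simp
next
  note sA = subgroup.subset[OF A] and sB = subgroup.subset[OF B]
  fix x y assume xy: "x \<in> A <#> B" "y \<in> A <#> B"
  then have "x \<otimes> y \<in> (A <#> B) <#> (A <#> B)" unfolding set_mult_def by blast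
  also have "(A <#> B) <#> (A <#> B) = A <#> (B <#> A) <#> B"
    using sA sB set_mult_closed by (simp add: set_mult_assoc)
  also have "\<dots> = (A <#> A) <#> (B <#> B)"
    unfolding comm[symmetric] using sA sB set_mult_closed by (simp add: set_mult_assoc)
  also have "\<dots> = A <#> B" using subgroup_mult_id A B by simp
  finally show "x \<otimes> y \<in> A <#> B" .
qed

lemma (in group) conj_set_subgroup:
  assumes T: "subgroup T G" and x: "x \<in> carrier G"
  shows "subgroup (conj_set G T x) G" "card (conj_set G T x) = card T"
proof -
  note cT = subgroup.mem_carrier[OF T]
  have eq: "conj_set G T x = (\<lambda>y. inv x \<otimes> y \<otimes> inv (inv x)) ` T"
    unfolding conj_set_def l_coset_def r_coset_def using x by auto
  interpret c: group_hom G G "\<lambda>y. inv x \<otimes> y \<otimes> inv (inv x)" using conj_group_hom(1)[OF inv_closed[OF x]] .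
  show "subgroup (conj_set G T x) G" unfolding eq using c.subgroup_img_is_subgroup[OF T] .
  have "inj_on (\<lambda>y. inv x \<otimes> y \<otimes> inv (inv x)) T"
    using x cT by (intro inj_onI) (simp add: m_assoc)
  then show "card (conj_set G T x) = card T" unfolding eq by (rule card_image)
qed

text \<open>Turns coset counts in a restricted group into factorizations of orders, the form in
  which the index comparisons below are made.\<close>

lemma (in group) hall_subgroupD:
  assumes "subgroup U G" "hall_subgroup s R (G\<lparr>carrier := U\<rparr>)"
  shows "subgroup R G" "R \<subseteq> U"
    "\<And>q. Factorial_Ring.prime q \<Longrightarrow> q dvd card R \<Longrightarrow> q \<in> s"
    "\<exists>v. card U = card R * v \<and> (\<forall>q\<in>s. \<not> q dvd v)"
proof -
  interpret U: group "G\<lparr>carrier := U\<rparr>" using subgroup_imp_group[OF assms(1)] .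
  have R: "subgroup R (G\<lparr>carrier := U\<rparr>)" using assms(2) unfolding hall_subgroup_def pi_subgroup_def by blast
  then show "subgroup R G" "R \<subseteq> U" using subgroup_restrict_iff[OF assms(1)] by auto
  show "\<And>q. Factorial_Ring.prime q \<Longrightarrow> q dvd card R \<Longrightarrow> q \<in> s"
    using assms(2) unfolding hall_subgroup_def pi_subgroup_def pi_number_def by blast
  have "card U = card R * card (rcosets\<^bsub>G\<lparr>carrier := U\<rparr>\<^esub> R)"
    using U.lagrange[OF R] by (simp add: order_def mult.commute)
  then show "\<exists>v. card U = card R * v \<and> (\<forall>q\<in>s. \<not> q dvd v)"
    using assms(2) unfolding hall_subgroup_def by blast
qed

lemma (in group) hall_subgroupI:
  assumes fin: "finite (carrier G)" and U: "subgroup U G" and R: "subgroup R G" "R \<subseteq> U"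
    and "\<And>q. Factorial_Ring.prime q \<Longrightarrow> q dvd card R \<Longrightarrow> q \<in> s"
    and v: "card U = card R * v" "\<And>q. q \<in> s \<Longrightarrow> \<not> q dvd v"
  shows "hall_subgroup s R (G\<lparr>carrier := U\<rparr>)"
proof -
  interpret U: group "G\<lparr>carrier := U\<rparr>" using subgroup_imp_group[OF U] .
  have R': "subgroup R (G\<lparr>carrier := U\<rparr>)" using R subgroup_restrict_iff[OF U] by blast
  have pos: "card R > 0" using finite_subgroup_pos[OF fin R(1)] by blast
  have "card (rcosets\<^bsub>G\<lparr>carrier := U\<rparr>\<^esub> R) * card R = v * card R"
    using U.lagrange[OF R'] v(1) by (simp add: order_def mult.commute)
  then have "card (rcosets\<^bsub>G\<lparr>carrier := U\<rparr>\<^esub> R) = v" using pos by simp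
  then show ?thesis
    unfolding hall_subgroup_def pi_subgroup_def pi_number_def using R' pos assms(5) v(2) by blast
qed

text \<open>The index of \<open>H \<inter> E\<close> in \<open>E\<close> equals that of
  \<open>H\<close> in \<open>H <#> E\<close>, which divides the index of \<open>H\<close> in
  \<open>G\<close>.\<close>

lemma (in group) hall_subgroup_inter_normal:
  assumes fin: "finite (carrier G)" and H: "hall_subgroup s H G" and E: "E \<lhd> G"
  obtains w where "card E = card (H \<inter> E) * w" "\<And>q. q \<in> s \<Longrightarrow> \<not> q dvd w"
proof -
  have sE: "subgroup E G" using E normal_imp_subgroup by blast
  have H': "hall_subgroup s H (G\<lparr>carrier := carrier G\<rparr>)" using H by simp
  note HD = hall_subgroupD[OF subgroup_self H']
  obtain v where v: "card (carrier G) = card H * v" "\<forall>q\<in>s. \<not> q dvd v" using HD(4) by blast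
  have HE: "subgroup (H <#> E) G"
    using subgroup_mult_normal[OF HD(1) E] .
  note sub = subset_set_mult_subgroup[OF HD(1) sE]
  obtain w where w: "card (H <#> E) = card H * w" using card_subgroup_dvd[OF HD(1) HE sub(1)] by blast
  have pos: "card H > 0" using finite_subgroup_pos[OF fin HD(1)] by blast
  have "card H * w dvd card H * v"
    using card_subgroup_dvd_order[OF HE] w v(1) by (simp add: order_def)
  then have "w dvd v" using pos by simp
  then have "\<not> q dvd w" if "q \<in> s" for q using v(2) that dvd_trans by blast
  moreover have "card E = card (H \<inter> E) * w"
    using card_set_mult[OF HD(1) sE fin] w pos by (simp add: mult.commute mult.left_commute)
  ultimately show thesis using that by blast
qed

text \<open>A \<open>\<sigma>\<^sub>i\<close>-sylowizer that permutes with a conjugate of a Hall \<open>\<sigma>\<^sub>j\<close>-subgroup, \<open>j \<noteq> i\<close>,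
  contains this conjugate by maximality.\<close>

lemma (in group) sylowizer_hall_dvd:
  assumes fin: "finite (carrier G)" and S: "sylowizer s R S G" and T: "subgroup T G"
    and disj: "\<And>q. Factorial_Ring.prime q \<Longrightarrow> q dvd card T \<Longrightarrow> q \<notin> s" and s: "\<And>q. q \<in> s \<Longrightarrow> Factorial_Ring.prime q"
    and perm: "c_permutable G S T"
  shows "card T dvd card S"
proof -
  have sS: "subgroup S G" and hall: "hall_subgroup s R (G\<lparr>carrier := S\<rparr>)"
    and max: "\<And>U. subgroup U G \<Longrightarrow> hall_subgroup s R (G\<lparr>carrier := U\<rparr>) \<Longrightarrow> S \<subseteq> U \<Longrightarrow> U = S"
    using S unfolding sylowizer_def by blast+
  note R = hall_subgroupD[OF sS hall]
  obtain v where v: "card S = card R * v" "\<forall>q\<in>s. \<not> q dvd v" using R(4) by blast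
  obtain x where x: "x \<in> carrier G" "S <#> conj_set G T x = conj_set G T x <#> S"
    using perm unfolding c_permutable_def by blast
  let ?T = "conj_set G T x"
  note Tx = conj_set_subgroup[OF T x(1)]
  let ?W = "S <#> ?T"
  have W: "subgroup ?W G" using subgroup_set_mult_commuting[OF sS Tx(1) x(2)] .
  note sub = subset_set_mult_subgroup[OF sS Tx(1)]
  obtain c where c: "card ?W = card S * c" using card_subgroup_dvd[OF sS W sub(1)] by blast
  have "card S > 0" using finite_subgroup_pos[OF fin sS] by blast
  then have "card T = c * card (S \<inter> ?T)"
    using card_set_mult[OF sS Tx(1) fin] c Tx(2) by (simp add: mult.assoc)
  then have cT: "c dvd card T" by simp
  \<comment> \<open>The product has order \<open>card R\<close> times \<open>v * c\<close>, where
    \<open>c\<close> divides the order of \<open>T\<close>; so \<open>R\<close> remains a Hall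
    subgroup of it and maximality of \<open>S\<close> applies.\<close>
  have "\<not> q dvd v * c" if q: "q \<in> s" for q
  proof
    assume "q dvd v * c"
    then have "q dvd c" using v(2) q prime_dvd_mult_iff[OF s[OF q]] by blast
    then show False using disj[OF s[OF q]] cT q dvd_trans by blast
  qed
  then have "hall_subgroup s R (G\<lparr>carrier := ?W\<rparr>)"
    using hall_subgroupI[OF fin W R(1) _ R(3), of "v * c"] R(2) sub(1) c v(1) by (simp add: mult.assoc)
  then have "?W = S" using max[OF W] sub(1) by blast
  then have "?T \<subseteq> S" using sub(2) by simp
  then show ?thesis using card_subgroup_dvd[OF Tx(1) sS] Tx(2) by simp
qed

text \<open>All equalities compare \<open>s\<close>-parts. The index \<open>b\<close> of
  \<open>S\<close> is an \<open>s\<close>-number, so the \<open>s\<close>-part of the order of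
  \<open>G\<close> is both \<open>card M * b\<close> and \<open>card H\<close>; and
  \<open>S \<inter> H\<close> is an \<open>s\<close>-group containing the Hall subgroup
  \<open>M\<close> of \<open>S\<close>, so it is \<open>M\<close>. Inside \<open>E\<close>, the
  index of \<open>E \<inter> S\<close> is an \<open>s\<close>-number while \<open>p * card M\<close>
  is the full \<open>s\<close>-part.\<close>

lemma (in group) sylowizer_index:
  assumes fin: "finite (carrier G)" and s: "\<And>q. q \<in> s \<Longrightarrow> Factorial_Ring.prime q"
    and H: "hall_subgroup s H G" and E: "E \<lhd> G"
    and M: "M \<subseteq> H \<inter> E" "card (H \<inter> E) = p * card M" and p: "p \<in> s"
    and S: "sylowizer s M S G"
    and idx: "\<And>q b. order G = card S * b \<Longrightarrow> Factorial_Ring.prime q \<Longrightarrow> q dvd b \<Longrightarrow> q \<in> s"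
  shows "S <#> H = carrier G" "card E = p * card (E \<inter> S)"
proof -
  have sS: "subgroup S G" and hall: "hall_subgroup s M (G\<lparr>carrier := S\<rparr>)"
    using S unfolding sylowizer_def by blast+
  note MD = hall_subgroupD[OF sS hall]
  obtain v where v: "card S = card M * v" "\<forall>q\<in>s. \<not> q dvd v" using MD(4) by blast
  have H': "hall_subgroup s H (G\<lparr>carrier := carrier G\<rparr>)" using H by simp
  note HD = hall_subgroupD[OF subgroup_self H']
  obtain u where u: "card (carrier G) = card H * u" "\<forall>q\<in>s. \<not> q dvd u" using HD(4) by blast
  have sE: "subgroup E G" using E normal_imp_subgroup by blast
  have oG: "order G > 0" using fin order_gt_0_iff_finite by simp
  have posS: "card S > 0" and posM: "card M > 0" and posH: "card H > 0"
    using finite_subgroup_pos[OF fin] sS MD(1) HD(1) by blast+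
  obtain b where b: "order G = card S * b" using card_subgroup_dvd_order[OF sS] by blast
  have bs: "q \<in> s" if "Factorial_Ring.prime q" "q dvd b" for q using idx[OF b that] .
  have nv: "q \<notin> s" if "q dvd v" for q using v(2) that by blast
  have nu: "q \<notin> s" if "q dvd u" for q using u(2) that by blast
  have eq: "(card M * b) * v = card H * u"
    using b v(1) u(1) by (simp add: order_def mult.commute mult.left_commute)
  have H_eq: "card M * b = card H"
  proof (rule pi_part_unique[OF eq, of s])
    show "0 < card M * b * v" using eq u(1) oG by (simp add: order_def)
    show "q \<in> s" if "Factorial_Ring.prime q" "q dvd card M * b" for q
      using that MD(3) bs prime_dvd_mult_iff by blast
  qed (use HD(3) nv nu in blast)+
  have SH: "S \<inter> H = M"
  proof -
    have I: "subgroup (S \<inter> H) G" using subgroups_Inter_pair sS HD(1) by blast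
    have MI: "M \<subseteq> S \<inter> H" using MD(2) M(1) by blast
    obtain f where f: "card S = card (S \<inter> H) * f" using card_subgroup_dvd[OF I sS] by blast
    have "card (S \<inter> H) dvd card H" using card_subgroup_dvd[OF I HD(1)] by blast
    then have IH: "q \<in> s" if "Factorial_Ring.prime q" "q dvd card (S \<inter> H)" for q
      using HD(3) that dvd_trans by blast
    obtain e where e: "card (S \<inter> H) = card M * e" using card_subgroup_dvd[OF MD(1) I MI] by blast
    have "e * f = v" using f e v(1) posM by simp
    then have nf: "q \<notin> s" if "q dvd f" for q using nv that dvd_mult by blast
    have "card (S \<inter> H) = card M"
    proof (rule pi_part_unique[of _ f _ v s])
      show "card (S \<inter> H) * f = card M * v" "0 < card (S \<inter> H) * f" using f v(1) posS by auto
    qed (use IH MD(3) nf nv in blast)+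
    then show ?thesis using MI finite_subgroup_pos(2)[OF fin I] by (intro card_subset_eq[symmetric]) auto
  qed
  have "card (S <#> H) * card M = order G * card M"
    using card_set_mult[OF sS HD(1) fin] SH H_eq b by (simp add: mult.commute mult.left_commute)
  then have "card (S <#> H) = card (carrier G)" using posM by (simp add: order_def)
  then show "S <#> H = carrier G"
    using set_mult_closed[OF subgroup.subset[OF sS] subgroup.subset[OF HD(1)]] fin
    by (intro card_subset_eq) auto
  have ES: "subgroup (E \<inter> S) G" using subgroups_Inter_pair sE sS by blast
  have posES: "card (E \<inter> S) > 0" using finite_subgroup_pos[OF fin ES] by blast
  have SE: "subgroup (S <#> E) G"
    using mult_norm_subgroup[OF E sS] commut_normal[OF sS E] by simp
  obtain g where g: "card (S <#> E) = card S * g"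
    using card_subgroup_dvd[OF sS SE subset_set_mult_subgroup(1)[OF sS sE]] by blast
  have "card S * g dvd card S * b" using card_subgroup_dvd_order[OF SE] g b by simp
  then have "g dvd b" using posS by simp
  then have gs: "q \<in> s" if "Factorial_Ring.prime q" "q dvd g" for q using bs that dvd_trans by blast
  have cE: "card E = g * card (E \<inter> S)"
    using card_set_mult[OF sS sE fin] g posS by (simp add: Int_commute mult.assoc)
  have MES: "M \<subseteq> E \<inter> S" using M(1) MD(2) by blast
  obtain k where k: "card (E \<inter> S) = card M * k" using card_subgroup_dvd[OF MD(1) ES MES] by blast
  obtain y where y: "card S = card (E \<inter> S) * y" using card_subgroup_dvd[OF ES sS] by blast
  have "k * y = v" using k y v(1) posM by simp
  then have nk: "q \<notin> s" if "q dvd k" for q using nv that dvd_mult2 by blast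
  obtain w where w: "card E = card (H \<inter> E) * w" "\<And>q. q \<in> s \<Longrightarrow> \<not> q dvd w"
    using hall_subgroup_inter_normal[OF fin H E] by blast
  have "card M * (g * k) = card E" using cE k by simp
  also have "\<dots> = card M * (p * w)" using w(1) M(2) by simp
  finally have gk: "g * k = p * w" using posM by simp
  have "g = p"
  proof (rule pi_part_unique[OF gk, of s])
    show "0 < g * k" using cE k posES finite_subgroup_pos(1)[OF fin sE] by simp
    show "q \<in> s" if "Factorial_Ring.prime q" "q dvd p" for q
      using that p s primes_dvd_imp_eq by blast
  qed (use gs nk w(2) in blast)+
  then show "card E = p * card (E \<inter> S)" using cE by simp
qed

text \<open>Translates a hypothesis about blocks into one condition per prime: \<open>p\<close>
  determines its block \<open>s\<close>, and \<open>H s\<close> becomes the nilpotent subgroup that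
  each \<open>S\<close> supplements.\<close>

lemma (in group) sylowizer_condition_if_c_permutable:
  assumes part: "partition_on {p. Factorial_Ring.prime p} \<sigma>"
    and fin: "finite (carrier G)" and E: "E \<lhd> G"
    and hall: "\<forall>s\<in>sigma_of \<sigma> G. hall_subgroup s (H s) G \<and> nilpotent_group (G\<lparr>carrier := H s\<rparr>)"
    and syl: "\<forall>s\<in>sigma_of \<sigma> (G\<lparr>carrier := E\<rparr>).
           \<not> cyclic_group (G\<lparr>carrier := H s \<inter> E\<rparr>) \<longrightarrow>
           (\<forall>M. maximal_subgroup M (G\<lparr>carrier := H s \<inter> E\<rparr>) \<longrightarrow>
             (\<exists>S. sylowizer s M S G \<and> (\<forall>T\<in>H ` sigma_of \<sigma> G. c_permutable G S T)))"
  shows "sylowizer_condition G E"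
  unfolding sylowizer_condition_def
proof (intro conjI allI impI E)
  have sE: "subgroup E G" using E normal_imp_subgroup by blast
  have oG: "order G > 0" using fin order_gt_0_iff_finite by simp
  fix p assume "Factorial_Ring.prime p \<and> p dvd card E"
  then have p: "Factorial_Ring.prime p" "p dvd card E" by auto
  obtain s where s: "s \<in> \<sigma>" "p \<in> s" using part p(1) unfolding partition_on_def by blast
  have prime: "Factorial_Ring.prime q" if "q \<in> t" "t \<in> \<sigma>" for q t
    using part that unfolding partition_on_def by blast
  have sE': "s \<in> sigma_of \<sigma> (G\<lparr>carrier := E\<rparr>)"
    unfolding sigma_of_def prime_divisors_def using s p by (auto simp: order_def)
  have mem: "t \<in> sigma_of \<sigma> G" if "t \<in> \<sigma>" "q \<in> t" "q dvd order G" for t q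
    unfolding sigma_of_def prime_divisors_def using that prime by blast
  have sG: "s \<in> sigma_of \<sigma> G" using mem s p(2) card_subgroup_dvd_order[OF sE] dvd_trans by blast
  have Hs: "hall_subgroup s (H s) G" and nilg: "nilpotent_group (G\<lparr>carrier := H s\<rparr>)" using hall sG by auto
  have HD: "subgroup (H t) G" "\<And>q. Factorial_Ring.prime q \<Longrightarrow> q dvd card (H t) \<Longrightarrow> q \<in> t"
    "\<exists>v. order G = card (H t) * v \<and> (\<forall>q\<in>t. \<not> q dvd v)" if "t \<in> sigma_of \<sigma> G" for t
    using hall_subgroupD[OF subgroup_self, of t "H t"] hall that by (auto simp: order_def)
  have nil: "nilpotent_in G (H s)" using nilpotent_in_if[OF HD(1)[OF sG] nilg] .
  let ?U = "H s \<inter> E"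
  have U: "subgroup ?U G" using subgroups_Inter_pair HD(1)[OF sG] sE by blast
  have nilU: "nilpotent_in G ?U" using nilpotent_in_subgroup[OF nil U] by blast
  have fU: "finite ?U" "card ?U > 0" using finite_subgroup_pos[OF fin U] by auto
  obtain w where w: "card E = card ?U * w" "\<And>q. q \<in> s \<Longrightarrow> \<not> q dvd w"
    using hall_subgroup_inter_normal[OF fin Hs E] by blast
  have "w > 0" using w(1) finite_subgroup_pos(1)[OF fin sE] by (metis gr0I mult_0_right)
  \<comment> \<open>The cofactor \<open>w\<close> is prime to \<open>s\<close>, in particular to
    \<open>p\<close>, so a Sylow \<open>p\<close>-subgroup of \<open>H s \<inter> E\<close> is one
    of \<open>E\<close>.\<close>
  then have mult: "multiplicity p (card E) = multiplicity p (card ?U)"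
    using w s(2) p(1) fU(2) prime_elem_multiplicity_mult_distrib[of p "card ?U" w]
      not_dvd_imp_multiplicity_0[of p w] by simp
  interpret UG: group "G\<lparr>carrier := ?U\<rparr>" using subgroup_imp_group[OF U] .
  obtain m where "card ?U = p ^ multiplicity p (card ?U) * m" using multiplicity_dvd[of p "card ?U"] by blast
  then obtain P where "subgroup P (G\<lparr>carrier := ?U\<rparr>)" "card P = p ^ multiplicity p (card ?U)"
    using sylow_thm[OF p(1) UG.group_axioms, of "multiplicity p (card ?U)" m] fU by (auto simp: order_def)
  then have P: "subgroup P G" "P \<subseteq> ?U" "card P = p ^ multiplicity p (card ?U)"
    using subgroup_restrict_iff[OF U] by auto
  have nilP: "nilpotent_in G P" using nilpotent_in_subgroup[OF nil P(1)] P(2) by blast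
  have "cyclic_in G P \<or> (\<exists>H. nilpotent_in G H \<and> P \<subseteq> H \<and>
        (\<forall>M. maximal_in G M P \<longrightarrow>
          (\<exists>S. subgroup S G \<and> M \<subseteq> S \<and> S <#> H = carrier G \<and> card E = p * card (E \<inter> S))))"
  proof (cases "cyclic_group (G\<lparr>carrier := ?U\<rparr>)")
    case True
    then have "cyclic_in G ?U" using cyclic_in_iff[OF U fU(1)] by blast
    then show ?thesis using cyclic_in_subgroup[OF fin _ P(1,2)] by blast
  next
    case False
    have "\<exists>S. subgroup S G \<and> M \<subseteq> S \<and> S <#> H s = carrier G \<and> card E = p * card (E \<inter> S)"
      if M: "maximal_in G M P" for M
    proof -
      \<comment> \<open>The hypothesis provides sylowizers for maximal subgroups of
        \<open>?U\<close> only, so \<open>M\<close> is first extended to one that meets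
        \<open>P\<close> in \<open>M\<close>.\<close>
      obtain M' where M': "maximal_in G M' ?U" "P \<inter> M' = M" "card ?U = p * card M'"
        using nilpotent_extend_maximal[OF fin nilU p(1) P M] by blast
      obtain S where S: "sylowizer s M' S G" "\<And>t. t \<in> sigma_of \<sigma> G \<Longrightarrow> c_permutable G S (H t)"
        using syl[rule_format, OF sE' False, of M'] maximal_in_iff[OF U, of M'] M'(1) by auto
      have sS: "subgroup S G" and hallS: "hall_subgroup s M' (G\<lparr>carrier := S\<rparr>)"
        using S(1) unfolding sylowizer_def by blast+
      \<comment> \<open>A prime \<open>q\<close> outside \<open>s\<close> lies in another block
        \<open>t\<close>. The order of \<open>H t\<close> divides that of \<open>S\<close>, so
        \<open>S\<close> takes up the full \<open>q\<close>-part of the order of \<open>G\<close>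
        and leaves none for the index.\<close>
      have idx: "q \<in> s" if b: "order G = card S * b" and q: "Factorial_Ring.prime q" "q dvd b" for q b
      proof (rule ccontr)
        assume "q \<notin> s"
        obtain t where t: "t \<in> \<sigma>" "q \<in> t" using part q(1) unfolding partition_on_def by blast
        have tG: "t \<in> sigma_of \<sigma> G" using mem[OF t] b q(2) by simp
        have "t \<noteq> s" using t(2) \<open>q \<notin> s\<close> by blast
        then have "t \<inter> s = {}" using part t(1) s(1) unfolding partition_on_def disjoint_def by blast
        then have disj: "r \<notin> s" if "Factorial_Ring.prime r" "r dvd card (H t)" for r
          using HD(2)[OF tG that] by blast
        have "card (H t) dvd card S"
          using sylowizer_hall_dvd[OF fin S(1) HD(1)[OF tG] disj prime[OF _ s(1)] S(2)[OF tG]] .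
        then obtain c where c: "card S = card (H t) * c" by blast
        obtain v where v: "order G = card (H t) * v" "\<forall>q\<in>t. \<not> q dvd v" using HD(3)[OF tG] by blast
        have "card (H t) > 0" using finite_subgroup_pos[OF fin HD(1)[OF tG]] by blast
        then have "v = c * b" using v(1) b c by simp
        then have "q dvd v" using q(2) by simp
        then show False using v(2) t(2) by blast
      qed
      have "M \<subseteq> S" using M'(2) hall_subgroupD(2)[OF sS hallS] by blast
      moreover note index = sylowizer_index[OF fin prime[OF _ s(1)] Hs E maximal_inD(2)[OF M'(1)] M'(3) s(2) S(1)]
      have "S <#> H s = carrier G" by (rule index(1)) (auto intro: idx)
      moreover have "card E = p * card (E \<inter> S)" by (rule index(2)) (auto intro: idx)
      ultimately show ?thesis using sS by (intro exI[of _ S]) simp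
    qed
    then show ?thesis using nil P(2) by blast
  qed
  then show "\<exists>P. subgroup P G \<and> P \<subseteq> E \<and> card P = p ^ multiplicity p (card E) \<and> nilpotent_in G P \<and>
      (cyclic_in G P \<or> (\<exists>H. nilpotent_in G H \<and> P \<subseteq> H \<and>
        (\<forall>M. maximal_in G M P \<longrightarrow>
          (\<exists>S. subgroup S G \<and> M \<subseteq> S \<and> S <#> H = carrier G \<and> card E = p * card (E \<inter> S)))))"
    using P nilP mult by (intro exI[of _ P]) auto
qed

theorem theorem2p6:
  fixes F :: "nat monoid set"
    and \<sigma> :: "nat set set"
    and G :: "('a, 'b) monoid_scheme"
    and E :: "'a set"
    and \<H> :: "'a set set"
    and H :: "nat set \<Rightarrow> 'a set"
  assumes "saturated_formation F"
    and "\<forall>K\<in>F. solvable K"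
    and "\<forall>K :: nat monoid. group K \<and> finite (carrier K) \<and> supersoluble K \<longrightarrow> K \<in> F"
    and "partition_on {p. Factorial_Ring.prime p} \<sigma>"
    and "group G" and "finite (carrier G)"
    and "E \<lhd> G" and "in_class F (G Mod E)"
    and "sigma_full_sylow_type \<sigma> G"
    and "complete_hall_set \<sigma> G \<H>"
    and "\<H> = H ` sigma_of \<sigma> G"
    and "\<forall>s\<in>sigma_of \<sigma> G. hall_subgroup s (H s) G \<and> nilpotent_group (G\<lparr>carrier := H s\<rparr>)"
    and "\<forall>s\<in>sigma_of \<sigma> (G\<lparr>carrier := E\<rparr>).
           \<not> cyclic_group (G\<lparr>carrier := H s \<inter> E\<rparr>) \<longrightarrow>
           (\<forall>M. maximal_subgroup M (G\<lparr>carrier := H s \<inter> E\<rparr>) \<longrightarrow>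
             (\<exists>S. sylowizer s M S G \<and> (\<forall>T\<in>\<H>. c_permutable G S T)))"
  shows "in_class F G"
proof -
  interpret group G by fact
  have form: "formation F" using assms(1) unfolding saturated_formation_def by blast
  have cond: "sylowizer_condition G E"
    using sylowizer_condition_if_c_permutable[OF assms(4,6,7,12)] assms(13)[unfolded assms(11)] by blast
  have sE: "subgroup E G" using assms(7) normal_imp_subgroup by blast
  \<comment> \<open>Factoring by the trivial subgroup replaces \<open>G\<close> by an isomorphic
    group on the naturals that satisfies the same condition.\<close>
  obtain K :: "nat monoid" and E' where K: "group K" "finite (carrier K)"
    "sylowizer_condition K E'" "in_class F (K Mod E')" "G Mod {\<one>\<^bsub>G\<^esub>} \<cong> K"
    using quotient_sylowizer_condition[OF assms(6) form cond assms(8) one_is_normal] subgroup.one_closed[OF sE]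
    by blast
  have "K \<in> F" using sylowizer_condition_in_class[OF assms(1,3) K(1-4)] .
  then have "in_class F (G Mod {\<one>\<^bsub>G\<^esub>})" using K(5) unfolding in_class_def by blast
  then show ?thesis
    using in_class_iso[OF _ iso_Mod_triv normal.factorgroup_is_group[OF one_is_normal]] by blast
qed

end
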